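(* (1) Let $0<\alpha<1$. For any $p,q>0$ we have $G_{\alpha,q}(A,B)\prec_{\log}SG_{\alpha,p}(A,B)$ for all $A,B\ge0$ with $s(A)\ge s(B)$. (2) Let $\alpha>1$. For any $p,q>0$ there exist $A,B\in\mathbb{M}_2^{++}$ such that $G_{\alpha,q}(A,B)\not\prec_{\log}SG_{\alpha,p}(A,B)$. (3) Let $\alpha>1$ and $p,q>0$. If $p/q\le\min\bigl\{2,\frac{\alpha}{\alpha-1}\bigr\}$, then $SG_{\alpha,p}(A,B)\prec_{\log}G_{\alpha,q}(A,B)$ for all $A,B\ge0$ with $s(A)\ge s(B)$.
   Context: Notation: $\mathbb{M}_n$ is the set of $n\times n$ complex matrices, $\mathbb{M}_n^+$ (resp. $\mathbb{M}_n^{++}$) the positive semidefinite (resp. positive definite) ones. $A\ge0$ (resp. $A>0$) means $A\in\mathbb{M}_n^+$ (resp. $A\in\mathbb{M}_n^{++}$) for some $n\in\mathbb{N}$; matrices appearing together have the same size. $s(A)$ is the support projection of $A\ge0$. $A^{-1}$ denotes the generalized inverse (the inverse on the support of $A$, zero on the kernel), and $A^r:=(A^{-1})^{-r}$ for $r<0$. For $\alpha>0$ and $A,B\ge0$ with $s(A)\ge s(B)$, $A\#_\alpha B:=A^{1/2}(A^{-1/2}BA^{-1/2})^{\alpha}A^{1/2}$, and $\#:=\#_{1/2}$. For $s(A)\ge s(B)$: $G_{\alpha,p}(A,B):=(A^p\#_\alpha B^p)^{1/p}$ and $SG_{\alpha,p}(A,B):=\bigl((A^{-p}\#B^p)^{\alpha}A^p(A^{-p}\#B^p)^{\alpha}\bigr)^{1/p}$.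 Log-majorization: for $X,Y\in\mathbb{M}_n^+$ with eigenvalues $\lambda_1(\cdot)\ge\dots\ge\lambda_n(\cdot)$ counted with multiplicity, $X\prec_{\log}Y$ means $\prod_{i=1}^k\lambda_i(X)\le\prod_{i=1}^k\lambda_i(Y)$ for $1\le k\le n$, with equality for $k=n$. *)

theory Defs
  imports
    "Jordan_Normal_Form.Schur_Decomposition"
    "Jordan_Normal_Form.Matrix_Kernel"
begin

text \<open>
  The order used on matrices below is the Loewner order.  The library's \<open>\<le>\<close> on
  type \<open>mat\<close> is the entrywise order and is never used here.
\<close>

definition psd_mats :: "nat \<Rightarrow> complex mat set" where
  "psd_mats n = {A \<in> carrier_mat n n. mat_adjoint A = A \<and>
     (\<forall>v \<in> carrier_vec n. 0 \<le> (A *\<^sub>v v) \<bullet>c v)}"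

definition pd_mats :: "nat \<Rightarrow> complex mat set" where
  "pd_mats n = {A \<in> carrier_mat n n. mat_adjoint A = A \<and>
     (\<forall>v \<in> carrier_vec n. v \<noteq> 0\<^sub>v n \<longrightarrow> 0 < (A *\<^sub>v v) \<bullet>c v)}"

definition loewner_le :: "nat \<Rightarrow> complex mat \<Rightarrow> complex mat \<Rightarrow> bool" where
  "loewner_le n A B \<longleftrightarrow> A \<in> carrier_mat n n \<and> B \<in> carrier_mat n n \<and> B - A \<in> psd_mats n"

text \<open>
  The support projection of a Hermitian matrix: the orthogonal projection with the
  same kernel, i.e. the projection onto the orthogonal complement of the kernel.
\<close>

definition supp_proj :: "complex mat \<Rightarrow> complex mat" where
  "supp_proj A = (THE P. P \<in> carrier_mat (dim_row A) (dim_row A) \<and>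
     mat_adjoint P = P \<and> P * P = P \<and> mat_kernel P = mat_kernel A)"

definition unitary_mats :: "nat \<Rightarrow> complex mat set" where
  "unitary_mats n = {U \<in> carrier_mat n n.
     U * mat_adjoint U = 1\<^sub>m n \<and> mat_adjoint U * U = 1\<^sub>m n}"

text \<open>
  Functional calculus for Hermitian matrices.  The result does not depend on
  the choice of the unitary diagonalization.
\<close>

definition mat_fun :: "(real \<Rightarrow> real) \<Rightarrow> complex mat \<Rightarrow> complex mat" where
  "mat_fun f A = (let n = dim_row A in
     THE B. \<exists>U d. U \<in> unitary_mats n \<and>
       A = U * mat_diag n (\<lambda>i. complex_of_real (d i)) * mat_adjoint U \<and>
       B = U * mat_diag n (\<lambda>i. complex_of_real (f (d i))) * mat_adjoint U)"

text \<open>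
  Generalized inverse: as \<open>inverse 0 = 0\<close> for reals, this inverts on the support
  and is zero on the kernel.
\<close>

definition gen_inv :: "complex mat \<Rightarrow> complex mat" where
  "gen_inv A = mat_fun inverse A"

text \<open>
  As \<open>0 powr r = 0\<close> for every \<open>r\<close>, the exponent \<open>r = 0\<close> gives the support projection.
\<close>

definition mat_powr :: "complex mat \<Rightarrow> real \<Rightarrow> complex mat" where
  "mat_powr A r =
     (if r < 0 then mat_fun (\<lambda>x. x powr (- r)) (gen_inv A) else mat_fun (\<lambda>x. x powr r) A)"

definition wt_geo_mean :: "real \<Rightarrow> complex mat \<Rightarrow> complex mat \<Rightarrow> complex mat" where
  "wt_geo_mean \<alpha> A B =
     mat_powr A (1/2) * mat_powr (mat_powr A (-1/2) * B * mat_powr A (-1/2)) \<alpha> * mat_powr A (1/2)"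

abbreviation geo_mean :: "complex mat \<Rightarrow> complex mat \<Rightarrow> complex mat" where
  "geo_mean \<equiv> wt_geo_mean (1/2)"

definition G_mean :: "real \<Rightarrow> real \<Rightarrow> complex mat \<Rightarrow> complex mat \<Rightarrow> complex mat" where
  "G_mean \<alpha> p A B = mat_powr (wt_geo_mean \<alpha> (mat_powr A p) (mat_powr B p)) (1/p)"

definition SG_mean :: "real \<Rightarrow> real \<Rightarrow> complex mat \<Rightarrow> complex mat \<Rightarrow> complex mat" where
  "SG_mean \<alpha> p A B =
     (let C = mat_powr (geo_mean (mat_powr A (- p)) (mat_powr B p)) \<alpha>
      in mat_powr (C * mat_powr A p * C) (1/p))"

text \<open>
  The decreasing list of the eigenvalues, with algebraic multiplicity, of a matrix
  all of whose eigenvalues are real.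
\<close>

definition eigvals_desc :: "complex mat \<Rightarrow> real list" where
  "eigvals_desc X = (THE xs. sorted_wrt (\<ge>) xs \<and>
     char_poly X = (\<Prod>x\<leftarrow>xs. [:- complex_of_real x, 1:]))"

text \<open>Log-majorization, meant for \<open>X\<close> and \<open>Y\<close> in \<open>psd_mats n\<close>; lists are indexed from 0.\<close>

definition log_maj :: "nat \<Rightarrow> complex mat \<Rightarrow> complex mat \<Rightarrow> bool" where
  "log_maj n X Y \<longleftrightarrow>
     (\<forall>k\<in>{1..n}. (\<Prod>i<k. eigvals_desc X ! i) \<le> (\<Prod>i<k. eigvals_desc Y ! i)) \<and>
     (\<Prod>i<n. eigvals_desc X ! i) = (\<Prod>i<n. eigvals_desc Y ! i)"

end

theory Submission imports Defs begin

text \<open>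
  Write \<open>F = A\<^bsup>p\<^esup>\<close>, \<open>H = B\<^bsup>p\<^esup>\<close> and \<open>E = F\<^bsup>-1\<^esup> # H\<close>, so that \<open>E F E = H\<close>.  By passing to compound matrices
  (antisymmetric tensor powers) and scaling \<open>B\<close>, both majorizations reduce to implications between
  the operator inequalities \<open>SG \<le> 1\<close> and \<open>G \<le> 1\<close>; the determinants agree.

  For \<open>\<alpha> < 1\<close>, \<open>SG \<le> 1\<close> says \<open>F \<le> E\<^bsup>-2\<alpha>\<^esup>\<close>, hence \<open>H = E F E \<le> E\<^bsup>2-2\<alpha>\<^esup>\<close>.  Loewner--Heinz and monotonicity of
  the weighted geometric mean give \<open>G \<le> 1\<close> for \<open>q \<le> p\<close>, and the Ando--Hiai inequality covers \<open>q > p\<close>.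

  For \<open>\<alpha> > 1\<close> and \<open>p / q \<le> min 2 (\<alpha> / (\<alpha> - 1))\<close>, \<open>G \<le> 1\<close> implies \<open>H \<le> F\<^bsup>\<theta>\<^esup>\<close> with \<open>\<theta> = 1 - 1/\<alpha>\<close>.  Then
  \<open>F \<le> c E\<^bsup>-2\<alpha>\<^esup>\<close> implies \<open>E F E = H \<le> c\<^bsup>\<theta>\<^esup> E\<^bsup>2-2\<alpha>\<^esup>\<close>, that is \<open>F \<le> c\<^bsup>\<theta>\<^esup> E\<^bsup>-2\<alpha>\<^esup>\<close>; iterating yields \<open>c = 1\<close>.

  For every \<open>\<alpha> > 1\<close>, a large gap between the eigenvalues of \<open>F\<close> makes the norm of \<open>G\<close> exceed that of \<open>SG\<close>
  as soon as \<open>E\<close> has a nonzero off-diagonal entry in an eigenbasis of \<open>F\<close>.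
\<close>

section \<open>Adjoints and the spectral theorem\<close>

text \<open>The product of the k largest eigenvalues of a positive semidefinite matrix is the norm
  of its k-th compound, and compounds respect products, adjoints and powers, hence both means; so
  only norms have to be compared. Both means are homogeneous of the same degree \<alpha> in B,
  whatever p and q are, which is why the bound 1 is enough. Singular arguments are treated
  asymmetrically: A occurs with negative powers, which are not continuous at singular matrices, so
  it is altered exactly on its kernel; B occurs with positive powers only and is approximated by
  definite matrices.

  For \<alpha> > 1 the obstacle is that the power \<alpha> is not operator monotone, so G \<le> 1 is
  usable only after a root has been taken. The two terms of the minimum come from two ways of doing
  this, with A, B written for the q-th powers: for \<alpha> \<ge> 2, where \<alpha> / (\<alpha> - 1)
  \<le> 2, the reversed mean has inner exponent 1 - \<alpha> and yields B^(\<alpha>/(\<alpha>-1))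
  \<le> A; for \<alpha> < 2 a mean of the inverses has weight \<alpha> - 1 in (0, 1) and is compared
  with B^(-2).\<close>

lemma adj_index [simp]:
  "i < dim_col A \<Longrightarrow> j < dim_row A \<Longrightarrow> mat_adjoint A $$ (i, j) = cnj (A $$ (j, i))" for A :: "complex mat"
  unfolding mat_adjoint_def by (simp add: mat_of_rows_index)

lemma dim_adj [simp]:
  "dim_row (mat_adjoint A) = dim_col A" "dim_col (mat_adjoint A) = dim_row A" for A :: "complex mat"
  unfolding mat_adjoint_def by auto

lemma adj_carrier [simp]: "A \<in> carrier_mat n m \<Longrightarrow> mat_adjoint A \<in> carrier_mat m n" for A :: "complex mat"
  by (intro carrier_matI) auto

lemma adj_mult:
  fixes A B :: "complex mat"
  assumes "A \<in> carrier_mat n m" "B \<in> carrier_mat m k"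
  shows "mat_adjoint (A * B) = mat_adjoint B * mat_adjoint A"
  by (rule eq_matI) (use assms in \<open>auto simp: scalar_prod_def mult.commute intro!: sum.cong\<close>)

lemma adj_adj [simp]: "mat_adjoint (mat_adjoint A) = A" for A :: "complex mat"
  by (rule eq_matI) auto

lemma adj_add: "A \<in> carrier_mat n m \<Longrightarrow> B \<in> carrier_mat n m \<Longrightarrow>
  mat_adjoint (A + B) = mat_adjoint A + mat_adjoint B" for A B :: "complex mat"
  by (rule eq_matI) auto

lemma adj_minus: "A \<in> carrier_mat n m \<Longrightarrow> B \<in> carrier_mat n m \<Longrightarrow>
  mat_adjoint (A - B) = mat_adjoint A - mat_adjoint B" for A B :: "complex mat"
  by (rule eq_matI) auto

lemma adj_smult: "mat_adjoint (c \<cdot>\<^sub>m A) = cnj c \<cdot>\<^sub>m mat_adjoint A" for A :: "complex mat"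
  by (rule eq_matI) auto

lemma adj_one [simp]: "mat_adjoint (1\<^sub>m n) = (1\<^sub>m n :: complex mat)"
  by (rule eq_matI) auto

lemma adj_diag [simp]: "mat_adjoint (mat_diag n f) = mat_diag n (\<lambda>i. cnj (f i))"
  by (rule eq_matI) (auto simp: mat_diag_def)

lemma ip_adj:
  fixes A :: "complex mat"
  assumes "A \<in> carrier_mat n m" "v \<in> carrier_vec m" "w \<in> carrier_vec n"
  shows "(A *\<^sub>v v) \<bullet>c w = v \<bullet>c (mat_adjoint A *\<^sub>v w)"
proof -
  have "(A *\<^sub>v v) \<bullet>c w = (\<Sum>i<n. \<Sum>j<m. A $$ (i,j) * v $ j * cnj (w $ i))"
    using assms by (auto simp: scalar_prod_def lessThan_atLeast0 sum_distrib_right intro!: sum.cong)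
  also have "\<dots> = (\<Sum>j<m. \<Sum>i<n. A $$ (i,j) * v $ j * cnj (w $ i))" by (rule sum.swap)
  also have "\<dots> = v \<bullet>c (mat_adjoint A *\<^sub>v w)"
    using assms by (auto simp: scalar_prod_def lessThan_atLeast0 sum_distrib_left mult_ac intro!: sum.cong)
  finally show ?thesis .
qed

lemma unitary_matsD:
  assumes "U \<in> unitary_mats n"
  shows "U \<in> carrier_mat n n" "U * mat_adjoint U = 1\<^sub>m n" "mat_adjoint U * U = 1\<^sub>m n"
  using assms by (auto simp: unitary_mats_def)

lemma unitary_matsI:
  assumes "U \<in> carrier_mat n n" "mat_adjoint U * U = 1\<^sub>m n"
  shows "U \<in> unitary_mats n"
  using assms mat_mult_left_right_inverse[of "mat_adjoint U" n U] by (auto simp: unitary_mats_def)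

lemma unitary_mats_mult:
  assumes "U \<in> unitary_mats n" "V \<in> unitary_mats n"
  shows "U * V \<in> unitary_mats n"
proof (rule unitary_matsI)
  note U = unitary_matsD[OF assms(1)] and V = unitary_matsD[OF assms(2)]
  show "U * V \<in> carrier_mat n n" using U V by auto
  have "mat_adjoint (U * V) * (U * V) = mat_adjoint V * (mat_adjoint U * U * V)"
    using U(1) V(1) by (simp add: adj_mult[of _ n n _ n] assoc_mult_mat[of _ n n _ n _ n] mult_carrier_mat[of _ n n _ n])
  then show "mat_adjoint (U * V) * (U * V) = 1\<^sub>m n" using U V by simp
qed

lemma ip_self:
  fixes v :: "complex vec"
  assumes "v \<in> carrier_vec n"
  shows "v \<bullet>c v = complex_of_real (\<Sum>i<n. (cmod (v $ i))\<^sup>2)"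
  using assms by (auto simp: scalar_prod_def lessThan_atLeast0 complex_norm_square[symmetric] intro!: sum.cong)

lemma ip_self_pos:
  fixes v :: "complex vec"
  assumes "v \<in> carrier_vec n" "v \<noteq> 0\<^sub>v n"
  shows "0 < Re (v \<bullet>c v)"
proof -
  obtain i where i: "i < n" "v $ i \<noteq> 0" using assms by (auto simp: vec_eq_iff)
  have "0 < (\<Sum>i<n. (cmod (v $ i))\<^sup>2)"
    by (rule sum_pos2[of _ i]) (use i in auto)
  then show ?thesis using ip_self[OF assms(1)] by simp
qed

lemma exists_eigenvector:
  fixes A :: "complex mat"
  assumes A: "A \<in> carrier_mat n n" and n: "0 < n"
  obtains e v where "v \<in> carrier_vec n" "v \<noteq> 0\<^sub>v n" "A *\<^sub>v v = e \<cdot>\<^sub>v v"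
proof -
  from char_poly_factorized[OF A] obtain as where
    as: "char_poly A = (\<Prod>a\<leftarrow>as. [:- a, 1:])" "length as = n" by blast
  with n obtain e es where "as = e # es" by (cases as) auto
  then have "eigenvalue A e" unfolding eigenvalue_root_char_poly[OF A] using as by auto
  then show thesis using that A unfolding eigenvalue_def eigenvector_def by auto
qed

text \<open>Gram-Schmidt applied to a basis that starts with \<open>v\<close> keeps \<open>v\<close>
  in first place; dividing by the norms makes the resulting orthogonal basis orthonormal.\<close>

lemma unitary_first_col:
  fixes v :: "complex vec"
  assumes v: "v \<in> carrier_vec n" "v \<noteq> 0\<^sub>v n" and n: "0 < n"
  obtains U c where "U \<in> unitary_mats n" "col U 0 = c \<cdot>\<^sub>v v"
proof -
  interpret cof_vec_space n "TYPE(complex)" .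
  define b where "b = basis_completion v"
  define ws where "ws = gram_schmidt n b"
  from basis_completion[OF v, folded b_def] have dist_b: "distinct b"
    and indep: "\<not> lin_dep (set b)" and b: "set b \<subseteq> carrier_vec n" and hdb: "hd b = v"
    and len_b: "length b = n" by auto
  from hdb len_b n obtain vs where bv: "b = v # vs" by (cases b) auto
  from gram_schmidt_result[OF b dist_b indep refl, folded ws_def]
  have ws: "set ws \<subseteq> carrier_vec n" "corthogonal ws" "length ws = n" by (auto simp: len_b)
  from gram_schmidt_hd[OF v(1), of vs, folded bv] have hdws: "hd ws = v" unfolding ws_def .
  then have ws0: "ws ! 0 = v" using ws(3) n by (cases ws) auto
  define c where "c i = complex_of_real (1 / sqrt (Re (ws ! i \<bullet>c ws ! i)))" for i
  define U where "U = mat n n (\<lambda>(i,j). c j * ws ! j $ i)"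
  have U: "U \<in> carrier_mat n n" by (auto simp: U_def)
  have wsi: "ws ! i \<in> carrier_vec n" if "i < n" for i using ws that by auto
  have "mat_adjoint U * U = 1\<^sub>m n"
  proof (rule eq_matI)
    fix i j assume "i < dim_row (1\<^sub>m n :: complex mat)" "j < dim_col (1\<^sub>m n :: complex mat)"
    then have i: "i < n" and j: "j < n" by auto
    have "(mat_adjoint U * U) $$ (i,j) = (\<Sum>k<n. c i * c j * (ws ! j $ k * cnj (ws ! i $ k)))"
      using i j wsi by (auto simp: U_def scalar_prod_def lessThan_atLeast0 c_def intro!: sum.cong)
    also have "\<dots> = c i * c j * (ws ! j \<bullet>c ws ! i)"
      using wsi[OF i] wsi[OF j] by (simp add: scalar_prod_def lessThan_atLeast0 sum_distrib_left)
    also have "\<dots> = 1\<^sub>m n $$ (i,j)"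
    proof (cases "i = j")
      case True
      have ne: "ws ! i \<bullet>c ws ! i \<noteq> 0" using ws(2) i ws(3) corthogonalD by blast
      have re: "ws ! i \<bullet>c ws ! i = complex_of_real (Re (ws ! i \<bullet>c ws ! i))" using ip_self[OF wsi[OF i]] by simp
      have "Re (ws ! i \<bullet>c ws ! i) \<ge> 0" using ip_self[OF wsi[OF i]] by (simp add: sum_nonneg)
      with ne re have pos: "Re (ws ! i \<bullet>c ws ! i) > 0" by (metis of_real_0 order_less_le)
      define x where "x = Re (ws ! i \<bullet>c ws ! i)"
      have "c i * c i * (ws ! i \<bullet>c ws ! i) = of_real (1 / sqrt x * (1 / sqrt x) * x)"
      proof -
        have "c i = of_real (1 / sqrt x)" by (simp add: c_def x_def)
        moreover have "ws ! i \<bullet>c ws ! i = of_real x" unfolding x_def by (rule re)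
        ultimately show ?thesis by (simp only: of_real_mult)
      qed
      also have "1 / sqrt x * (1 / sqrt x) * x = 1" using pos by (simp add: x_def[symmetric])
      finally show ?thesis using True i by simp
    next
      case False
      then have "ws ! j \<bullet>c ws ! i = 0" using ws(2,3) i j corthogonalD by blast
      then show ?thesis using False i j by simp
    qed
    finally show "(mat_adjoint U * U) $$ (i,j) = 1\<^sub>m n $$ (i,j)" .
  qed (use U in auto)
  then have "U \<in> unitary_mats n" by (rule unitary_matsI[OF U])
  moreover have "col U 0 = c 0 \<cdot>\<^sub>v v"
    using n v ws0 by (intro eq_vecI) (auto simp: U_def)
  ultimately show thesis by (rule that)
qed

text \<open>Deflation: in an orthonormal basis whose first vector is an eigenvector, the first
  column is a multiple of the first unit vector. Hermitian symmetry gives the same for the first row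
  and a real eigenvalue, and the remaining block is Hermitian of size \<open>n\<close>.\<close>

theorem spectral:
  fixes A :: "complex mat"
  assumes "A \<in> carrier_mat n n" "mat_adjoint A = A"
  shows "\<exists>U d. U \<in> unitary_mats n \<and> A = U * mat_diag n (\<lambda>i. complex_of_real (d i)) * mat_adjoint U"
  using assms
proof (induction n arbitrary: A)
  case 0
  then show ?case by (intro exI[of _ "1\<^sub>m 0"]) (auto simp: unitary_mats_def intro!: eq_matI)
next
  case (Suc n A)
  obtain e v where
    v: "v \<in> carrier_vec (Suc n)" "v \<noteq> 0\<^sub>v (Suc n)" "A *\<^sub>v v = e \<cdot>\<^sub>v v"
    by (rule exists_eigenvector[OF Suc.prems(1) zero_less_Suc])
  obtain U c where U: "U \<in> unitary_mats (Suc n)" "col U 0 = c \<cdot>\<^sub>v v"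
    by (rule unitary_first_col[OF v(1,2) zero_less_Suc])
  note Uc = unitary_matsD[OF U(1)]
  note A = Suc.prems
  define B where "B = mat_adjoint U * (A * U)"
  note asc = assoc_mult_mat[of _ "Suc n" "Suc n" _ "Suc n" _ "Suc n"]
  note assoc = asc mult_carrier_mat[of _ "Suc n" "Suc n" _ "Suc n"]
  have B: "B \<in> carrier_mat (Suc n) (Suc n)" using A Uc by (auto simp: B_def)
  have adjB: "mat_adjoint B = B" unfolding B_def using A Uc by (simp add: assoc adj_mult[of _ "Suc n" "Suc n" _ "Suc n"])
  have "A * U = U * B"
  proof -
    have "U * B = U * mat_adjoint U * (A * U)"
      unfolding B_def using A Uc(1) by (intro asc[symmetric]) auto
    then show ?thesis using A Uc by simp
  qed
  have "col (A * U) 0 = A *\<^sub>v col U 0" using A Uc by (intro col_mult2) auto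
  also have "\<dots> = e \<cdot>\<^sub>v col U 0" using A v Uc unfolding U(2) by (simp add: mult_mat_vec smult_smult_assoc mult.commute)
  finally have "col B 0 = e \<cdot>\<^sub>v (mat_adjoint U *\<^sub>v col U 0)"
    unfolding B_def using A Uc by (subst col_mult2[of _ "Suc n" "Suc n" _ "Suc n"]) (auto simp: mult_mat_vec)
  also have "mat_adjoint U *\<^sub>v col U 0 = col (mat_adjoint U * U) 0" 
    using Uc by (subst col_mult2[of _ "Suc n" "Suc n" _ "Suc n"]) auto
  finally have colB: "col B 0 = e \<cdot>\<^sub>v col (1\<^sub>m (Suc n)) 0" using Uc by simp
  have Bi0: "B $$ (i, 0) = (if i = 0 then e else 0)" if "i < Suc n" for i
    using arg_cong[OF colB, of "\<lambda>v. v $ i"] that B by auto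
  have B0i: "B $$ (0, i) = (if i = 0 then e else 0)" if "i < Suc n" for i
  proof -
    have "B $$ (0, i) = cnj (B $$ (i, 0))" using adj_index[of 0 B i] that B by (simp add: adjB)
    moreover have "cnj e = e" using adj_index[of 0 B 0] Bi0[of 0] B by (simp add: adjB)
    ultimately show ?thesis using Bi0[OF that] by auto
  qed
  have e: "e = complex_of_real (Re e)"
    using adj_index[of 0 B 0] Bi0[of 0] B by (auto simp: adjB complex_eq_iff)
  define D where "D = mat n n (\<lambda>(i,j). B $$ (Suc i, Suc j))"
  have D: "D \<in> carrier_mat n n" by (auto simp: D_def)
  have "mat_adjoint D = D"
  proof (rule eq_matI)
    fix i j assume "i < dim_row D" "j < dim_col D"
    then show "mat_adjoint D $$ (i,j) = D $$ (i,j)"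
      using adj_index[of "Suc i" B "Suc j"] B by (auto simp: D_def adjB)
  qed (use D in auto)
  from Suc.IH[OF D this] obtain V d where
    V: "V \<in> unitary_mats n" and DV: "D = V * mat_diag n (\<lambda>i. complex_of_real (d i)) * mat_adjoint V" by blast
  note Vc = unitary_matsD[OF V]
  let ?o = "1\<^sub>m 1 :: complex mat"
  let ?fb = "\<lambda>X Y. four_block_mat X (0\<^sub>m 1 n) (0\<^sub>m n 1) Y :: complex mat"
  define W where "W = ?fb ?o V"
  define d' where "d' i = (case i of 0 \<Rightarrow> Re e | Suc i \<Rightarrow> d i)" for i
  have W: "W \<in> carrier_mat (Suc n) (Suc n)" using Vc by (auto simp: W_def)
  have adjW: "mat_adjoint W = ?fb ?o (mat_adjoint V)"
    by (rule eq_matI) (use Vc in \<open>auto simp: W_def\<close>)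
  have diag: "mat_diag (Suc n) (\<lambda>i. complex_of_real (d' i)) = ?fb (e \<cdot>\<^sub>m ?o) (mat_diag n (\<lambda>i. complex_of_real (d i)))"
    by (rule eq_matI) (use e in \<open>auto simp: mat_diag_def d'_def split: nat.splits\<close>)
  have fbm: "?fb X Y * ?fb X' Y' = ?fb (X * X') (Y * Y')"
    if "X \<in> carrier_mat 1 1" "X' \<in> carrier_mat 1 1" "Y \<in> carrier_mat n n" "Y' \<in> carrier_mat n n" for X X' Y Y'
    using that by (subst mult_four_block_mat[of _ 1 1 _ n _ n _ _ 1 _ n]) auto
  have "mat_adjoint W * W = 1\<^sub>m (Suc n)"
    unfolding adjW using Vc by (subst W_def, subst fbm) auto
  then have WU: "W \<in> unitary_mats (Suc n)" by (rule unitary_matsI[OF W])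
  let ?D = "mat_diag n (\<lambda>i. complex_of_real (d i))"
  have "W * mat_diag (Suc n) (\<lambda>i. complex_of_real (d' i)) * mat_adjoint W
    = ?fb (?o * (e \<cdot>\<^sub>m ?o)) (V * ?D) * ?fb ?o (mat_adjoint V)"
    unfolding adjW unfolding W_def diag using Vc by (subst fbm) auto
  also have "\<dots> = ?fb (e \<cdot>\<^sub>m ?o) D"
    using Vc by (subst fbm) (auto simp: DV mult_carrier_mat[of _ n n _ n])
  also have "\<dots> = B"
    by (rule eq_matI) (use B Bi0 B0i D in \<open>auto simp: D_def\<close>)
  finally have BW: "B = W * mat_diag (Suc n) (\<lambda>i. complex_of_real (d' i)) * mat_adjoint W" ..
  have "A = A * (U * mat_adjoint U)" using A Uc by simp
  also have "\<dots> = A * U * mat_adjoint U" using A Uc(1) by (intro asc[symmetric]) auto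
  also have "\<dots> = U * B * mat_adjoint U" by (simp add: \<open>A * U = U * B\<close>)
  also have "\<dots> = (U * W) * mat_diag (Suc n) (\<lambda>i. complex_of_real (d' i)) * mat_adjoint (U * W)"
    unfolding BW using Uc(1) W by (simp add: assoc adj_mult[of _ "Suc n" "Suc n" _ "Suc n"])
  finally show ?case using unitary_mats_mult[OF U(1) WU] by blast
qed

section \<open>Functional calculus and the Loewner order\<close>

definition herm :: "nat \<Rightarrow> complex mat \<Rightarrow> bool" where
  "herm n A \<longleftrightarrow> A \<in> carrier_mat n n \<and> mat_adjoint A = A"

abbreviation rdiag :: "nat \<Rightarrow> (nat \<Rightarrow> real) \<Rightarrow> complex mat" where
  "rdiag n d \<equiv> mat_diag n (\<lambda>i. complex_of_real (d i))"

definition qform :: "complex mat \<Rightarrow> complex vec \<Rightarrow> real" where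
  "qform A v = Re ((A *\<^sub>v v) \<bullet>c v)"

text \<open>On Hermitian matrices \<open>qle\<close> is the Loewner order; it carries no Hermiticity requirement.\<close>

definition qle :: "nat \<Rightarrow> complex mat \<Rightarrow> complex mat \<Rightarrow> bool" where
  "qle n A B \<longleftrightarrow> (\<forall>v \<in> carrier_vec n. qform A v \<le> qform B v)"

text \<open>One formula for all real exponents: as \<open>0 powr r = 0\<close>, negative powers of a
  positive semidefinite matrix are powers of its generalized inverse, which gives
  \<open>mat_powr_pw\<close>.\<close>

definition pw :: "complex mat \<Rightarrow> real \<Rightarrow> complex mat" where
  "pw A r = mat_fun (\<lambda>x. x powr r) A"

lemma ip_cnj:
  fixes v w :: "complex vec"
  assumes "v \<in> carrier_vec n" "w \<in> carrier_vec n"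
  shows "v \<bullet>c w = cnj (w \<bullet>c v)"
  using assms by (auto simp: scalar_prod_def mult.commute intro!: sum.cong)

lemma ip_sum:
  fixes v w :: "complex vec"
  assumes "v \<in> carrier_vec n" "w \<in> carrier_vec n"
  shows "v \<bullet>c w = (\<Sum>i<n. v $ i * cnj (w $ i))"
  using assms by (auto simp: scalar_prod_def lessThan_atLeast0)

text \<open>If \<open>r\<close> lay in a gap of the closed set \<open>R\<close>, the midpoint of the
  two end points \<open>l\<close> and \<open>u\<close> of that gap would be a point of
  \<open>R\<close> inside the gap.\<close>

lemma midpoint_closed_interval:
  fixes R :: "real set"
  assumes "closed R" "0 \<in> R" "1 \<in> R" "\<And>s t. s \<in> R \<Longrightarrow> t \<in> R \<Longrightarrow> (s + t) / 2 \<in> R"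
    and r: "0 \<le> r" "r \<le> 1"
  shows "r \<in> R"
proof (rule ccontr)
  assume nr: "r \<notin> R"
  have "compact ({0..r} \<inter> R)" "compact ({r..1} \<inter> R)"
    using assms(1) by (auto intro: compact_Int_closed)
  moreover have "{0..r} \<inter> R \<noteq> {}" "{r..1} \<inter> R \<noteq> {}" using assms(2,3) r by force+
  ultimately obtain l u where l: "l \<in> {0..r} \<inter> R" "\<And>x. x \<in> {0..r} \<inter> R \<Longrightarrow> x \<le> l"
    and u: "u \<in> {r..1} \<inter> R" "\<And>x. x \<in> {r..1} \<inter> R \<Longrightarrow> u \<le> x"
    using compact_attains_sup compact_attains_inf by metis
  have lu: "l < r" "r < u" using l(1) u(1) nr by (auto simp: less_le)
  have m: "(l + u) / 2 \<in> R" using assms(4) l(1) u(1) by blast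
  show False
  proof (cases "(l + u) / 2 \<le> r")
    case True
    then show False using l(2)[of "(l + u) / 2"] m l(1) u(1) lu by auto
  next
    case False
    then show False using u(2)[of "(l + u) / 2"] m l(1) u(1) lu by auto
  qed
qed

text \<open>After division by \<open>x + y\<close> this is z \<le> z^r on [0, 1]. It serves to split
  off \<epsilon> from (x + \<epsilon>)^r in the continuity proof for powers.\<close>

lemma powr_add_le:
  fixes x y r :: real
  assumes "0 \<le> x" "0 \<le> y" "0 < r" "r \<le> 1"
  shows "(x + y) powr r \<le> x powr r + y powr r"
proof (cases "x + y = 0")
  case False
  then have s: "0 < x + y" using assms by simp
  have *: "z / (x + y) \<le> (z / (x + y)) powr r" if "0 \<le> z" "z \<le> x + y" for z
  proof (cases "z = 0")
    case False
    then have "(z / (x + y)) powr 1 \<le> (z / (x + y)) powr r"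
      using that s assms by (intro powr_mono') auto
    then show ?thesis using that s by simp
  qed simp
  have "1 = x / (x + y) + y / (x + y)" using s by (simp add: add_divide_distrib[symmetric])
  also have "\<dots> \<le> (x / (x + y)) powr r + (y / (x + y)) powr r"
    using assms by (intro add_mono *) auto
  also have "\<dots> = (x powr r + y powr r) / (x + y) powr r"
    using assms s by (simp add: powr_divide add_divide_distrib)
  finally show ?thesis using s by (simp add: field_simps)
qed (use assms in auto)

context
  fixes n :: nat
begin

abbreviation "M \<equiv> carrier_mat n n :: complex mat set"
abbreviation "adj \<equiv> mat_adjoint :: complex mat \<Rightarrow> complex mat"

lemmas assoc = assoc_mult_mat[of _ n n _ n _ n]
lemmas mult_M = mult_carrier_mat[of _ n n _ n]
lemmas adj_mul = adj_mult[of _ n n _ n]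
lemmas one_l = left_mult_one_mat[of _ n n]
lemmas one_r = right_mult_one_mat[of _ n n]
lemmas mv_assoc = assoc_mult_mat_vec[of _ n n _ n]
lemmas mv_carrier = mult_mat_vec_carrier[of _ n n]
lemmas mat_simps = assoc mult_M adj_mul one_l one_r

lemma herm_carrier [simp]: "herm n A \<Longrightarrow> A \<in> M"
  and herm_adj [simp]: "herm n A \<Longrightarrow> adj A = A"
  by (auto simp: herm_def)

lemma qform_herm:
  assumes "herm n A" "v \<in> carrier_vec n"
  shows "(A *\<^sub>v v) \<bullet>c v = complex_of_real (qform A v)"
proof -
  have "(A *\<^sub>v v) \<bullet>c v = v \<bullet>c (A *\<^sub>v v)" using ip_adj[of A n n v v] assms by simp
  also have "\<dots> = cnj ((A *\<^sub>v v) \<bullet>c v)" using assms by (intro ip_cnj[of _ n]) (auto intro: mv_carrier)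
  finally show ?thesis by (auto simp: qform_def complex_eq_iff)
qed

lemma hermI: "A \<in> M \<Longrightarrow> adj A = A \<Longrightarrow> herm n A"
  by (simp only: herm_def)

lemma psd_iff: "A \<in> psd_mats n \<longleftrightarrow> herm n A \<and> (\<forall>v \<in> carrier_vec n. 0 \<le> qform A v)"
proof -
  have "A \<in> psd_mats n \<longleftrightarrow> herm n A \<and> (\<forall>v \<in> carrier_vec n. 0 \<le> (A *\<^sub>v v) \<bullet>c v)"
    unfolding psd_mats_def herm_def by blast
  then show ?thesis using qform_herm by (auto simp: less_complex_def less_eq_complex_def)
qed

lemma pd_iff: "A \<in> pd_mats n \<longleftrightarrow> herm n A \<and> (\<forall>v \<in> carrier_vec n. v \<noteq> 0\<^sub>v n \<longrightarrow> 0 < qform A v)"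
proof -
  have "A \<in> pd_mats n \<longleftrightarrow> herm n A \<and> (\<forall>v \<in> carrier_vec n. v \<noteq> 0\<^sub>v n \<longrightarrow> 0 < (A *\<^sub>v v) \<bullet>c v)"
    unfolding pd_mats_def herm_def by blast
  then show ?thesis using qform_herm by (auto simp: less_complex_def less_eq_complex_def)
qed

lemma psdI: "herm n A \<Longrightarrow> (\<And>v. v \<in> carrier_vec n \<Longrightarrow> 0 \<le> qform A v) \<Longrightarrow> A \<in> psd_mats n"
  and psdD: "A \<in> psd_mats n \<Longrightarrow> v \<in> carrier_vec n \<Longrightarrow> 0 \<le> qform A v"
  unfolding psd_iff by blast+

lemma pdI: "herm n A \<Longrightarrow> (\<And>v. v \<in> carrier_vec n \<Longrightarrow> v \<noteq> 0\<^sub>v n \<Longrightarrow> 0 < qform A v) \<Longrightarrow> A \<in> pd_mats n"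
  and pdD: "A \<in> pd_mats n \<Longrightarrow> v \<in> carrier_vec n \<Longrightarrow> v \<noteq> 0\<^sub>v n \<Longrightarrow> 0 < qform A v"
  unfolding pd_iff by blast+

lemma psd_herm [simp]: "A \<in> psd_mats n \<Longrightarrow> herm n A"
  and pd_herm [simp]: "A \<in> pd_mats n \<Longrightarrow> herm n A"
  by (simp_all only: psd_iff pd_iff)

lemma qform_zero_vec: "A \<in> M \<Longrightarrow> qform A (0\<^sub>v n) = 0"
  unfolding qform_def by (subst ip_sum[of _ n]) (auto intro: mv_carrier)

lemma pd_psd [simp]: "A \<in> pd_mats n \<Longrightarrow> A \<in> psd_mats n"
  unfolding psd_iff pd_iff using qform_zero_vec[of A] herm_carrier[of A] by force

lemma psd_carrier [simp]: "A \<in> psd_mats n \<Longrightarrow> A \<in> M"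
  and pd_carrier [simp]: "A \<in> pd_mats n \<Longrightarrow> A \<in> M"
  by simp_all

section \<open>Well-definedness and rules of the functional calculus\<close>

text \<open>In the two eigenbases \<open>T\<close> becomes \<open>W\<close>, and the hypothesis says
  that \<open>W $$ (i,j)\<close> vanishes unless \<open>d i = e j\<close>. Then
  \<open>f (d i) = f (e j)\<close> wherever \<open>W\<close> is nonzero.\<close>

lemma diag_intertwine:
  assumes U: "U \<in> unitary_mats n" and V: "V \<in> unitary_mats n" and T: "T \<in> M"
    and eq: "(U * rdiag n d * adj U) * T = T * (V * rdiag n e * adj V)"
  shows "(U * rdiag n (\<lambda>i. f (d i)) * adj U) * T = T * (V * rdiag n (\<lambda>i. f (e i)) * adj V)"
proof -
  note u = unitary_matsD[OF U] and v = unitary_matsD[OF V]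
  note [simp] = u(1) v(1) T mat_simps
  have uc [simp]: "adj U * (U * X) = X" "U * (adj U * X) = X" if "X \<in> M" for X
    using that u by (simp_all add: assoc[symmetric])
  have vc [simp]: "adj V * (V * X) = X" "V * (adj V * X) = X" if "X \<in> M" for X
    using that v by (simp_all add: assoc[symmetric])
  define W where "W = adj U * (T * V)"
  have W [simp]: "W \<in> M" by (simp add: W_def)
  have T_eq: "T = U * (W * adj V)" by (simp add: W_def v)
  have "adj U * ((U * rdiag n d * adj U) * T) * V = adj U * (T * (V * rdiag n e * adj V)) * V"
    by (simp only: eq)
  then have dW: "rdiag n d * W = W * rdiag n e"
    by (simp add: W_def v)
  have ent: "of_real (d i) * W $$ (i,j) = W $$ (i,j) * of_real (e j)" if "i < n" "j < n" for i j
    using arg_cong[of _ _ "\<lambda>A. A $$ (i,j)", OF dW[unfolded mat_diag_mult_left[OF W] mat_diag_mult_right[OF W]]]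
      that by simp
  have "of_real (f (d i)) * W $$ (i,j) = W $$ (i,j) * of_real (f (e j))" if "i < n" "j < n" for i j
    using ent[OF that] by (cases "W $$ (i,j) = 0") auto
  then have "rdiag n (\<lambda>i. f (d i)) * W = W * rdiag n (\<lambda>i. f (e i))"
    unfolding mat_diag_mult_left[OF W] mat_diag_mult_right[OF W] by (intro eq_matI) auto
  then have "U * ((rdiag n (\<lambda>i. f (d i)) * W) * adj V) = U * ((W * rdiag n (\<lambda>i. f (e i))) * adj V)"
    by simp
  then show ?thesis unfolding T_eq by (simp add: v)
qed

text \<open>Two diagonalizations of the same matrix are intertwined by the identity, so
  \<open>diag_intertwine\<close> gives the uniqueness behind the description in
  \<open>mat_fun\<close>.\<close>

lemma mat_fun_eq:
  assumes U: "U \<in> unitary_mats n" and A: "A = U * rdiag n d * adj U"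
  shows "mat_fun f A = U * rdiag n (\<lambda>i. f (d i)) * adj U"
proof -
  have dim: "dim_row A = n" using unitary_matsD(1)[OF U] by (simp add: A)
  show ?thesis unfolding mat_fun_def dim Let_def
  proof (rule the_equality)
    fix B assume "\<exists>V e. V \<in> unitary_mats n \<and> A = V * rdiag n e * adj V \<and> B = V * rdiag n (\<lambda>i. f (e i)) * adj V"
    then obtain V e where V: "V \<in> unitary_mats n" "A = V * rdiag n e * adj V"
      and B: "B = V * rdiag n (\<lambda>i. f (e i)) * adj V" by blast
    note [simp] = unitary_matsD(1)[OF U] unitary_matsD(1)[OF V(1)] mult_M one_l one_r
    have "(V * rdiag n e * adj V) * 1\<^sub>m n = 1\<^sub>m n * (U * rdiag n d * adj U)"
      using V(2) A by simp
    from diag_intertwine[OF V(1) U _ this, of f] show "B = U * rdiag n (\<lambda>i. f (d i)) * adj U"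
      by (simp add: B)
  qed (use U A in blast)
qed

lemma herm_obtain:
  assumes "herm n A"
  obtains U d where "U \<in> unitary_mats n" "A = U * rdiag n d * adj U"
    "\<And>f. mat_fun f A = U * rdiag n (\<lambda>i. f (d i)) * adj U"
proof -
  obtain U d where *: "U \<in> unitary_mats n" "A = U * rdiag n d * adj U"
    using spectral[of A n] assms unfolding herm_def by blast
  show thesis by (rule that[OF * mat_fun_eq[OF *]])
qed

lemma udiag_herm:
  assumes "U \<in> M"
  shows "herm n (U * rdiag n d * adj U)"
  by (rule hermI) (use assms in \<open>simp_all add: mat_simps\<close>)

lemma mat_fun_herm [simp]: "herm n A \<Longrightarrow> herm n (mat_fun f A)"
  by (erule herm_obtain) (simp add: udiag_herm unitary_matsD)

lemma mat_fun_carrier [simp]: "herm n A \<Longrightarrow> mat_fun f A \<in> M"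
  by (rule herm_carrier) simp

lemma mat_fun_intertwine:
  assumes "herm n X" "herm n Y" "T \<in> M" "X * T = T * Y"
  shows "mat_fun f X * T = T * mat_fun f Y"
proof -
  obtain U d where U: "U \<in> unitary_mats n" "X = U * rdiag n d * adj U"
    "\<And>f. mat_fun f X = U * rdiag n (\<lambda>i. f (d i)) * adj U" using herm_obtain[OF assms(1)] by blast
  obtain V e where V: "V \<in> unitary_mats n" "Y = V * rdiag n e * adj V"
    "\<And>f. mat_fun f Y = V * rdiag n (\<lambda>i. f (e i)) * adj V" using herm_obtain[OF assms(2)] by blast
  show ?thesis unfolding U(3) V(3)
    by (rule diag_intertwine[OF U(1) V(1) assms(3)]) (use assms U V in simp)
qed

lemma mat_fun_mult:
  assumes "herm n A"
  shows "mat_fun f A * mat_fun g A = mat_fun (\<lambda>x. f x * g x) A"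
proof (rule herm_obtain[OF assms])
  fix U d assume U: "U \<in> unitary_mats n" and *: "\<And>f. mat_fun f A = U * rdiag n (\<lambda>i. f (d i)) * adj U"
  note u = unitary_matsD[OF U]
  have "U * rdiag n (\<lambda>i. f (d i)) * adj U * (U * rdiag n (\<lambda>i. g (d i)) * adj U)
    = U * rdiag n (\<lambda>i. f (d i)) * (adj U * U) * rdiag n (\<lambda>i. g (d i)) * adj U"
    using u(1) by (simp add: mat_simps)
  also have "\<dots> = U * (rdiag n (\<lambda>i. f (d i)) * rdiag n (\<lambda>i. g (d i))) * adj U"
    using u(1) unfolding u(3) by (simp add: assoc mult_M one_r)
  finally show ?thesis unfolding * by simp
qed

lemma mat_fun_comp:
  assumes "herm n A"
  shows "mat_fun f (mat_fun g A) = mat_fun (\<lambda>x. f (g x)) A"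
proof (rule herm_obtain[OF assms])
  fix U d assume U: "U \<in> unitary_mats n" and *: "\<And>f. mat_fun f A = U * rdiag n (\<lambda>i. f (d i)) * adj U"
  show ?thesis using mat_fun_eq[OF U *, of f g] unfolding * by simp
qed

lemma mat_fun_id: "herm n A \<Longrightarrow> mat_fun (\<lambda>x. x) A = A"
  by (erule herm_obtain) simp

lemma mat_fun_const: "herm n A \<Longrightarrow> mat_fun (\<lambda>x. c) A = complex_of_real c \<cdot>\<^sub>m 1\<^sub>m n"
proof (erule herm_obtain)
  fix U d assume U: "U \<in> unitary_mats n" and *: "\<And>f. mat_fun f A = U * rdiag n (\<lambda>i. f (d i)) * adj U"
  note u = unitary_matsD[OF U]
  have "rdiag n (\<lambda>i. c) = complex_of_real c \<cdot>\<^sub>m 1\<^sub>m n" by (intro eq_matI) (auto simp: mat_diag_def)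
  then show ?thesis unfolding * using u
    by (simp add: mult_smult_distrib[of _ n n _ n] mult_smult_assoc_mat[of _ n n _ n] one_r)
qed

section \<open>Quadratic forms and eigenvalues\<close>

lemma rdiag_mv:
  assumes "w \<in> carrier_vec n" "i < n"
  shows "(rdiag n d *\<^sub>v w) $ i = of_real (d i) * w $ i"
  using assms by (simp add: mat_diag_def scalar_prod_def if_distrib[of "\<lambda>x. x * _"] cong: if_cong)

lemma qform_udiag:
  assumes U: "U \<in> M" and v: "v \<in> carrier_vec n"
  shows "qform (U * rdiag n d * adj U) v = (\<Sum>i<n. d i * (cmod ((adj U *\<^sub>v v) $ i))\<^sup>2)"
proof -
  let ?w = "adj U *\<^sub>v v"
  have w: "?w \<in> carrier_vec n" using assms by (intro mv_carrier) auto
  have dw: "(rdiag n d *\<^sub>v ?w) $ i = of_real (d i) * ?w $ i" if "i < n" for i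
    using w that by (rule rdiag_mv)
  have "(U * rdiag n d * adj U *\<^sub>v v) \<bullet>c v = (U *\<^sub>v (rdiag n d *\<^sub>v ?w)) \<bullet>c v"
    using assms by (simp add: mv_assoc mult_M mv_carrier assoc)
  also have "\<dots> = (rdiag n d *\<^sub>v ?w) \<bullet>c ?w"
    using assms w by (intro ip_adj[of _ n n]) (auto intro: mv_carrier)
  also have "\<dots> = (\<Sum>i<n. of_real (d i * (cmod (?w $ i))\<^sup>2))"
    using w by (subst ip_sum[of _ n]) 
      (auto simp: dw complex_norm_square[symmetric] mult.assoc intro!: sum.cong mv_carrier)
  finally show ?thesis unfolding qform_def by simp
qed

lemma qform_mult:
  assumes "A \<in> M" "T \<in> M" "v \<in> carrier_vec n"
  shows "qform (adj T * (A * T)) v = qform A (T *\<^sub>v v)"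
  unfolding qform_def using assms
  by (simp add: mv_assoc mult_M mv_carrier ip_adj[of "adj T" n n])

lemma qform_add: "A \<in> M \<Longrightarrow> B \<in> M \<Longrightarrow> v \<in> carrier_vec n \<Longrightarrow> qform (A + B) v = qform A v + qform B v"
  unfolding qform_def
  by (simp add: add_mult_distrib_mat_vec[of _ n n] add_scalar_prod_distrib[of _ n] mv_carrier)

lemma qform_minus: "A \<in> M \<Longrightarrow> B \<in> M \<Longrightarrow> v \<in> carrier_vec n \<Longrightarrow> qform (A - B) v = qform A v - qform B v"
  unfolding qform_def
  by (simp add: minus_mult_distrib_mat_vec[of _ n n] minus_scalar_prod_distrib[of _ n] mv_carrier)

lemma qform_smult:
  assumes "A \<in> M" "v \<in> carrier_vec n"
  shows "qform (complex_of_real c \<cdot>\<^sub>m A) v = c * qform A v"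
proof -
  have "(complex_of_real c \<cdot>\<^sub>m A) *\<^sub>v v = complex_of_real c \<cdot>\<^sub>v (A *\<^sub>v v)"
    using assms by (intro eq_vecI) (auto simp: scalar_prod_def sum_distrib_left mult.assoc)
  then show ?thesis unfolding qform_def using assms
    by (simp add: mv_carrier smult_scalar_prod_distrib[of _ n])
qed

lemma qform_one: "v \<in> carrier_vec n \<Longrightarrow> qform (1\<^sub>m n) v = (\<Sum>i<n. (cmod (v $ i))\<^sup>2)"
  unfolding qform_def using ip_self[of v n] by simp

lemma qform_one_nonneg: "v \<in> carrier_vec n \<Longrightarrow> 0 \<le> qform (1\<^sub>m n) v"
  by (simp add: qform_one sum_nonneg)

lemma qform_one_pos: "v \<in> carrier_vec n \<Longrightarrow> v \<noteq> 0\<^sub>v n \<Longrightarrow> 0 < qform (1\<^sub>m n) v"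
  unfolding qform_def using ip_self_pos[of v n] by simp

lemma eigencol:
  assumes U: "U \<in> unitary_mats n" and A: "A = U * rdiag n d * adj U" and i: "i < n"
  shows "col U i \<in> carrier_vec n" "col U i \<noteq> 0\<^sub>v n" "A *\<^sub>v col U i = complex_of_real (d i) \<cdot>\<^sub>v col U i"
    "qform A (col U i) = d i"
proof -
  note u = unitary_matsD[OF U]
  have Ui: "adj U *\<^sub>v col U i = unit_vec n i"
    using col_mult2[of "adj U" n n U n i] u i by simp
  show c: "col U i \<in> carrier_vec n" using u by auto
  show "col U i \<noteq> 0\<^sub>v n"
  proof
    assume "col U i = 0\<^sub>v n"
    with Ui u have "unit_vec n i = (0\<^sub>v n :: complex vec)" by (simp add: mult_mat_vec_def scalar_prod_def vec_eq_iff)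
    then show False using i by (auto simp: vec_eq_iff)
  qed
  have du: "rdiag n d *\<^sub>v unit_vec n i = complex_of_real (d i) \<cdot>\<^sub>v unit_vec n i"
    using i by (intro eq_vecI) (auto simp: mat_diag_def)
  have Uu: "U *\<^sub>v unit_vec n i = col U i"
    using u(1) i by (intro eq_vecI) auto
  have "A *\<^sub>v col U i = U *\<^sub>v (rdiag n d *\<^sub>v (adj U *\<^sub>v col U i))"
    unfolding A using u(1) c by (simp add: mv_assoc mult_M mv_carrier)
  also have "\<dots> = complex_of_real (d i) \<cdot>\<^sub>v col U i"
    unfolding Ui du using u(1) by (simp add: mult_mat_vec[of _ n n] Uu)
  finally show "A *\<^sub>v col U i = complex_of_real (d i) \<cdot>\<^sub>v col U i" .
  have "qform A (col U i) = (\<Sum>j<n. if j = i then d i else 0)"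
    unfolding A qform_udiag[OF u(1) c] Ui using i by (intro sum.cong) auto
  then show "qform A (col U i) = d i" using i by simp
qed

lemma unitary_mv_nonzero:
  assumes U: "U \<in> unitary_mats n" and v: "v \<in> carrier_vec n" "v \<noteq> 0\<^sub>v n"
  shows "\<exists>i<n. (adj U *\<^sub>v v) $ i \<noteq> 0"
proof (rule ccontr)
  note u = unitary_matsD[OF U]
  assume "\<not> ?thesis"
  then have "adj U *\<^sub>v v = 0\<^sub>v n" using u v by (intro eq_vecI) auto
  moreover have "v = U *\<^sub>v (adj U *\<^sub>v v)" using u v by (simp add: mv_assoc[symmetric])
  ultimately show False using u v by (simp add: mult_mat_vec_def scalar_prod_def vec_eq_iff)
qed

lemma psd_obtain:
  assumes "A \<in> psd_mats n"
  obtains U d where "U \<in> unitary_mats n" "A = U * rdiag n d * adj U"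
    "\<And>f. mat_fun f A = U * rdiag n (\<lambda>i. f (d i)) * adj U" "\<And>i. i < n \<Longrightarrow> 0 \<le> d i"
proof (rule herm_obtain[of A])
  fix U d assume *: "U \<in> unitary_mats n" "A = U * rdiag n d * adj U"
    "\<And>f. mat_fun f A = U * rdiag n (\<lambda>i. f (d i)) * adj U"
  show thesis by (rule that[OF *]) (metis eigencol(1,4)[OF *(1,2)] psdD[OF assms])
qed (use assms in simp)

lemma pd_obtain:
  assumes "A \<in> pd_mats n"
  obtains U d where "U \<in> unitary_mats n" "A = U * rdiag n d * adj U"
    "\<And>f. mat_fun f A = U * rdiag n (\<lambda>i. f (d i)) * adj U" "\<And>i. i < n \<Longrightarrow> 0 < d i"
proof (rule herm_obtain[of A])
  fix U d assume *: "U \<in> unitary_mats n" "A = U * rdiag n d * adj U"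
    "\<And>f. mat_fun f A = U * rdiag n (\<lambda>i. f (d i)) * adj U"
  show thesis by (rule that[OF *]) (metis eigencol(1,2,4)[OF *(1,2)] pdD[OF assms])
qed (use assms in simp)

lemma udiag_psd:
  assumes "U \<in> M" "\<And>i. i < n \<Longrightarrow> 0 \<le> d i"
  shows "U * rdiag n d * adj U \<in> psd_mats n"
  using assms by (intro psdI) (auto simp: udiag_herm qform_udiag intro!: sum_nonneg)

lemma udiag_pd:
  assumes "U \<in> unitary_mats n" "\<And>i. i < n \<Longrightarrow> 0 < d i"
  shows "U * rdiag n d * adj U \<in> pd_mats n"
proof (rule pdI)
  note u = unitary_matsD[OF assms(1)]
  show "herm n (U * rdiag n d * adj U)" using u by (simp add: udiag_herm)
  fix v :: "complex vec" assume v: "v \<in> carrier_vec n" "v \<noteq> 0\<^sub>v n"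
  obtain i where "i < n" "(adj U *\<^sub>v v) $ i \<noteq> 0" using unitary_mv_nonzero[OF assms(1) v] by blast
  then show "0 < qform (U * rdiag n d * adj U) v"
    unfolding qform_udiag[OF u(1) v(1)]
    by (intro sum_pos2[of _ i]) (use assms(2) in \<open>auto simp: less_imp_le\<close>)
qed

lemma qle_udiag:
  assumes "U \<in> M" "\<And>i. i < n \<Longrightarrow> d i \<le> e i"
  shows "qle n (U * rdiag n d * adj U) (U * rdiag n e * adj U)"
  using assms by (auto simp: qle_def qform_udiag intro!: sum_mono mult_right_mono)

lemma mat_fun_psd:
  assumes "A \<in> psd_mats n" "\<And>x. 0 \<le> x \<Longrightarrow> 0 \<le> f x"
  shows "mat_fun f A \<in> psd_mats n"
  by (rule psd_obtain[OF assms(1)]) (use assms in \<open>auto simp: udiag_psd unitary_matsD\<close>)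

lemma mat_fun_pd:
  assumes "A \<in> pd_mats n" "\<And>x. 0 < x \<Longrightarrow> 0 < f x"
  shows "mat_fun f A \<in> pd_mats n"
  by (rule pd_obtain[OF assms(1)]) (use assms in \<open>auto simp: udiag_pd\<close>)

lemma mat_fun_qle:
  assumes "A \<in> psd_mats n" "\<And>x. 0 \<le> x \<Longrightarrow> f x \<le> g x"
  shows "qle n (mat_fun f A) (mat_fun g A)"
  by (rule psd_obtain[OF assms(1)]) (use assms in \<open>auto simp: qle_udiag unitary_matsD\<close>)

lemma rdiag_cong: "(\<And>i. i < n \<Longrightarrow> d i = e i) \<Longrightarrow> rdiag n d = rdiag n e"
  by (intro eq_matI) (auto simp: mat_diag_def)

lemma mat_fun_cong_psd:
  assumes "A \<in> psd_mats n" "\<And>x. 0 \<le> x \<Longrightarrow> f x = g x"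
  shows "mat_fun f A = mat_fun g A"
proof (rule psd_obtain[OF assms(1)])
  fix U d assume *: "\<And>f. mat_fun f A = U * rdiag n (\<lambda>i. f (d i)) * adj U" and "\<And>i. i < n \<Longrightarrow> 0 \<le> d i"
  then have "rdiag n (\<lambda>i. f (d i)) = rdiag n (\<lambda>i. g (d i))" by (intro rdiag_cong) (use assms in auto)
  then show ?thesis by (simp add: *)
qed

lemma mat_fun_cong_pd:
  assumes "A \<in> pd_mats n" "\<And>x. 0 < x \<Longrightarrow> f x = g x"
  shows "mat_fun f A = mat_fun g A"
proof (rule pd_obtain[OF assms(1)])
  fix U d assume *: "\<And>f. mat_fun f A = U * rdiag n (\<lambda>i. f (d i)) * adj U" and "\<And>i. i < n \<Longrightarrow> 0 < d i"
  then have "rdiag n (\<lambda>i. f (d i)) = rdiag n (\<lambda>i. g (d i))" by (intro rdiag_cong) (use assms in auto)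
  then show ?thesis by (simp add: *)
qed

section \<open>Real powers, congruence and contractions\<close>

lemma pw_psd [simp]: "A \<in> psd_mats n \<Longrightarrow> pw A r \<in> psd_mats n"
  unfolding pw_def by (rule mat_fun_psd) auto

lemma pw_pd [simp]: "A \<in> pd_mats n \<Longrightarrow> pw A r \<in> pd_mats n"
  unfolding pw_def by (rule mat_fun_pd) auto

text \<open>The law holds for all real exponents even on singular matrices, because
  \<open>0 powr r = 0\<close> for every \<open>r\<close>.\<close>

lemma pw_mul: "A \<in> psd_mats n \<Longrightarrow> pw A r * pw A s = pw A (r + s)"
  unfolding pw_def by (simp add: mat_fun_mult powr_add)

lemma pw_pw: "A \<in> psd_mats n \<Longrightarrow> pw (pw A r) s = pw A (r * s)"
  unfolding pw_def by (simp add: mat_fun_comp powr_powr)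

lemma pw_1 [simp]: "A \<in> psd_mats n \<Longrightarrow> pw A 1 = A"
  unfolding pw_def using mat_fun_cong_psd[of A "\<lambda>x. x powr 1" "\<lambda>x. x"] by (simp add: mat_fun_id)

text \<open>On a singular matrix the exponent 0 would give the support projection instead, as
  \<open>0 powr 0 = 0\<close>.\<close>

lemma pw_0 [simp]: "A \<in> pd_mats n \<Longrightarrow> pw A 0 = 1\<^sub>m n"
  unfolding pw_def using mat_fun_cong_pd[of A "\<lambda>x. x powr 0" "\<lambda>x. 1"]
  by (simp add: mat_fun_const) (intro eq_matI, auto)

lemma mat_powr_pw:
  assumes "A \<in> psd_mats n"
  shows "mat_powr A r = pw A r"
proof (cases "r < 0")
  case True
  have "mat_fun (\<lambda>x. inverse x powr - r) A = mat_fun (\<lambda>x. x powr r) A"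
    by (rule mat_fun_cong_psd[OF assms]) (simp add: powr_minus inverse_powr)
  then show ?thesis using True assms by (simp add: mat_powr_def gen_inv_def mat_fun_comp pw_def)
qed (simp add: mat_powr_def pw_def)

lemma qle_refl [simp]: "qle n A A" by (simp add: qle_def)

lemma qle_trans [trans]: "qle n A B \<Longrightarrow> qle n B C \<Longrightarrow> qle n A C"
  unfolding qle_def by (meson order_trans)

lemma qle_cong:
  assumes "A \<in> M" "B \<in> M" "T \<in> M" "qle n A B"
  shows "qle n (adj T * (A * T)) (adj T * (B * T))"
  using assms by (auto simp: qle_def qform_mult mv_carrier)

lemma herm_mult_cong: "herm n A \<Longrightarrow> T \<in> M \<Longrightarrow> herm n (adj T * (A * T))"
  by (rule hermI) (simp_all add: mat_simps)

lemma psd_cong: "A \<in> psd_mats n \<Longrightarrow> T \<in> M \<Longrightarrow> adj T * (A * T) \<in> psd_mats n"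
  by (rule psdI) (simp_all add: herm_mult_cong qform_mult mv_carrier psdD)

lemma pd_cong:
  assumes "A \<in> pd_mats n" "T \<in> M" "S \<in> M" "S * T = 1\<^sub>m n"
  shows "adj T * (A * T) \<in> pd_mats n"
proof (rule pdI)
  show "herm n (adj T * (A * T))" using assms by (simp add: herm_mult_cong)
  fix v :: "complex vec" assume v: "v \<in> carrier_vec n" "v \<noteq> 0\<^sub>v n"
  have "T *\<^sub>v v \<noteq> 0\<^sub>v n"
  proof
    assume "T *\<^sub>v v = 0\<^sub>v n"
    then have "S *\<^sub>v (T *\<^sub>v v) = 0\<^sub>v n" using assms by (intro eq_vecI) (auto simp: scalar_prod_def)
    moreover have "S *\<^sub>v (T *\<^sub>v v) = v" using assms v by (simp add: mv_assoc[symmetric])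
    ultimately show False using v by simp
  qed
  then show "0 < qform (adj T * (A * T)) v"
    using assms v by (simp add: qform_mult pdD mv_carrier)
qed

lemma one_pd [simp]: "1\<^sub>m n \<in> pd_mats n"
  by (rule pdI) (auto simp: qform_one_pos intro!: hermI)

lemma ip_le:
  assumes "v \<in> carrier_vec n" "w \<in> carrier_vec n"
  shows "Re (v \<bullet>c w) \<le> (qform (1\<^sub>m n) v + qform (1\<^sub>m n) w) / 2"
proof -
  have "Re (v \<bullet>c w) = (\<Sum>i<n. Re (v $ i * cnj (w $ i)))" using assms by (simp add: ip_sum[of _ n])
  also have "\<dots> \<le> (\<Sum>i<n. ((cmod (v $ i))\<^sup>2 + (cmod (w $ i))\<^sup>2) / 2)"
  proof (rule sum_mono)
    fix i
    have "Re (v $ i * cnj (w $ i)) \<le> cmod (v $ i) * cmod (w $ i)"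
      using complex_Re_le_cmod[of "v $ i * cnj (w $ i)"] by (simp add: norm_mult)
    also have "\<dots> \<le> ((cmod (v $ i))\<^sup>2 + (cmod (w $ i))\<^sup>2) / 2"
      using sum_squares_bound[of "cmod (v $ i)" "cmod (w $ i)"] by simp
    finally show "Re (v $ i * cnj (w $ i)) \<le> ((cmod (v $ i))\<^sup>2 + (cmod (w $ i))\<^sup>2) / 2" .
  qed
  also have "\<dots> = (qform (1\<^sub>m n) v + qform (1\<^sub>m n) w) / 2"
    using assms by (simp add: qform_one sum.distrib sum_divide_distrib[symmetric])
  finally show ?thesis .
qed

text \<open>With w = T* v, the squared norm of w is the inner product of T w and v, hence at most
  the average of the squared norms of T w and v; as T is a contraction, the first of these is at
  most the squared norm of w itself.\<close>

lemma qle_flip: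
  assumes T: "T \<in> M" and le: "qle n (adj T * T) (1\<^sub>m n)"
  shows "qle n (T * adj T) (1\<^sub>m n)"
  unfolding qle_def
proof
  fix v :: "complex vec" assume v: "v \<in> carrier_vec n"
  let ?w = "adj T *\<^sub>v v"
  have w: "?w \<in> carrier_vec n" using T v by (simp add: mv_carrier)
  have q: "qform (T * adj T) v = qform (1\<^sub>m n) ?w"
    using qform_mult[of "1\<^sub>m n" "adj T" v] T v by (simp add: one_l)
  have "qform (T * adj T) v = Re ((T *\<^sub>v ?w) \<bullet>c v)"
    unfolding qform_def using T v by (simp add: mv_assoc)
  also have "\<dots> \<le> (qform (1\<^sub>m n) (T *\<^sub>v ?w) + qform (1\<^sub>m n) v) / 2"
    using T v w by (intro ip_le) (auto intro: mv_carrier)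
  also have "qform (1\<^sub>m n) (T *\<^sub>v ?w) = qform (adj T * T) ?w"
    using qform_mult[of "1\<^sub>m n" T ?w] T w by (simp add: one_l)
  also have "\<dots> \<le> qform (1\<^sub>m n) ?w" using le w by (simp add: qle_def)
  finally show "qform (T * adj T) v \<le> qform (1\<^sub>m n) v" using q by simp
qed

lemma qle_one_eigenvalues:
  assumes A: "herm n A"
    and ev: "\<And>\<mu> x. x \<in> carrier_vec n \<Longrightarrow> x \<noteq> 0\<^sub>v n \<Longrightarrow> A *\<^sub>v x = complex_of_real \<mu> \<cdot>\<^sub>v x \<Longrightarrow> \<mu> \<le> c"
  shows "qle n A (complex_of_real c \<cdot>\<^sub>m 1\<^sub>m n)"
proof (rule herm_obtain[OF A])
  fix U d assume *: "U \<in> unitary_mats n" "A = U * rdiag n d * adj U"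
    "\<And>f. mat_fun f A = U * rdiag n (\<lambda>i. f (d i)) * adj U"
  have "d i \<le> c" if "i < n" for i using ev eigencol[OF *(1,2) that] by blast
  then have "qle n A (mat_fun (\<lambda>x. c) A)" unfolding *(3) using *(1)
    by (subst *(2)) (auto intro!: qle_udiag dest: unitary_matsD)
  then show ?thesis using A by (simp add: mat_fun_const)
qed

section \<open>The Loewner--Heinz inequality\<close>

declare mult_M [simp] one_l [simp] one_r [simp]

lemmas msmult = mult_smult_distrib[of _ n n _ n] mult_smult_assoc_mat[of _ n n _ n]

lemma one_smult_mat [simp]: "1 \<cdot>\<^sub>m A = A" for A :: "complex mat"
  by (intro eq_matI) auto

lemma mult_mat_vec_zero: "A \<in> carrier_mat n n \<Longrightarrow> A *\<^sub>v 0\<^sub>v n = 0\<^sub>v n" for A :: "complex mat"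
  by (intro eq_vecI) (auto simp: scalar_prod_def)

lemma pw_mul': "A \<in> psd_mats n \<Longrightarrow> X \<in> carrier_mat n n \<Longrightarrow> pw A r * (pw A s * X) = pw A (r + s) * X"
  by (simp add: assoc[symmetric] pw_mul)

lemmas pw_simps = assoc adj_mul pw_mul pw_mul'

lemma qle_sandwich:
  assumes "A \<in> carrier_mat n n" "B \<in> carrier_mat n n" "herm n T" "qle n A B"
  shows "qle n (T * (A * T)) (T * (B * T))"
  using qle_cong[OF assms(1,2) herm_carrier[OF assms(3)] assms(4)] assms(3) by simp

lemma qle_move:
  assumes "A \<in> pd_mats n" "B \<in> carrier_mat n n" "C \<in> carrier_mat n n"
    and "qle n (pw A r * (B * pw A r)) C"
  shows "qle n B (pw A (-r) * (C * pw A (-r)))"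
proof -
  have "qle n (pw A (-r) * ((pw A r * (B * pw A r)) * pw A (-r))) (pw A (-r) * (C * pw A (-r)))"
    using assms by (intro qle_sandwich) auto
  then show ?thesis using assms by (simp add: pw_simps)
qed

text \<open>The inequality A^s \<le> B^s expresses that A^(s/2) B^(-s/2) is a contraction.\<close>

lemma contraction:
  assumes A: "A \<in> psd_mats n" and B: "B \<in> pd_mats n" and le: "qle n (pw A s) (pw B s)"
    and y: "y \<in> carrier_vec n"
  shows "qform (1\<^sub>m n) (pw A (s/2) *\<^sub>v (pw B (-s/2) *\<^sub>v y)) \<le> qform (1\<^sub>m n) y"
proof -
  let ?z = "pw B (-s/2) *\<^sub>v y"
  have z: "?z \<in> carrier_vec n" using B y by (simp add: mv_assoc mv_carrier)
  have "qform (1\<^sub>m n) (pw A (s/2) *\<^sub>v ?z) = qform (pw A s) ?z"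
    using qform_mult[of "1\<^sub>m n" "pw A (s/2)" ?z] A z by (simp add: pw_simps)
  also have "\<dots> \<le> qform (pw B s) ?z" using le z by (simp add: qle_def)
  also have "\<dots> = qform (pw B (-s/2) * (pw B s * pw B (-s/2))) y"
    using qform_mult[of "pw B s" "pw B (-s/2)" y] B y by simp
  also have "pw B (-s/2) * (pw B s * pw B (-s/2)) = 1\<^sub>m n"
    using B by (simp add: pw_simps)
  finally show ?thesis .
qed

text \<open>With \<open>a = A\<^bsup>(s+t)/2\<^esup>\<close> and \<open>b = B\<^bsup>(s+t)/2\<^esup>\<close>, the Hermitian matrix \<open>b\<^bsup>-1/2\<^esup> a b\<^bsup>-1/2\<^esup>\<close> is similar to
  \<open>(A\<^bsup>t/2\<^esup> B\<^bsup>-t/2\<^esup>)\<^sup>* (A\<^bsup>s/2\<^esup> B\<^bsup>-s/2\<^esup>)\<close>, a product of two contractions, so its eigenvalues are at most 1.\<close>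

lemma loewner_heinz_midpoint:
  assumes A: "A \<in> psd_mats n" and B: "B \<in> pd_mats n"
    and s: "qle n (pw A s) (pw B s)" and t: "qle n (pw A t) (pw B t)"
  shows "qle n (pw A ((s+t)/2)) (pw B ((s+t)/2))"
proof -
  define r where "r = -(s+t)/4"
  \<comment> \<open>Chosen so that r - c = -t/2 and r + c = -s/2: conjugating \<open>K\<close> by
    \<open>pw B c\<close> splits the powers of B unevenly, as the two contractions demand.\<close>
  define c where "c = (t-s)/4"
  define K where "K = pw B r * (pw A ((s+t)/2) * pw B r)"
  note [simp] = A B
  have K: "herm n K" unfolding K_def using herm_mult_cong[of "pw A ((s+t)/2)" "pw B r"] by simp
  have "qle n K (complex_of_real 1 \<cdot>\<^sub>m 1\<^sub>m n)"
  proof (rule qle_one_eigenvalues[OF K])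
    fix \<mu> x assume x: "x \<in> carrier_vec n" "x \<noteq> 0\<^sub>v n" "K *\<^sub>v x = complex_of_real \<mu> \<cdot>\<^sub>v x"
    define y where "y = pw B (-c) *\<^sub>v x"
    have y: "y \<in> carrier_vec n" using x by (simp add: y_def mv_assoc mv_carrier)
    have xy: "x = pw B c *\<^sub>v y"
      unfolding y_def using x by (simp add: mv_assoc[symmetric] pw_simps)
    have "y \<noteq> 0\<^sub>v n"
    proof
      assume "y = 0\<^sub>v n"
      then have "x = 0\<^sub>v n" unfolding xy using mult_mat_vec_zero[of "pw B c"] by simp
      then show False using x by simp
    qed
    then have pos: "0 < qform (1\<^sub>m n) y" using y by (intro qform_one_pos)
    have L: "pw B (-c) * (K * pw B c) = pw B (-t/2) * (pw A (t/2) * (pw A (s/2) * pw B (-s/2)))"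
      unfolding K_def by (simp add: pw_simps r_def c_def) (simp add: field_simps)
    have "(pw B (-c) * (K * pw B c)) *\<^sub>v y = pw B (-c) *\<^sub>v (K *\<^sub>v x)"
      using y K by (simp add: mv_assoc mv_carrier xy)
    also have "\<dots> = complex_of_real \<mu> \<cdot>\<^sub>v y"
      unfolding x(3) y_def using x by (simp add: mult_mat_vec[of _ n n])
    finally have Ly: "pw B (-t/2) *\<^sub>v (pw A (t/2) *\<^sub>v (pw A (s/2) *\<^sub>v (pw B (-s/2) *\<^sub>v y))) = complex_of_real \<mu> \<cdot>\<^sub>v y"
      unfolding L using y by (simp add: mv_assoc mv_carrier)
    let ?u = "pw A (s/2) *\<^sub>v (pw B (-s/2) *\<^sub>v y)" and ?w = "pw A (t/2) *\<^sub>v (pw B (-t/2) *\<^sub>v y)"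
    have u: "?u \<in> carrier_vec n" "?w \<in> carrier_vec n" using y by (simp_all add: mv_assoc mv_carrier)
    \<comment> \<open>Moving the contraction with exponent t to the other side of the inner product
      leaves \<open>?u\<close> and \<open>?w\<close>, two images of \<open>y\<close> under
      contractions.\<close>
    have "\<mu> * qform (1\<^sub>m n) y = Re ((complex_of_real \<mu> \<cdot>\<^sub>v y) \<bullet>c y)"
      using y by (simp add: qform_def smult_scalar_prod_distrib[of _ n])
    also have "\<dots> = Re (?u \<bullet>c ?w)"
      unfolding Ly[symmetric] using y u
      by (simp add: ip_adj[of "pw B _" n n] ip_adj[of "pw A _" n n] mv_assoc mv_carrier)
    also have "\<dots> \<le> (qform (1\<^sub>m n) ?u + qform (1\<^sub>m n) ?w) / 2" by (rule ip_le[OF u])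
    also have "\<dots> \<le> qform (1\<^sub>m n) y"
      using contraction[OF A B s y] contraction[OF A B t y] by simp
    finally show "\<mu> \<le> 1" using pos by simp
  qed
  then have "qle n (pw A ((s+t)/2)) (pw B (-r) * (1\<^sub>m n * pw B (-r)))"
    by (intro qle_move) (auto simp: K_def one_smult_mat)
  moreover have "pw B (-r) * (1\<^sub>m n * pw B (-r)) = pw B ((s+t)/2)"
    by (simp add: pw_mul) (rule arg_cong[of _ _ "pw B"], simp add: r_def field_simps)
  ultimately show ?thesis by simp
qed

text \<open>A zero eigenvalue causes no jump at r = 0, since \<open>0 powr r\<close> is 0 there as
  well.\<close>

lemma continuous_qform_pw:
  assumes A: "A \<in> psd_mats n" and v: "v \<in> carrier_vec n"
  shows "continuous_on UNIV (\<lambda>r. qform (pw A r) v)"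
proof (rule psd_obtain[OF A])
  fix U d assume U: "U \<in> unitary_mats n" and *: "\<And>f. mat_fun f A = U * rdiag n (\<lambda>i. f (d i)) * adj U"
  have "continuous_on UNIV (\<lambda>r. x powr r)" for x :: real
    by (cases "x = 0") (auto intro!: continuous_intros)
  then show ?thesis unfolding pw_def * qform_udiag[OF unitary_matsD(1)[OF U] v]
    by (intro continuous_on_sum continuous_on_mult continuous_on_const)
qed

text \<open>The exponents for which the inequality holds form a closed set that contains 0 and 1 and
  is stable under midpoints. At exponent 0 a projection is compared with the identity.\<close>

theorem loewner_heinz:
  assumes A: "A \<in> psd_mats n" and B: "B \<in> pd_mats n" and le: "qle n A B" and r: "0 \<le> r" "r \<le> 1"
  shows "qle n (pw A r) (pw B r)"
proof -
  define R where "R = {r. qle n (pw A r) (pw B r)}"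
  have "R = (\<Inter>v \<in> carrier_vec n. {r. qform (pw A r) v \<le> qform (pw B r) v})"
    by (auto simp: R_def qle_def)
  also have "closed \<dots>"
    by (intro closed_INT ballI closed_Collect_le continuous_qform_pw A pd_psd B)
  finally have "closed R" .
  moreover have "0 \<in> R"
  proof -
    have "qle n (mat_fun (\<lambda>x. x powr 0) A) (mat_fun (\<lambda>x. 1) A)" by (rule mat_fun_qle[OF A]) auto
    moreover have "mat_fun (\<lambda>x. 1) A = 1\<^sub>m n" using mat_fun_const[of A 1] A by simp
    ultimately show ?thesis unfolding R_def mem_Collect_eq pw_0[OF B] unfolding pw_def by (simp only:)
  qed
  moreover have "1 \<in> R" using A B le by (simp add: R_def)
  moreover have "(s + t) / 2 \<in> R" if "s \<in> R" "t \<in> R" for s t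
    using that unfolding R_def mem_Collect_eq by (rule loewner_heinz_midpoint[OF A B])
  ultimately have "r \<in> R" using r by (rule midpoint_closed_interval)
  then show ?thesis by (simp add: R_def)
qed

text \<open>A \<le> B says T* T \<le> 1 for T = A^(1/2) B^(-1/2); the flipped inequality T T* \<le>
  1 reads A^(1/2) B^(-1) A^(1/2) \<le> 1.\<close>

lemma inverse_antimono:
  assumes A: "A \<in> pd_mats n" and B: "B \<in> pd_mats n" and le: "qle n A B"
  shows "qle n (pw B (-1)) (pw A (-1))"
proof -
  note [simp] = A B
  let ?T = "pw A (1/2) * pw B (-1/2)"
  have "qle n (pw B (-1/2) * (A * pw B (-1/2))) (pw B (-1/2) * (B * pw B (-1/2)))"
    using le by (intro qle_sandwich) auto
  moreover have "pw B (-1/2) * (B * pw B (-1/2)) = pw B (-1/2) * (pw B 1 * pw B (-1/2))" by simp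
  moreover have "A * pw B (-1/2) = pw A 1 * pw B (-1/2)" by simp
  ultimately have "qle n (adj ?T * ?T) (1\<^sub>m n)" by (simp add: pw_simps del: pw_1)
  then have "qle n (?T * adj ?T) (1\<^sub>m n)" by (intro qle_flip) auto
  then have "qle n (pw A (1/2) * (pw B (-1) * pw A (1/2))) (1\<^sub>m n)" by (simp add: pw_simps)
  then have "qle n (pw B (-1)) (pw A (-(1/2)) * (1\<^sub>m n * pw A (-(1/2))))" by (intro qle_move) auto
  then show ?thesis by (simp add: pw_simps)
qed

lemma loewner_heinz_neg:
  assumes "A \<in> pd_mats n" "B \<in> pd_mats n" "qle n A B" "0 \<le> r" "r \<le> 1"
  shows "qle n (pw B (-r)) (pw A (-r))"
proof -
  have "qle n (pw (pw B (-1)) r) (pw (pw A (-1)) r)"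
    using assms by (intro loewner_heinz inverse_antimono) auto
  then show ?thesis using assms by (simp add: pw_pw)
qed

section \<open>Weighted geometric means of positive definite matrices\<close>

lemma pw_inverse_unique:
  assumes Y: "Y \<in> pd_mats n" and Z: "Z \<in> carrier_mat n n" "Z * Y = 1\<^sub>m n"
  shows "pw Y (-1) = Z"
proof -
  have "Y * pw Y (-1) = pw Y 1 * pw Y (-1)" using Y by simp
  also have "\<dots> = 1\<^sub>m n" using Y by (simp add: pw_mul del: pw_1)
  finally have "Z * (Y * pw Y (-1)) = Z" using Z by simp
  then show ?thesis using Y Z by (simp add: assoc[symmetric])
qed

text \<open>\<open>T\<close> intertwines T T* with T* T, hence also their powers. Splitting one
  factor T* T off the power absorbs the inverse \<open>S\<close> of \<open>T\<close>.\<close>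

lemma pw_mult_adj:
  assumes T: "T \<in> carrier_mat n n" "S \<in> carrier_mat n n" "T * S = 1\<^sub>m n" "S * T = 1\<^sub>m n"
  shows "pw (T * adj T) r = T * (pw (adj T * T) (r - 1) * adj T)"
proof -
  let ?Y = "adj T * T"
  have Y: "?Y \<in> pd_mats n" using pd_cong[of "1\<^sub>m n" T S] T by simp
  have X: "herm n (T * adj T)" using herm_mult_cong[of "1\<^sub>m n" "adj T"] T by simp
  have "pw (T * adj T) r * T = T * pw ?Y r"
    unfolding pw_def using X Y T by (intro mat_fun_intertwine) (auto simp: assoc)
  then have "pw (T * adj T) r * (T * S) = T * pw ?Y r * S"
    using X Y T by (subst assoc[symmetric]) (auto simp: pw_def)
  then have "pw (T * adj T) r = T * pw ?Y r * S" using X T by (simp add: pw_def)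
  also have "pw ?Y r = pw ?Y (r - 1) * (adj T * T)"
    using pw_mul[of ?Y "r - 1" 1] Y by simp
  also have "T * \<dots> * S = T * (pw ?Y (r - 1) * (adj T * (T * S)))"
    using T Y by (simp add: assoc)
  finally show ?thesis using T by simp
qed

lemma pw_unitary:
  assumes "herm n N" "U \<in> carrier_mat n n" "U * adj U = 1\<^sub>m n"
  shows "pw (U * (N * adj U)) t = U * (pw N t * adj U)"
proof -
  have U: "adj U * U = 1\<^sub>m n" using assms mat_mult_left_right_inverse[of U n "adj U"] by simp
  have X: "herm n (U * (N * adj U))" using herm_mult_cong[of N "adj U"] assms by simp
  have "pw (U * (N * adj U)) t * U = U * pw N t"
    unfolding pw_def using X U assms by (intro mat_fun_intertwine) (auto simp: assoc)
  then have "pw (U * (N * adj U)) t * (U * adj U) = U * pw N t * adj U"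
    using X assms by (subst assoc[symmetric]) (auto simp: pw_def)
  then show ?thesis using X assms by (simp add: pw_def assoc)
qed

text \<open>This is \<open>wt_geo_mean\<close> in terms of \<open>pw\<close>, with products nested
  to the right as the rewrite rules \<open>pw_simps\<close> leave them.\<close>

definition mean :: "real \<Rightarrow> complex mat \<Rightarrow> complex mat \<Rightarrow> complex mat" where
  "mean t A B = pw A (1/2) * (pw (pw A (-1/2) * (B * pw A (-1/2))) t * pw A (1/2))"

lemma mid_psd [simp]: "A \<in> psd_mats n \<Longrightarrow> B \<in> psd_mats n \<Longrightarrow> pw A r * (B * pw A r) \<in> psd_mats n"
  using psd_cong[of B "pw A r"] by simp

lemma mid_pd [simp]: "A \<in> pd_mats n \<Longrightarrow> B \<in> pd_mats n \<Longrightarrow> pw A r * (B * pw A r) \<in> pd_mats n"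
  using pd_cong[of B "pw A r" "pw A (-r)"] by (simp add: pw_mul)

lemma mean_psd [simp]: "A \<in> psd_mats n \<Longrightarrow> B \<in> psd_mats n \<Longrightarrow> mean t A B \<in> psd_mats n"
  unfolding mean_def by simp

lemma mean_pd [simp]: "A \<in> pd_mats n \<Longrightarrow> B \<in> pd_mats n \<Longrightarrow> mean t A B \<in> pd_mats n"
  unfolding mean_def by simp

text \<open>For T = A^(-1/2) B^(1/2) the inner matrix of the left mean is T T*, while T* T is the
  inverse of the inner matrix of the right mean; \<open>pw_mult_adj\<close> links their powers for
  every real \<open>t\<close>.\<close>

lemma mean_sym:
  assumes "A \<in> pd_mats n" "B \<in> pd_mats n"
  shows "mean t A B = mean (1 - t) B A"
proof -
  note [simp] = assms
  let ?T = "pw A (-1/2) * pw B (1/2)" and ?S = "pw B (-1/2) * pw A (1/2)"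
  let ?Y = "pw B (1/2) * (pw A (-1) * pw B (1/2))" and ?Z = "pw B (-1/2) * (A * pw B (-1/2))"
  have TT: "?T * adj ?T = pw A (-1/2) * (B * pw A (-1/2))" by (simp add: pw_simps)
  have Y: "adj ?T * ?T = ?Y" by (simp add: pw_simps)
  have Ypd: "?Y \<in> pd_mats n" by simp
  have ZY: "?Z * ?Y = 1\<^sub>m n"
  proof -
    have "?Z * ?Y = pw B (-1/2) * ((pw A 1 * pw B (-1/2)) * (pw B (1/2) * (pw A (-1) * pw B (1/2))))"
      by (simp add: assoc)
    also have "\<dots> = 1\<^sub>m n" by (simp add: pw_simps del: pw_1)
    finally show ?thesis .
  qed
  have Z: "pw ?Z (1 - t) = pw ?Y (t - 1)"
    using pw_pw[of ?Y "-1" "1 - t"] pw_inverse_unique[OF Ypd _ ZY] Ypd by simp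
  have "pw (pw A (-1/2) * (B * pw A (-1/2))) t = ?T * (pw ?Y (t - 1) * adj ?T)"
    using pw_mult_adj[of ?T ?S t] by (simp add: TT Y) (simp add: pw_simps)
  then show ?thesis unfolding mean_def Z using Ypd by (simp add: pw_simps)
qed

lemma mean_mono_right:
  assumes "A \<in> pd_mats n" "B \<in> psd_mats n" "B' \<in> pd_mats n" "qle n B B'" "0 \<le> t" "t \<le> 1"
  shows "qle n (mean t A B) (mean t A B')"
  unfolding mean_def using assms
  by (intro qle_sandwich loewner_heinz) auto

text \<open>Monotonicity in the second argument is Loewner-Heinz; reversing the mean carries it over
  to the first, with weight 1 - t.\<close>

lemma mean_mono:
  assumes "A \<in> pd_mats n" "A' \<in> pd_mats n" "B \<in> pd_mats n" "B' \<in> pd_mats n"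
    "qle n A A'" "qle n B B'" "0 \<le> t" "t \<le> 1"
  shows "qle n (mean t A B) (mean t A' B')"
proof -
  have "qle n (mean t A B) (mean t A B')" using assms by (intro mean_mono_right) auto
  also have "mean t A B' = mean (1 - t) B' A" using assms by (intro mean_sym) auto
  also have "qle n \<dots> (mean (1 - t) B' A')" using assms by (intro mean_mono_right) auto
  also have "mean (1 - t) B' A' = mean t A' B'" using assms by (intro mean_sym[symmetric]) auto
  finally show ?thesis .
qed

lemma mean_commuting:
  assumes "E \<in> pd_mats n"
  shows "mean t (pw E a) (pw E b) = pw E ((1 - t) * a + t * b)"
  unfolding mean_def using assms
  by (simp add: pw_pw pw_simps) (simp add: field_simps)

text \<open>With P = T* X T, the matrix U = P^(-1/2) T* X^(1/2) is unitary and carries the inner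
  matrix of the pair X, Y to that of the transformed pair.\<close>

lemma mean_congruence:
  assumes X: "X \<in> pd_mats n" and Y: "Y \<in> pd_mats n" and T: "T \<in> carrier_mat n n"
    and P: "adj T * (X * T) \<in> pd_mats n"
  shows "mean t (adj T * (X * T)) (adj T * (Y * T)) = adj T * (mean t X Y * T)"
proof -
  note [simp] = X Y T P
  let ?P = "adj T * (X * T)"
  define U where "U = pw ?P (-1/2) * (adj T * pw X (1/2))"
  define N where "N = pw X (-1/2) * (Y * pw X (-1/2))"
  have N [simp]: "N \<in> pd_mats n" by (simp add: N_def)
  have U [simp]: "U \<in> carrier_mat n n" by (simp add: U_def)
  have aU: "adj U = pw X (1/2) * (T * pw ?P (-1/2))" by (simp add: U_def adj_mul assoc)
  have "U * adj U = pw ?P (-1/2) * ((adj T * (X * T)) * pw ?P (-1/2))"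
    unfolding aU U_def by (simp add: pw_simps)
  also have "\<dots> = pw ?P (-1/2) * (pw ?P 1 * pw ?P (-1/2))" by simp
  also have "\<dots> = 1\<^sub>m n" by (simp add: pw_mul pw_mul' del: pw_1)
  finally have UU: "U * adj U = 1\<^sub>m n" .
  have "U * (N * adj U) = pw ?P (-1/2) * ((adj T * (Y * T)) * pw ?P (-1/2))"
    unfolding aU N_def unfolding U_def by (simp add: pw_simps)
  then have "pw (pw ?P (-1/2) * ((adj T * (Y * T)) * pw ?P (-1/2))) t = U * (pw N t * adj U)"
    using pw_unitary[OF _ U UU, of N t] by simp
  then have "mean t ?P (adj T * (Y * T)) = pw ?P (1/2) * ((U * (pw N t * adj U)) * pw ?P (1/2))"
    unfolding mean_def by simp
  also have "\<dots> = (pw ?P (1/2) * U) * (pw N t * (adj U * pw ?P (1/2)))"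
    by (simp add: assoc)
  also have "pw ?P (1/2) * U = adj T * pw X (1/2)"
    unfolding U_def by (subst pw_mul') simp_all
  also have "adj U * pw ?P (1/2) = pw X (1/2) * T"
    unfolding aU by (simp add: assoc) (subst pw_mul, simp_all)
  finally have "mean t ?P (adj T * (Y * T)) = (adj T * pw X (1/2)) * (pw N t * (pw X (1/2) * T))" .
  then show ?thesis unfolding mean_def N_def[symmetric] by (simp add: assoc)
qed

lemma mat_fun_smult_fun:
  assumes "herm n A"
  shows "mat_fun (\<lambda>x. c * f x) A = complex_of_real c \<cdot>\<^sub>m mat_fun f A"
proof -
  have "mat_fun (\<lambda>x. c * f x) A = mat_fun (\<lambda>x. c) A * mat_fun f A"
    using mat_fun_mult[OF assms, of "\<lambda>x. c" f] by simp
  then show ?thesis using assms by (simp add: mat_fun_const msmult mat_fun_carrier)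
qed

lemma pw_smult:
  assumes A: "A \<in> psd_mats n" and c: "0 \<le> c"
  shows "pw (complex_of_real c \<cdot>\<^sub>m A) r = complex_of_real (c powr r) \<cdot>\<^sub>m pw A r"
proof -
  have "complex_of_real c \<cdot>\<^sub>m A = mat_fun (\<lambda>x. c * x) A"
    using mat_fun_smult_fun[of A c "\<lambda>x. x"] A by (simp add: mat_fun_id)
  then have "pw (complex_of_real c \<cdot>\<^sub>m A) r = mat_fun (\<lambda>x. (c * x) powr r) A"
    using A by (simp add: pw_def mat_fun_comp)
  also have "\<dots> = mat_fun (\<lambda>x. c powr r * x powr r) A"
    using c by (intro mat_fun_cong_psd[OF A]) (simp add: powr_mult)
  also have "\<dots> = complex_of_real (c powr r) \<cdot>\<^sub>m pw A r"
    using A by (simp add: mat_fun_smult_fun pw_def)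
  finally show ?thesis .
qed

lemma smult_psd: 
  assumes A: "A \<in> psd_mats n" and c: "0 \<le> c"
  shows "complex_of_real c \<cdot>\<^sub>m A \<in> psd_mats n"
proof (rule psdI)
  show "herm n (complex_of_real c \<cdot>\<^sub>m A)"
    by (rule hermI) (use A in \<open>simp_all add: adj_smult\<close>)
qed (use A c in \<open>simp add: qform_smult psdD\<close>)

lemma smult_pd: 
  assumes A: "A \<in> pd_mats n" and c: "0 < c"
  shows "complex_of_real c \<cdot>\<^sub>m A \<in> pd_mats n"
proof (rule pdI)
  show "herm n (complex_of_real c \<cdot>\<^sub>m A)"
    by (rule hermI) (use A in \<open>simp_all add: adj_smult\<close>)
qed (use A c in \<open>simp add: qform_smult pdD\<close>)

lemma qle_smult:
  assumes "A \<in> carrier_mat n n" "B \<in> carrier_mat n n" "qle n A B" "0 \<le> c"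
  shows "qle n (complex_of_real c \<cdot>\<^sub>m A) (complex_of_real c \<cdot>\<^sub>m B)"
  using assms by (auto simp: qle_def qform_smult intro: mult_left_mono)

lemma herm_bounded:
  assumes "herm n A"
  shows "\<exists>c>0. qle n A (complex_of_real c \<cdot>\<^sub>m 1\<^sub>m n)"
proof -
  obtain U d where U: "U \<in> unitary_mats n" "A = U * rdiag n d * adj U"
    "\<And>f. mat_fun f A = U * rdiag n (\<lambda>i. f (d i)) * adj U" by (rule herm_obtain[OF assms]) blast
  define c where "c = 1 + (\<Sum>i<n. \<bar>d i\<bar>)"
  have "d i \<le> c" if "i < n" for i
  proof -
    have "\<bar>d i\<bar> \<le> (\<Sum>i<n. \<bar>d i\<bar>)" using that by (intro member_le_sum) auto
    then show ?thesis by (simp add: c_def)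
  qed
  then have "qle n (U * rdiag n d * adj U) (U * rdiag n (\<lambda>i. c) * adj U)"
    by (intro qle_udiag unitary_matsD(1)[OF U(1)])
  then have "qle n A (complex_of_real c \<cdot>\<^sub>m 1\<^sub>m n)"
    unfolding mat_fun_const[OF assms, symmetric] U(3) by (subst U(2))
  moreover have "0 < c" unfolding c_def by (intro add_pos_nonneg sum_nonneg) auto
  ultimately show ?thesis by blast
qed

lemma qle_scalar_iff:
  assumes U: "U \<in> unitary_mats n" and A: "A = U * rdiag n d * adj U"
  shows "qle n A (complex_of_real c \<cdot>\<^sub>m 1\<^sub>m n) \<longleftrightarrow> (\<forall>i<n. d i \<le> c)"
proof
  assume le: "qle n A (complex_of_real c \<cdot>\<^sub>m 1\<^sub>m n)"
  show "\<forall>i<n. d i \<le> c"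
  proof (intro allI impI)
    fix i assume i: "i < n"
    note e = eigencol[OF U A i]
    have "d i * qform (1\<^sub>m n) (col U i) = qform A (col U i)"
      using e(1) unfolding qform_def e(3) by (simp add: smult_scalar_prod_distrib[of _ n])
    also have "\<dots> \<le> c * qform (1\<^sub>m n) (col U i)"
      using le e(1) by (simp add: qle_def qform_smult)
    finally show "d i \<le> c" using qform_one_pos[OF e(1,2)] by simp
  qed
next
  assume le: "\<forall>i<n. d i \<le> c"
  have "qle n (U * rdiag n d * adj U) (U * rdiag n (\<lambda>i. c) * adj U)"
    using le by (intro qle_udiag unitary_matsD(1)[OF U]) auto
  moreover have "U * rdiag n (\<lambda>i. c) * adj U = complex_of_real c \<cdot>\<^sub>m 1\<^sub>m n"
    using mat_fun_eq[OF U A, of "\<lambda>x. c"] mat_fun_const[of A c] udiag_herm[OF unitary_matsD(1)[OF U], of d] A by simp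
  ultimately show "qle n A (complex_of_real c \<cdot>\<^sub>m 1\<^sub>m n)" by (simp only: A)
qed

lemma pw_le_scalar:
  assumes A: "A \<in> psd_mats n" and le: "qle n A (complex_of_real c \<cdot>\<^sub>m 1\<^sub>m n)" and s: "0 \<le> s"
  shows "qle n (pw A s) (complex_of_real (c powr s) \<cdot>\<^sub>m 1\<^sub>m n)"
proof (rule psd_obtain[OF A])
  fix U d assume U: "U \<in> unitary_mats n" "A = U * rdiag n d * adj U"
    "\<And>f. mat_fun f A = U * rdiag n (\<lambda>i. f (d i)) * adj U" "\<And>i. i < n \<Longrightarrow> 0 \<le> d i"
  have "\<forall>i<n. d i \<le> c" using qle_scalar_iff[OF U(1,2)] le by blast
  then have "\<forall>i<n. d i powr s \<le> c powr s" using U(4) s by (auto intro: powr_mono2)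
  then show ?thesis unfolding pw_def using qle_scalar_iff[OF U(1) U(3)] by simp
qed

lemma pw_le_one:
  assumes "A \<in> psd_mats n" "qle n A (1\<^sub>m n)" "0 \<le> s"
  shows "qle n (pw A s) (1\<^sub>m n)"
  using pw_le_scalar[of A 1 s] assms by simp

section \<open>Log-majorization inequalities at the level of operator norms\<close>

text \<open>With K = F^(1/2) H F^(1/2) one has E = F^(-1/2) K^(1/2) F^(-1/2), so the two square
  roots of \<open>K\<close> meet in E F E.\<close>

lemma riccati:
  assumes "F \<in> pd_mats n" "H \<in> psd_mats n"
  defines "E \<equiv> mean (1/2) (pw F (-1)) H"
  shows "E * (F * E) = H"
proof -
  define K where "K = pw F (1/2) * (H * pw F (1/2))"
  note [simp] = assms(1,2)
  have K [simp]: "K \<in> psd_mats n" by (simp add: K_def)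
  have E: "E = pw F (-1/2) * (pw K (1/2) * pw F (-1/2))"
    unfolding E_def mean_def K_def by (simp add: pw_pw)
  have "E * (F * E) = E * (pw F 1 * E)" by simp
  also have "\<dots> = pw F (-1/2) * (K * pw F (-1/2))"
    unfolding E by (simp add: pw_simps del: pw_1) (simp add: pw_simps)
  also have "\<dots> = H" unfolding K_def by (simp add: pw_simps)
  finally show ?thesis .
qed

text \<open>Writing \<open>C = A\<^bsup>-1/2\<^esup> B A\<^bsup>-1/2\<^esup>\<close>, the hypothesis reads \<open>A \<le> C\<^bsup>-\<alpha>\<^esup>\<close>.\<close>

lemma ando_hiai_step:
  assumes A: "A \<in> pd_mats n" and B: "B \<in> pd_mats n" and \<alpha>: "0 \<le> \<alpha>" "\<alpha> \<le> 1"
    and le: "qle n (mean \<alpha> A B) (1\<^sub>m n)" and r: "1 \<le> r" "r \<le> 2"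
  shows "qle n (mean \<alpha> (pw A r) (pw B r)) (1\<^sub>m n)"
proof -
  define C where "C = pw A (-1/2) * (B * pw A (-1/2))"
  note [simp] = A B
  have C [simp]: "C \<in> pd_mats n" by (simp add: C_def)
  have m: "mean \<alpha> A B = pw A (1/2) * (pw C \<alpha> * pw A (1/2))" by (simp add: mean_def C_def)
  have "qle n (pw C \<alpha>) (pw A (-(1/2)) * (1\<^sub>m n * pw A (-(1/2))))"
    using le unfolding m by (intro qle_move) auto
  then have "qle n (pw C \<alpha>) (pw A (-1))" by (simp add: pw_mul pw_mul')
  then have "qle n (pw (pw A (-1)) (-1)) (pw (pw C \<alpha>) (-1))" by (intro inverse_antimono) auto
  then have AC: "qle n A (pw C (-\<alpha>))" by (simp add: pw_pw)
  \<comment> \<open>These exponents satisfy (1 - \<alpha>) a + \<alpha> b = \<alpha>, so the bounds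
    for A^r and B^r have exactly the original mean of A and B as their mean.\<close>
  let ?a = "-\<alpha> * (r - 1)" and ?b = "1 + (1 - \<alpha>) * (r - 1)"
  have "qle n (pw A (r - 1)) (pw (pw C (-\<alpha>)) (r - 1))"
    using r AC by (intro loewner_heinz) auto
  then have "qle n (pw A (1/2) * (pw A (r - 1) * pw A (1/2))) (pw A (1/2) * (pw C ?a * pw A (1/2)))"
    by (intro qle_sandwich) (auto simp: pw_pw)
  then have Ar: "qle n (pw A r) (pw A (1/2) * (pw C ?a * pw A (1/2)))" by (simp add: pw_mul pw_mul')
  \<comment> \<open>Since B = T T*, the power B^r equals T (T* T)^(r-1) T*. Only the exponent r - 1
    meets Loewner-Heinz, and it lies in [0, 1] because r \<le> 2.\<close>
  let ?T = "pw A (1/2) * pw C (1/2)" and ?S = "pw C (-1/2) * pw A (-1/2)"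
  have "?T * adj ?T = pw A (1/2) * (C * pw A (1/2))" by (simp add: pw_simps)
  also have "\<dots> = B" unfolding C_def by (simp add: pw_simps)
  finally have TT: "?T * adj ?T = B" .
  let ?Y = "pw C (1/2) * (A * pw C (1/2))"
  have Y: "adj ?T * ?T = ?Y" by (simp add: pw_simps)
  have Br: "pw B r = ?T * (pw ?Y (r - 1) * adj ?T)"
    using pw_mult_adj[of ?T ?S r] unfolding TT Y by (simp add: pw_simps)
  have "qle n ?Y (pw C (1/2) * (pw C (-\<alpha>) * pw C (1/2)))"
    using AC by (intro qle_sandwich) auto
  then have "qle n ?Y (pw C (1 - \<alpha>))" by (simp add: pw_mul pw_mul')
  then have "qle n (pw ?Y (r - 1)) (pw (pw C (1 - \<alpha>)) (r - 1))"
    using r by (intro loewner_heinz) auto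
  then have "qle n (adj (adj ?T) * (pw ?Y (r - 1) * adj ?T)) (adj (adj ?T) * (pw C ((1 - \<alpha>) * (r - 1)) * adj ?T))"
    by (intro qle_cong) (auto simp: pw_pw)
  then have "qle n (pw B r) (?T * (pw C ((1 - \<alpha>) * (r - 1)) * adj ?T))" unfolding Br by simp
  moreover have "?T * (pw C ((1 - \<alpha>) * (r - 1)) * adj ?T) = pw A (1/2) * (pw C ?b * pw A (1/2))"
    by (simp add: pw_simps)
  ultimately have Br: "qle n (pw B r) (pw A (1/2) * (pw C ?b * pw A (1/2)))" by simp
  have "qle n (mean \<alpha> (pw A r) (pw B r)) (mean \<alpha> (pw A (1/2) * (pw C ?a * pw A (1/2))) (pw A (1/2) * (pw C ?b * pw A (1/2))))"
    using Ar Br \<alpha> by (intro mean_mono) auto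
  also have "\<dots> = pw A (1/2) * (mean \<alpha> (pw C ?a) (pw C ?b) * pw A (1/2))"
    using mean_congruence[of "pw C ?a" "pw C ?b" "pw A (1/2)" \<alpha>] by simp
  also have "mean \<alpha> (pw C ?a) (pw C ?b) = pw C \<alpha>"
    unfolding mean_commuting[OF C] by (rule arg_cong[of _ _ "pw C"]) (simp add: algebra_simps)
  also have "pw A (1/2) * (pw C \<alpha> * pw A (1/2)) = mean \<alpha> A B" by (simp add: m)
  finally show ?thesis using le by (rule qle_trans)
qed

text \<open>An exponent above 2 is reached from its half by one more step with factor 2; the
  induction is on the number of doublings.\<close>

lemma ando_hiai:
  assumes A: "A \<in> pd_mats n" and B: "B \<in> pd_mats n" and \<alpha>: "0 \<le> \<alpha>" "\<alpha> \<le> 1"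
    and le: "qle n (mean \<alpha> A B) (1\<^sub>m n)" and r: "1 \<le> r"
  shows "qle n (mean \<alpha> (pw A r) (pw B r)) (1\<^sub>m n)"
proof -
  have *: "qle n (mean \<alpha> (pw A r) (pw B r)) (1\<^sub>m n)" if "1 \<le> r" "r \<le> 2 ^ k" for r k
    using that
  proof (induction k arbitrary: r)
    case 0
    then show ?case using A B le by simp
  next
    case (Suc k)
    show ?case
    proof (cases "r \<le> 2")
      case True
      then show ?thesis using ando_hiai_step[OF A B \<alpha> le] Suc.prems by simp
    next
      case False
      then have "qle n (mean \<alpha> (pw A (r / 2)) (pw B (r / 2))) (1\<^sub>m n)"
        using Suc by (intro Suc.IH) auto
      then have "qle n (mean \<alpha> (pw (pw A (r / 2)) 2) (pw (pw B (r / 2)) 2)) (1\<^sub>m n)"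
        using A B \<alpha> by (intro ando_hiai_step[of "pw A (r / 2)" "pw B (r / 2)" \<alpha> 2]) auto
      then show ?thesis using A B by (simp add: pw_pw)
    qed
  qed
  obtain k where "r < 2 ^ k" using real_arch_pow[of 2 r] by auto
  then show ?thesis using r by (intro *[of _ k]) auto
qed

text \<open>Here \<open>r\<close> stands for q/p. The upper bounds E^(-2\<alpha>) for F and
  E^(2-2\<alpha>) for H commute, and the exponents of their \<alpha>-mean cancel to E^0 = 1.\<close>

theorem spectral_mean_dominates:
  assumes F: "F \<in> pd_mats n" and H: "H \<in> pd_mats n" and \<alpha>: "0 < \<alpha>" "\<alpha> < 1" and r: "0 < r"
    and E: "E = mean (1/2) (pw F (-1)) H"
    and le: "qle n (pw E \<alpha> * (F * pw E \<alpha>)) (1\<^sub>m n)"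
  shows "qle n (mean \<alpha> (pw F r) (pw H r)) (1\<^sub>m n)"
proof -
  have *: "qle n (mean \<alpha> (pw F r) (pw H r)) (1\<^sub>m n)" if r: "0 \<le> r" "r \<le> 1" for r
  proof -
    note [simp] = F H
    have [simp]: "E \<in> pd_mats n" by (simp add: E)
    have "qle n F (pw E (-\<alpha>) * (1\<^sub>m n * pw E (-\<alpha>)))" using le by (intro qle_move) auto
    then have F_le: "qle n F (pw E (-2*\<alpha>))" by (simp add: pw_mul pw_mul')
    have "qle n (E * (F * E)) (E * (pw E (-2*\<alpha>) * E))" using F_le by (intro qle_sandwich) auto
    also have "E * (pw E (-2*\<alpha>) * E) = pw E 1 * (pw E (-2*\<alpha>) * pw E 1)" by simp
    also have "\<dots> = pw E (2 - 2*\<alpha>)" by (simp add: pw_mul pw_mul' del: pw_1)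
    finally have H_le: "qle n H (pw E (2 - 2*\<alpha>))" unfolding E using riccati[OF F pd_psd[OF H]] by simp
    have "qle n (pw F r) (pw (pw E (-2*\<alpha>)) r)" "qle n (pw H r) (pw (pw E (2 - 2*\<alpha>)) r)"
      using F_le H_le r by (intro loewner_heinz; simp)+
    then have "qle n (mean \<alpha> (pw F r) (pw H r)) (mean \<alpha> (pw E (-2*\<alpha>*r)) (pw E ((2 - 2*\<alpha>)*r)))"
      using \<alpha> by (intro mean_mono) (auto simp: pw_pw)
    also have "mean \<alpha> (pw E (-2*\<alpha>*r)) (pw E ((2 - 2*\<alpha>)*r)) = pw E 0"
      unfolding mean_commuting[OF \<open>E \<in> pd_mats n\<close>] by (rule arg_cong[of _ _ "pw E"]) (simp add: algebra_simps)
    finally show ?thesis by simp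
  qed
  show ?thesis
  proof (cases "r \<le> 1")
    case False
    have "qle n (mean \<alpha> F H) (1\<^sub>m n)" using *[of 1] F H by simp
    then show ?thesis using False \<alpha> by (intro ando_hiai F H) auto
  qed (use * r in simp)
qed

text \<open>The hypothesis reads C^\<alpha> \<le> c A^(-1) for the inner matrix \<open>C\<close>;
  since 1/\<alpha> < 1, Loewner-Heinz permits taking the root of order \<alpha>.\<close>

lemma geo_mean_bound:
  assumes A: "A \<in> pd_mats n" and B: "B \<in> pd_mats n" and \<alpha>: "1 < \<alpha>"
    and le: "qle n (mean \<alpha> A B) (complex_of_real c \<cdot>\<^sub>m 1\<^sub>m n)" and c: "0 < c"
  shows "qle n B (complex_of_real (c powr (1/\<alpha>)) \<cdot>\<^sub>m pw A (1 - 1/\<alpha>))"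
proof -
  define C where "C = pw A (-1/2) * (B * pw A (-1/2))"
  note [simp] = A B
  have C [simp]: "C \<in> pd_mats n" by (simp add: C_def)
  have m: "mean \<alpha> A B = pw A (1/2) * (pw C \<alpha> * pw A (1/2))" by (simp add: mean_def C_def)
  have "qle n (pw C \<alpha>) (pw A (-(1/2)) * ((complex_of_real c \<cdot>\<^sub>m 1\<^sub>m n) * pw A (-(1/2))))"
    using le unfolding m by (intro qle_move) auto
  then have "qle n (pw C \<alpha>) (complex_of_real c \<cdot>\<^sub>m pw A (-1))" by (simp add: pw_mul pw_mul' msmult)
  then have "qle n (pw (pw C \<alpha>) (1/\<alpha>)) (pw (complex_of_real c \<cdot>\<^sub>m pw A (-1)) (1/\<alpha>))"
    using \<alpha> c by (intro loewner_heinz) (auto intro: smult_pd)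
  then have "qle n C (complex_of_real (c powr (1/\<alpha>)) \<cdot>\<^sub>m pw A (-1/\<alpha>))"
    using \<alpha> c by (simp add: pw_pw pw_smult)
  then have "qle n (pw A (1/2) * (C * pw A (1/2))) (pw A (1/2) * ((complex_of_real (c powr (1/\<alpha>)) \<cdot>\<^sub>m pw A (-1/\<alpha>)) * pw A (1/2)))"
    by (intro qle_sandwich) auto
  also have "pw A (1/2) * (C * pw A (1/2)) = B" unfolding C_def by (simp add: pw_simps)
  finally show ?thesis by (simp add: msmult pw_mul pw_mul')
qed

text \<open>Here \<open>p\<close> stands for p/q. For p \<le> 1 this is
  \<open>geo_mean_bound\<close> with Loewner-Heinz; the gain is in larger exponents. The case
  distinction follows which of 2 and \<alpha>/(\<alpha>-1) is smaller.\<close>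

lemma geo_mean_bound_power:
  assumes A: "A \<in> pd_mats n" and B: "B \<in> pd_mats n" and \<alpha>: "1 < \<alpha>"
    and le: "qle n (mean \<alpha> A B) (1\<^sub>m n)" and p: "0 < p" "p \<le> 2" "p \<le> \<alpha> / (\<alpha> - 1)"
  shows "qle n (pw B p) (pw A (p * (1 - 1/\<alpha>)))"
proof (cases "2 \<le> \<alpha>")
  case True
  note [simp] = A B
  define Z where "Z = pw B (-1/2) * (A * pw B (-1/2))"
  have [simp]: "Z \<in> pd_mats n" by (simp add: Z_def)
  have "mean \<alpha> A B = pw B (1/2) * (pw Z (1 - \<alpha>) * pw B (1/2))"
    by (subst mean_sym) (simp_all add: mean_def Z_def)
  then have "qle n (pw Z (1 - \<alpha>)) (pw B (-(1/2)) * (1\<^sub>m n * pw B (-(1/2))))"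
    using le by (intro qle_move) auto
  then have "qle n (pw Z (1 - \<alpha>)) (pw B (-1))" by (simp add: pw_mul pw_mul')
  \<comment> \<open>For \<alpha> \<ge> 2 the exponent -1/(\<alpha>-1) lies in [-1, 0], so taking
    this power reverses the order.\<close>
  then have "qle n (pw (pw B (-1)) (-(1/(\<alpha>-1)))) (pw (pw Z (1 - \<alpha>)) (-(1/(\<alpha>-1))))"
    using True by (intro loewner_heinz_neg) auto
  moreover have "(1 - \<alpha>) * (-(1/(\<alpha>-1))) = 1" using True by (simp add: field_simps)
  ultimately have "qle n (pw B (1/(\<alpha>-1))) Z" by (simp add: pw_pw del: mult_minus_right)
  then have "qle n (pw B (1/2) * (pw B (1/(\<alpha>-1)) * pw B (1/2))) (pw B (1/2) * (Z * pw B (1/2)))"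
    by (intro qle_sandwich) auto
  also have "pw B (1/2) * (Z * pw B (1/2)) = A" unfolding Z_def by (simp add: pw_simps)
  also have "pw B (1/2) * (pw B (1/(\<alpha>-1)) * pw B (1/2)) = pw B (\<alpha>/(\<alpha>-1))"
    by (simp add: pw_mul pw_mul') (rule arg_cong[of _ _ "pw B"], use True in \<open>simp add: field_simps\<close>)
  finally have "qle n (pw (pw B (\<alpha>/(\<alpha>-1))) (p * (1 - 1/\<alpha>))) (pw A (p * (1 - 1/\<alpha>)))"
    using p True by (intro loewner_heinz) (auto simp: field_simps)
  moreover have "\<alpha>/(\<alpha>-1) * (p * (1 - 1/\<alpha>)) = p" using True by (simp add: field_simps)
  ultimately show ?thesis by (simp add: pw_pw)
next
  case False
  note [simp] = A B
  let ?\<theta> = "1 - 1/\<alpha>"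
  define Z where "Z = pw B (1/2) * (pw A (-1) * pw B (1/2))"
  have "qle n B (complex_of_real (1 powr (1/\<alpha>)) \<cdot>\<^sub>m pw A ?\<theta>)"
    using le by (intro geo_mean_bound) (auto simp: \<alpha>)
  then have "qle n B (pw A ?\<theta>)" by simp
  then have "qle n (pw (pw A ?\<theta>) (-1)) (pw B (-1))" by (intro inverse_antimono) auto
  then have BA: "qle n (pw A (-?\<theta>)) (pw B (-1))" by (simp add: pw_pw)
  have "mean (\<alpha>-1) (pw B (-1)) (pw A (-1)) = pw B (-1/2) * (pw Z (\<alpha>-1) * pw B (-1/2))"
    by (simp add: mean_def Z_def pw_pw)
  moreover have "mean \<alpha> A B = pw B (1/2) * (pw Z (\<alpha>-1) * pw B (1/2))"
  proof -
    let ?Y = "pw B (-1/2) * (A * pw B (-1/2))"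
    have "?Y * Z = pw B (-1/2) * (pw A 1 * pw B (-1/2)) * Z" by simp
    also have "\<dots> = 1\<^sub>m n" unfolding Z_def by (simp add: pw_simps del: pw_1)
    finally have "pw Z (-1) = ?Y" by (intro pw_inverse_unique) (auto simp: Z_def)
    moreover have "pw (pw Z (-1)) (1 - \<alpha>) = pw Z (\<alpha>-1)" by (simp add: pw_pw Z_def)
    ultimately show ?thesis by (subst mean_sym) (simp_all add: mean_def)
  qed
  moreover have [simp]: "Z \<in> pd_mats n" by (simp add: Z_def)
  \<comment> \<open>Conjugation by B trades the weight \<alpha>, which exceeds 1, for \<alpha> - 1,
    which is below 1, so that the mean becomes monotone in both arguments.\<close>
  ultimately have "pw B 1 * (mean (\<alpha>-1) (pw B (-1)) (pw A (-1)) * pw B 1) = mean \<alpha> A B"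
    by (simp add: pw_simps del: pw_1)
  then have "qle n (mean (\<alpha>-1) (pw B (-1)) (pw A (-1))) (pw B (-1) * (1\<^sub>m n * pw B (-1)))"
    using le by (intro qle_move) auto
  then have le2: "qle n (mean (\<alpha>-1) (pw B (-1)) (pw A (-1))) (pw B (-2))" by (simp add: pw_mul pw_mul')
  \<comment> \<open>Replacing B^(-1) by its lower bound A^(-\<theta>) leaves a mean of two powers of
    A, namely A^(-2\<theta>), below B^(-2); the power -p/2 is then admissible because p \<le>
    2.\<close>
  have "qle n (mean (\<alpha>-1) (pw A (-?\<theta>)) (pw A (-1))) (mean (\<alpha>-1) (pw B (-1)) (pw A (-1)))"
    using BA \<alpha> False by (intro mean_mono) auto
  also note le2
  also have "mean (\<alpha>-1) (pw A (-?\<theta>)) (pw A (-1)) = pw A (-2*?\<theta>)"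
    unfolding mean_commuting[OF A] by (rule arg_cong[of _ _ "pw A"]) (use \<alpha> in \<open>simp add: field_simps\<close>)
  finally have "qle n (pw (pw B (-2)) (-(p/2))) (pw (pw A (-2*?\<theta>)) (-(p/2)))"
    using p by (intro loewner_heinz_neg) auto
  moreover have "-2*?\<theta> * (-(p/2)) = p * ?\<theta>" by (simp add: field_simps)
  ultimately show ?thesis by (simp add: pw_pw)
qed

text \<open>The bound \<open>H \<le> F\<^bsup>\<theta>\<^esup>\<close> turns any bound \<open>c\<close> on \<open>E\<^sup>\<alpha> F E\<^sup>\<alpha>\<close> into the bound \<open>c\<^bsup>\<theta>\<^esup>\<close>; iterating gives 1.\<close>

theorem spectral_mean_dominated:
  assumes F: "F \<in> pd_mats n" and H: "H \<in> pd_mats n" and \<alpha>: "1 < \<alpha>"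
    and E: "E = mean (1/2) (pw F (-1)) H"
    and le: "qle n H (pw F (1 - 1/\<alpha>))"
  shows "qle n (pw E \<alpha> * (F * pw E \<alpha>)) (1\<^sub>m n)"
proof -
  note [simp] = F H
  have Epd [simp]: "E \<in> pd_mats n" by (simp add: E)
  let ?X = "pw E \<alpha> * (F * pw E \<alpha>)"
  define \<theta> where "\<theta> = 1 - 1/\<alpha>"
  have \<theta>: "0 < \<theta>" "\<theta> < 1" using \<alpha> by (auto simp: \<theta>_def)
  have step: "qle n ?X (complex_of_real (c powr \<theta>) \<cdot>\<^sub>m 1\<^sub>m n)"
    if c: "0 < c" "qle n ?X (complex_of_real c \<cdot>\<^sub>m 1\<^sub>m n)" for c
  proof -
    have "qle n F (pw E (-\<alpha>) * ((complex_of_real c \<cdot>\<^sub>m 1\<^sub>m n) * pw E (-\<alpha>)))"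
      using c by (intro qle_move) auto
    then have "qle n F (complex_of_real c \<cdot>\<^sub>m pw E (-2*\<alpha>))" by (simp add: pw_mul pw_mul' msmult)
    then have "qle n (pw F \<theta>) (pw (complex_of_real c \<cdot>\<^sub>m pw E (-2*\<alpha>)) \<theta>)"
      using c \<theta> by (intro loewner_heinz) (auto intro: smult_pd)
    then have "qle n (pw F \<theta>) (complex_of_real (c powr \<theta>) \<cdot>\<^sub>m pw E (2 - 2*\<alpha>))"
    proof -
      \<comment> \<open>This identity is what ties \<theta> to \<alpha>: after conjugation by E^(-1)
        the bound on F returns with the same power -2\<alpha> of E, and only the constant has
        changed.\<close>
      have "-2*\<alpha>*\<theta> = 2 - 2*\<alpha>" using \<alpha> by (simp add: \<theta>_def field_simps)
      then have "pw (complex_of_real c \<cdot>\<^sub>m pw E (-2*\<alpha>)) \<theta> = complex_of_real (c powr \<theta>) \<cdot>\<^sub>m pw E (2 - 2*\<alpha>)"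
        using c by (simp add: pw_smult pw_pw del: mult_minus_left)
      then show ?thesis using \<open>qle n (pw F \<theta>) (pw (complex_of_real c \<cdot>\<^sub>m pw E (-2*\<alpha>)) \<theta>)\<close> by (simp only:)
    qed
    with le have "qle n H (complex_of_real (c powr \<theta>) \<cdot>\<^sub>m pw E (2 - 2*\<alpha>))"
      unfolding \<theta>_def[symmetric] by (rule qle_trans)
    then have "qle n (pw E 1 * (F * pw E 1)) (complex_of_real (c powr \<theta>) \<cdot>\<^sub>m pw E (2 - 2*\<alpha>))"
      using riccati[OF F pd_psd[OF H]] unfolding E[symmetric] by simp
    then have "qle n F (pw E (-1) * ((complex_of_real (c powr \<theta>) \<cdot>\<^sub>m pw E (2 - 2*\<alpha>)) * pw E (-1)))"
      by (intro qle_move) auto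
    then have "qle n F (complex_of_real (c powr \<theta>) \<cdot>\<^sub>m pw E (-2*\<alpha>))" by (simp add: pw_mul pw_mul' msmult)
    then have "qle n ?X (pw E \<alpha> * ((complex_of_real (c powr \<theta>) \<cdot>\<^sub>m pw E (-2*\<alpha>)) * pw E \<alpha>))"
      by (intro qle_sandwich) auto
    then show ?thesis by (simp add: pw_mul pw_mul' msmult)
  qed
  have "herm n ?X" by simp
  then obtain c where c: "0 < c" "qle n ?X (complex_of_real c \<cdot>\<^sub>m 1\<^sub>m n)" using herm_bounded by blast
  have iter: "qle n ?X (complex_of_real (c powr (\<theta> ^ k)) \<cdot>\<^sub>m 1\<^sub>m n)" for k
  proof (induction k)
    case (Suc k)
    then show ?case using step[of "c powr (\<theta> ^ k)"] c by (simp add: powr_powr mult.commute)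
  qed (use c in simp)
  show ?thesis unfolding qle_def
  proof
    fix v :: "complex vec" assume v: "v \<in> carrier_vec n"
    have "(\<lambda>k. c powr (\<theta> ^ k)) \<longlonglongrightarrow> c powr 0"
      using c \<theta> by (intro tendsto_powr tendsto_const LIMSEQ_realpow_zero) auto
    then have "(\<lambda>k. c powr (\<theta> ^ k) * qform (1\<^sub>m n) v) \<longlonglongrightarrow> 1 * qform (1\<^sub>m n) v"
      using c by (intro tendsto_mult tendsto_const) simp
    moreover have "qform ?X v \<le> c powr (\<theta> ^ k) * qform (1\<^sub>m n) v" for k
      using iter[of k] v by (simp add: qle_def qform_smult)
    ultimately show "qform ?X v \<le> qform (1\<^sub>m n) v"
      by (intro LIMSEQ_le_const[of _ "qform (1\<^sub>m n) v"]) auto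
  qed
qed

section \<open>Continuity of powers\<close>

text \<open>In a fixed dimension, entrywise convergence is the same as convergence in norm.\<close>

definition mconv :: "(nat \<Rightarrow> complex mat) \<Rightarrow> complex mat \<Rightarrow> bool" where
  "mconv X L \<longleftrightarrow> (\<forall>k. X k \<in> carrier_mat n n) \<and> L \<in> carrier_mat n n \<and>
     (\<forall>i<n. \<forall>j<n. (\<lambda>k. X k $$ (i, j)) \<longlonglongrightarrow> L $$ (i, j))"

lemma mconvD:
  "mconv X L \<Longrightarrow> X k \<in> carrier_mat n n" "mconv X L \<Longrightarrow> L \<in> carrier_mat n n"
  "mconv X L \<Longrightarrow> i < n \<Longrightarrow> j < n \<Longrightarrow> (\<lambda>k. X k $$ (i, j)) \<longlonglongrightarrow> L $$ (i, j)"
  by (auto simp: mconv_def)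

lemma mconv_const: "A \<in> carrier_mat n n \<Longrightarrow> mconv (\<lambda>k. A) A"
  by (simp add: mconv_def)

lemma mult_entry:
  fixes A B :: "complex mat"
  assumes "A \<in> carrier_mat n n" "B \<in> carrier_mat n n" "i < n" "j < n"
  shows "(A * B) $$ (i, j) = (\<Sum>k<n. A $$ (i, k) * B $$ (k, j))"
  using assms by (auto simp: scalar_prod_def lessThan_atLeast0 intro!: sum.cong)

lemma mconv_mult:
  assumes "mconv X A" "mconv Y B"
  shows "mconv (\<lambda>k. X k * Y k) (A * B)"
proof -
  note [simp] = mconvD(1,2)[OF assms(1)] mconvD(1,2)[OF assms(2)]
  have "(\<lambda>k. (X k * Y k) $$ (i, j)) \<longlonglongrightarrow> (A * B) $$ (i, j)" if "i < n" "j < n" for i j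
    using that assms by (simp only: mult_entry mconvD) (intro tendsto_sum tendsto_mult mconvD(3), auto)
  then show ?thesis by (simp add: mconv_def)
qed

lemma qform_entries:
  assumes "A \<in> carrier_mat n n" "v \<in> carrier_vec n"
  shows "qform A v = Re (\<Sum>i<n. \<Sum>j<n. A $$ (i, j) * v $ j * cnj (v $ i))"
  unfolding qform_def using assms
  by (auto simp: scalar_prod_def lessThan_atLeast0 sum_distrib_right intro!: sum.cong)

lemma qform_entry_bound:
  assumes "A \<in> carrier_mat n n" "v \<in> carrier_vec n"
  shows "\<bar>qform A v\<bar> \<le> (\<Sum>i<n. \<Sum>j<n. cmod (A $$ (i, j))) * qform (1\<^sub>m n) v"
proof -
  have "\<bar>qform A v\<bar> \<le> cmod (\<Sum>i<n. \<Sum>j<n. A $$ (i, j) * v $ j * cnj (v $ i))"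
    unfolding qform_entries[OF assms] by (rule abs_Re_le_cmod)
  also have "\<dots> \<le> (\<Sum>i<n. \<Sum>j<n. cmod (A $$ (i, j) * v $ j * cnj (v $ i)))"
    by (intro sum_norm_le order_refl norm_sum)
  also have "\<dots> \<le> (\<Sum>i<n. \<Sum>j<n. cmod (A $$ (i, j)) * qform (1\<^sub>m n) v)"
  proof (intro sum_mono)
    fix i j assume ij: "i \<in> {..<n}" "j \<in> {..<n}"
    have sq: "(cmod (v $ k))\<^sup>2 \<le> qform (1\<^sub>m n) v" if "k < n" for k
      unfolding qform_one[OF assms(2)] using that by (intro member_le_sum) auto
    have "cmod (v $ j) * cmod (v $ i) \<le> ((cmod (v $ j))\<^sup>2 + (cmod (v $ i))\<^sup>2) / 2"
      using sum_squares_bound[of "cmod (v $ j)" "cmod (v $ i)"] by simp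
    also have "\<dots> \<le> qform (1\<^sub>m n) v" using sq[of i] sq[of j] ij by simp
    finally show "cmod (A $$ (i, j) * v $ j * cnj (v $ i)) \<le> cmod (A $$ (i, j)) * qform (1\<^sub>m n) v"
      by (simp add: norm_mult mult.assoc mult_left_mono)
  qed
  finally show ?thesis by (simp add: sum_distrib_right)
qed

lemma mconv_qform_bound:
  assumes "mconv X L"
  obtains \<delta> where "\<delta> \<longlonglongrightarrow> 0" "\<And>k. 0 < \<delta> k"
    "\<And>k v. v \<in> carrier_vec n \<Longrightarrow> \<bar>qform (X k) v - qform L v\<bar> \<le> \<delta> k * qform (1\<^sub>m n) v"
proof
  \<comment> \<open>The summand \<open>1 / real (Suc k)\<close> keeps the error strictly positive,
    so that shifting by it produces definite matrices and strict upper bounds.\<close>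
  let ?\<delta> = "\<lambda>k. (\<Sum>i<n. \<Sum>j<n. cmod ((X k - L) $$ (i, j))) + 1 / real (Suc k)"
  note X = mconvD(1,2)[OF assms]
  have "(\<lambda>k. cmod ((X k - L) $$ (i, j))) \<longlonglongrightarrow> 0" if "i < n" "j < n" for i j
  proof -
    have "(\<lambda>k. X k $$ (i, j) - L $$ (i, j)) \<longlonglongrightarrow> L $$ (i, j) - L $$ (i, j)"
      by (intro tendsto_intros mconvD(3)[OF assms] that)
    then show ?thesis using X that by (simp add: tendsto_norm_zero_iff)
  qed
  then have "?\<delta> \<longlonglongrightarrow> (\<Sum>i<n. \<Sum>j<n. 0) + 0"
    by (intro tendsto_add tendsto_sum LIMSEQ_Suc[OF lim_1_over_n]) auto
  then show "?\<delta> \<longlonglongrightarrow> 0" by simp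
  show "0 < ?\<delta> k" for k by (intro add_nonneg_pos sum_nonneg) auto
  show "\<bar>qform (X k) v - qform L v\<bar> \<le> ?\<delta> k * qform (1\<^sub>m n) v" if v: "v \<in> carrier_vec n" for k v
  proof -
    have "\<bar>qform (X k) v - qform L v\<bar> = \<bar>qform (X k - L) v\<bar>"
      using X v by (simp add: qform_minus)
    also have "\<dots> \<le> (\<Sum>i<n. \<Sum>j<n. cmod ((X k - L) $$ (i, j))) * qform (1\<^sub>m n) v"
      using X v by (intro qform_entry_bound) auto
    also have "\<dots> \<le> ?\<delta> k * qform (1\<^sub>m n) v"
      using qform_one_nonneg[OF v] by (intro mult_right_mono) auto
    finally show ?thesis .
  qed
qed

text \<open>The squared modulus of an entry is at most the squared norm of its column, which is the
  quadratic form of A^2 at a unit vector, and A^2 \<le> c^2.\<close>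

lemma psd_entry_bound:
  assumes A: "A \<in> psd_mats n" and le: "qle n A (complex_of_real c \<cdot>\<^sub>m 1\<^sub>m n)" and c: "0 \<le> c" and ij: "i < n" "j < n"
  shows "cmod (A $$ (i, j)) \<le> c"
proof -
  let ?e = "unit_vec n j :: complex vec"
  have e: "?e \<in> carrier_vec n" by simp
  have Ae: "(A *\<^sub>v ?e) $ k = A $$ (k, j)" if "k < n" for k
    using carrier_matD[OF psd_carrier[OF A]] ij that by simp
  have Ac: "A *\<^sub>v ?e \<in> carrier_vec n" using psd_carrier[OF A] by (intro mv_carrier) auto
  have "(cmod (A $$ (i, j)))\<^sup>2 \<le> (\<Sum>k<n. (cmod ((A *\<^sub>v ?e) $ k))\<^sup>2)"
    using ij by (subst Ae[symmetric, OF ij(1)]) (intro member_le_sum, auto)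
  also have "\<dots> = qform (1\<^sub>m n) (A *\<^sub>v ?e)" using Ac by (simp add: qform_one)
  also have "\<dots> = qform (pw A 2) ?e"
    using qform_mult[of "1\<^sub>m n" A ?e] pw_mul[OF A, of 1 1] A e by simp
  also have "\<dots> \<le> c powr 2 * qform (1\<^sub>m n) ?e"
    using pw_le_scalar[OF A le, of 2] e by (simp add: qle_def qform_smult)
  also have "qform (1\<^sub>m n) ?e = (\<Sum>k<n. if k = j then 1 else 0)"
    unfolding qform_one[OF e] using ij by (intro sum.cong) auto
  also have "\<dots> = 1" using ij by simp
  finally show ?thesis using c by (simp add: powr_numeral power2_le_iff_abs_le)
qed

lemma qform_mat_fun_add:
  assumes "herm n A" "v \<in> carrier_vec n"
  shows "qform (mat_fun (\<lambda>x. f x + g x) A) v = qform (mat_fun f A) v + qform (mat_fun g A) v"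
proof (rule herm_obtain[OF assms(1)])
  fix U d assume U: "U \<in> unitary_mats n" and *: "\<And>f. mat_fun f A = U * rdiag n (\<lambda>i. f (d i)) * adj U"
  show ?thesis unfolding * qform_udiag[OF unitary_matsD(1)[OF U] assms(2)]
    by (simp add: distrib_right sum.distrib)
qed

text \<open>Written as a function of \<open>A\<close> rather than as a sum, so that powers of the
  shifted matrix are again functions of \<open>A\<close>.\<close>

definition shift :: "real \<Rightarrow> complex mat \<Rightarrow> complex mat" where
  "shift \<epsilon> A = mat_fun (\<lambda>x. x + \<epsilon>) A"

lemma shift_pd: 
  assumes "A \<in> psd_mats n" "0 < \<epsilon>"
  shows "shift \<epsilon> A \<in> pd_mats n"
proof (rule psd_obtain[OF assms(1)])
  fix U d assume U: "U \<in> unitary_mats n" "\<And>f. mat_fun f A = U * rdiag n (\<lambda>i. f (d i)) * adj U" "\<And>i. i < n \<Longrightarrow> 0 \<le> d i"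
  show ?thesis unfolding shift_def U(2) using assms(2) U by (intro udiag_pd add_nonneg_pos)
qed

lemma qform_shift:
  assumes "A \<in> psd_mats n" "v \<in> carrier_vec n"
  shows "qform (shift \<epsilon> A) v = qform A v + \<epsilon> * qform (1\<^sub>m n) v"
  unfolding shift_def using assms
  by (simp add: qform_mat_fun_add mat_fun_id mat_fun_const qform_smult)

lemma qform_pw_shift:
  assumes A: "A \<in> psd_mats n" and v: "v \<in> carrier_vec n" and "0 < \<epsilon>" "0 < r" "r \<le> 1"
  shows "qform (pw (shift \<epsilon> A) r) v \<le> qform (pw A r) v + \<epsilon> powr r * qform (1\<^sub>m n) v"
proof -
  have "pw (shift \<epsilon> A) r = mat_fun (\<lambda>x. (x + \<epsilon>) powr r) A"
    using A by (simp add: pw_def shift_def mat_fun_comp)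
  also have "qform \<dots> v \<le> qform (mat_fun (\<lambda>x. x powr r + \<epsilon> powr r) A) v"
    using mat_fun_qle[OF A, of "\<lambda>x. (x + \<epsilon>) powr r" "\<lambda>x. x powr r + \<epsilon> powr r"] assms
    by (auto simp: qle_def powr_add_le)
  also have "\<dots> = qform (pw A r) v + \<epsilon> powr r * qform (1\<^sub>m n) v"
    using A v by (simp add: qform_mat_fun_add pw_def mat_fun_const qform_smult)
  finally show ?thesis .
qed

text \<open>A shift by \<open>c\<close> makes the difference positive semidefinite, so its entries are controlled by its quadratic form.\<close>

lemma qform_close_entry:
  assumes X: "herm n X" and Y: "herm n Y" and c: "0 \<le> c" and ij: "i < n" "j < n"
    and close: "\<And>v. v \<in> carrier_vec n \<Longrightarrow> \<bar>qform X v - qform Y v\<bar> \<le> c * qform (1\<^sub>m n) v"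
  shows "cmod (X $$ (i, j) - Y $$ (i, j)) \<le> 3 * c"
proof -
  define D where "D = X - Y + complex_of_real c \<cdot>\<^sub>m 1\<^sub>m n"
  note [simp] = herm_carrier[OF X] herm_carrier[OF Y] X Y
  have XY [simp]: "X - Y \<in> carrier_mat n n" by (rule minus_carrier_mat) simp
  have D [simp]: "D \<in> carrier_mat n n" by (simp add: D_def)
  have qD: "qform D v = qform X v - qform Y v + c * qform (1\<^sub>m n) v" if "v \<in> carrier_vec n" for v
  proof -
    have "qform D v = qform (X - Y) v + qform (complex_of_real c \<cdot>\<^sub>m 1\<^sub>m n) v"
      unfolding D_def using that by (intro qform_add minus_carrier_mat) auto
    then show ?thesis using that by (simp add: qform_minus qform_smult)
  qed
  have "herm n D"
    by (rule hermI[OF D]) (simp add: D_def adj_add[of _ n n] adj_minus[of _ n n] adj_smult)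
  then have Dp: "D \<in> psd_mats n"
    by (rule psdI) (use close qD in fastforce)
  have "qle n D (complex_of_real (2 * c) \<cdot>\<^sub>m 1\<^sub>m n)"
    unfolding qle_def
  proof
    fix v :: "complex vec" assume v: "v \<in> carrier_vec n"
    show "qform D v \<le> qform (complex_of_real (2 * c) \<cdot>\<^sub>m 1\<^sub>m n) v"
      using close[OF v] v by (subst qform_smult) (auto simp: qD)
  qed
  from psd_entry_bound[OF Dp this _ ij] c have "cmod (D $$ (i, j)) \<le> 2 * c" by simp
  moreover define k where "k = (if i = j then complex_of_real c else 0)"
  moreover have "X $$ (i, j) - Y $$ (i, j) = D $$ (i, j) - k"
    using ij carrier_matD[OF herm_carrier[OF Y]] by (simp add: D_def k_def)
  moreover have "cmod (D $$ (i, j) - k) \<le> cmod (D $$ (i, j)) + cmod k" by (rule norm_triangle_ineq4)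
  moreover have "cmod k \<le> c" using c by (simp add: k_def)
  ultimately show ?thesis by simp
qed

lemma qform_close_mconv:
  assumes "\<And>k. herm n (X k)" "herm n L" "c \<longlonglongrightarrow> 0" "\<And>k. 0 \<le> c k"
    and close: "\<And>k v. v \<in> carrier_vec n \<Longrightarrow> \<bar>qform (X k) v - qform L v\<bar> \<le> c k * qform (1\<^sub>m n) v"
  shows "mconv X L"
proof -
  have "(\<lambda>k. X k $$ (i, j)) \<longlonglongrightarrow> L $$ (i, j)" if ij: "i < n" "j < n" for i j
  proof -
    have "(\<lambda>k. 3 * c k) \<longlonglongrightarrow> 3 * 0" by (intro tendsto_intros assms)
    then have lim: "(\<lambda>k. 3 * c k) \<longlonglongrightarrow> 0" by simp
    have "(\<lambda>k. cmod (X k $$ (i, j) - L $$ (i, j))) \<longlonglongrightarrow> 0"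
      by (rule tendsto_sandwich[OF _ _ tendsto_const lim])
        (intro always_eventually allI norm_ge_zero, intro always_eventually allI qform_close_entry assms ij)
    then have "(\<lambda>k. X k $$ (i, j) - L $$ (i, j)) \<longlonglongrightarrow> 0" by (rule tendsto_norm_zero_cancel)
    then show ?thesis by (simp add: LIM_zero_iff)
  qed
  then show ?thesis using herm_carrier[OF assms(1)] herm_carrier[OF assms(2)] by (simp add: mconv_def)
qed

lemma mconv_shift:
  assumes "A \<in> psd_mats n"
  shows "mconv (\<lambda>k. shift (1 / real (Suc k)) A) A"
proof (rule qform_close_mconv)
  show "(\<lambda>k. 1 / real (Suc k)) \<longlonglongrightarrow> 0" by (intro LIMSEQ_Suc lim_1_over_n)
  show "herm n (shift (1 / real (Suc k)) A)" for k using shift_pd[OF assms, of "1 / real (Suc k)"] by simp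
qed (use assms in \<open>auto simp: qform_shift qform_one_nonneg\<close>)

text \<open>From X \<le> L + \<delta> Loewner-Heinz gives X^r \<le> (L + \<delta>)^r \<le> L^r +
  \<delta>^r, and the roles of X and L can be exchanged.\<close>

lemma mconv_pw_small:
  assumes X: "\<And>k. X k \<in> psd_mats n" and L: "L \<in> psd_mats n" and XL: "mconv X L" and r: "0 < r" "r \<le> 1"
  shows "mconv (\<lambda>k. pw (X k) r) (pw L r)"
proof (rule mconv_qform_bound[OF XL])
  fix \<delta> assume \<delta>: "\<delta> \<longlonglongrightarrow> 0" "\<And>k. 0 < \<delta> k"
    and close: "\<And>k v. v \<in> carrier_vec n \<Longrightarrow> \<bar>qform (X k) v - qform L v\<bar> \<le> \<delta> k * qform (1\<^sub>m n) v"
  have *: "qform (pw A r) v \<le> qform (pw B r) v + d powr r * qform (1\<^sub>m n) v"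
    if A: "A \<in> psd_mats n" and B: "B \<in> psd_mats n" and d: "0 < d"
      and cl: "\<And>v. v \<in> carrier_vec n \<Longrightarrow> qform A v \<le> qform B v + d * qform (1\<^sub>m n) v" and v: "v \<in> carrier_vec n"
    for A B d v
  proof -
    have "qle n A (shift d B)" using B cl by (auto simp: qle_def qform_shift)
    then have "qle n (pw A r) (pw (shift d B) r)"
      using A B d r by (intro loewner_heinz shift_pd) auto
    then have "qform (pw A r) v \<le> qform (pw (shift d B) r) v" using v by (simp add: qle_def)
    also have "\<dots> \<le> qform (pw B r) v + d powr r * qform (1\<^sub>m n) v"
      using B v d r by (rule qform_pw_shift)
    finally show ?thesis .
  qed
  show ?thesis
  proof (rule qform_close_mconv[where c = "\<lambda>k. \<delta> k powr r"])
    show "herm n (pw (X k) r)" for k using X by simp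
    show "herm n (pw L r)" using L by simp
    show "(\<lambda>k. \<delta> k powr r) \<longlonglongrightarrow> 0"
      using tendsto_powr'[OF \<delta>(1) tendsto_const[of r]] r \<delta>(2) by (simp add: less_imp_le)
    fix k and v :: "complex vec" assume v: "v \<in> carrier_vec n"
    have "qform (X k) w \<le> qform L w + \<delta> k * qform (1\<^sub>m n) w" "qform L w \<le> qform (X k) w + \<delta> k * qform (1\<^sub>m n) w"
      if "w \<in> carrier_vec n" for w using close[OF that, of k] by (auto simp: abs_le_iff)
    then have "qform (pw (X k) r) v \<le> qform (pw L r) v + \<delta> k powr r * qform (1\<^sub>m n) v"
      "qform (pw L r) v \<le> qform (pw (X k) r) v + \<delta> k powr r * qform (1\<^sub>m n) v"
      using *[OF X L \<delta>(2) _ v] *[OF L X \<delta>(2) _ v] by blast+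
    then show "\<bar>qform (pw (X k) r) v - qform (pw L r) v\<bar> \<le> \<delta> k powr r * qform (1\<^sub>m n) v" by linarith
  qed simp
qed

text \<open>For exponents above 1 one factor of the matrix itself is split off; the induction runs
  over an integer bound of the exponent.\<close>

lemma mconv_pw:
  assumes X: "\<And>k. X k \<in> psd_mats n" and L: "L \<in> psd_mats n" and XL: "mconv X L" and r: "0 < r"
  shows "mconv (\<lambda>k. pw (X k) r) (pw L r)"
proof -
  have "mconv (\<lambda>k. pw (X k) r) (pw L r)" if "0 < r" "r \<le> real m" for m r
    using that
  proof (induction m arbitrary: r)
    case (Suc m)
    show ?case
    proof (cases "r \<le> 1")
      case False
      then have "mconv (\<lambda>k. X k * pw (X k) (r - 1)) (L * pw L (r - 1))"
        using Suc by (intro mconv_mult XL Suc.IH) auto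
      moreover have "A * pw A (r - 1) = pw A r" if "A \<in> psd_mats n" for A
        using pw_mul[OF that, of 1 "r - 1"] that by simp
      ultimately show ?thesis using X L by simp
    qed (use mconv_pw_small[OF X L XL] Suc in simp)
  qed simp
  moreover obtain m where "r \<le> real m" using real_arch_simple by blast
  ultimately show ?thesis using r by blast
qed

text \<open>Only the second argument varies: it enters through positive powers, whereas the first
  one is also raised to a negative power.\<close>

lemma mconv_mean:
  assumes "A \<in> psd_mats n" "\<And>k. X k \<in> psd_mats n" "L \<in> psd_mats n" "mconv X L" "0 < t"
  shows "mconv (\<lambda>k. mean t A (X k)) (mean t A L)"
  unfolding mean_def using assms
  by (intro mconv_mult mconv_pw mconv_const) auto

lemma mconv_le:
  assumes XL: "mconv X L" and le: "\<And>k. qle n (X k) (complex_of_real (c k) \<cdot>\<^sub>m 1\<^sub>m n)" and c: "c \<longlonglongrightarrow> d"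
  shows "qle n L (complex_of_real d \<cdot>\<^sub>m 1\<^sub>m n)"
proof (rule mconv_qform_bound[OF XL])
  fix \<delta> assume \<delta>: "\<delta> \<longlonglongrightarrow> 0" "\<And>k. 0 < \<delta> k"
    and close: "\<And>k v. v \<in> carrier_vec n \<Longrightarrow> \<bar>qform (X k) v - qform L v\<bar> \<le> \<delta> k * qform (1\<^sub>m n) v"
  show ?thesis unfolding qle_def
  proof
    fix v :: "complex vec" assume v: "v \<in> carrier_vec n"
    have "(\<lambda>k. (c k + \<delta> k) * qform (1\<^sub>m n) v) \<longlonglongrightarrow> (d + 0) * qform (1\<^sub>m n) v"
      by (intro tendsto_intros c \<delta>(1))
    moreover have "qform L v \<le> (c k + \<delta> k) * qform (1\<^sub>m n) v" for k
      using close[OF v, of k] le[of k] v by (auto simp: qle_def qform_smult distrib_right)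
    ultimately have "qform L v \<le> (d + 0) * qform (1\<^sub>m n) v"
      by (intro LIMSEQ_le_const[of _ "(d + 0) * qform (1\<^sub>m n) v"]) auto
    then show "qform L v \<le> qform (complex_of_real d \<cdot>\<^sub>m 1\<^sub>m n) v" using v by (simp add: qform_smult)
  qed
qed

text \<open>The strict inequality \<open>c < d k\<close> keeps the bounds positive when
  \<open>c\<close> is 0, so that they can be rescaled to 1.\<close>

lemma mconv_upper:
  assumes XL: "mconv X L" and le: "qle n L (complex_of_real c \<cdot>\<^sub>m 1\<^sub>m n)"
  obtains d where "d \<longlonglongrightarrow> c" "\<And>k. c < d k" "\<And>k. qle n (X k) (complex_of_real (d k) \<cdot>\<^sub>m 1\<^sub>m n)"
proof (rule mconv_qform_bound[OF XL])
  fix \<delta> assume \<delta>: "\<delta> \<longlonglongrightarrow> 0" "\<And>k. 0 < \<delta> k"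
    and close: "\<And>k v. v \<in> carrier_vec n \<Longrightarrow> \<bar>qform (X k) v - qform L v\<bar> \<le> \<delta> k * qform (1\<^sub>m n) v"
  show thesis
  proof (rule that[of "\<lambda>k. c + \<delta> k"])
    show "(\<lambda>k. c + \<delta> k) \<longlonglongrightarrow> c" using tendsto_add[OF tendsto_const \<delta>(1), of c] by simp
    show "qle n (X k) (complex_of_real (c + \<delta> k) \<cdot>\<^sub>m 1\<^sub>m n)" for k
      unfolding qle_def
    proof
      fix v :: "complex vec" assume v: "v \<in> carrier_vec n"
      show "qform (X k) v \<le> qform (complex_of_real (c + \<delta> k) \<cdot>\<^sub>m 1\<^sub>m n) v"
        using close[OF v, of k] le v by (subst qform_smult) (auto simp: qle_def qform_smult distrib_right)
    qed
  qed (use \<delta>(2) in simp)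
qed

section \<open>The two means\<close>

lemma G_mean_pw:
  assumes "A \<in> psd_mats n" "B \<in> psd_mats n"
  shows "G_mean \<alpha> q A B = pw (mean \<alpha> (pw A q) (pw B q)) (1/q)"
proof -
  have *: "wt_geo_mean \<alpha> X Y = mean \<alpha> X Y" if "X \<in> psd_mats n" "Y \<in> psd_mats n" for \<alpha> X Y
    unfolding wt_geo_mean_def mean_def using that by (simp add: mat_powr_pw assoc)
  show ?thesis unfolding G_mean_def using assms by (simp add: mat_powr_pw *)
qed

lemma SG_mean_pw:
  assumes "A \<in> psd_mats n" "B \<in> psd_mats n"
  defines "E \<equiv> \<lambda>p. mean (1/2) (pw A (-p)) (pw B p)"
  shows "SG_mean \<alpha> p A B = pw (pw (E p) \<alpha> * (pw A p * pw (E p) \<alpha>)) (1/p)"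
proof -
  have *: "wt_geo_mean \<alpha> X Y = mean \<alpha> X Y" if "X \<in> psd_mats n" "Y \<in> psd_mats n" for \<alpha> X Y
    unfolding wt_geo_mean_def mean_def using that by (simp add: mat_powr_pw assoc)
  show ?thesis unfolding SG_mean_def Let_def E_def using assms by (simp add: mat_powr_pw * assoc)
qed

lemma G_mean_psd [simp]: "A \<in> psd_mats n \<Longrightarrow> B \<in> psd_mats n \<Longrightarrow> G_mean \<alpha> q A B \<in> psd_mats n"
  and SG_mean_psd [simp]: "A \<in> psd_mats n \<Longrightarrow> B \<in> psd_mats n \<Longrightarrow> SG_mean \<alpha> q A B \<in> psd_mats n"
  by (simp_all add: G_mean_pw SG_mean_pw)

lemma pw_le_one_iff:
  assumes "X \<in> psd_mats n" "0 < s"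
  shows "qle n (pw X s) (1\<^sub>m n) \<longleftrightarrow> qle n X (1\<^sub>m n)"
  using pw_le_one[of X s] pw_le_one[of "pw X s" "1/s"] assms by (auto simp: pw_pw)

text \<open>The outer exponents 1/p and 1/q do not affect the bound 1, so
  \<open>spectral_mean_dominates\<close> applies to F = A^p and H = B^p with r = q/p.\<close>

lemma G_le_SG_one:
  assumes "A \<in> pd_mats n" "B \<in> pd_mats n" "0 < \<alpha>" "\<alpha> < 1" "0 < p" "0 < q"
    and "qle n (SG_mean \<alpha> p A B) (1\<^sub>m n)"
  shows "qle n (G_mean \<alpha> q A B) (1\<^sub>m n)"
proof -
  let ?E = "mean (1/2) (pw (pw A p) (-1)) (pw B p)"
  have "qle n (pw ?E \<alpha> * (pw A p * pw ?E \<alpha>)) (1\<^sub>m n)"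
    using assms by (simp add: SG_mean_pw pw_pw pw_le_one_iff)
  then have "qle n (mean \<alpha> (pw (pw A p) (q/p)) (pw (pw B p) (q/p))) (1\<^sub>m n)"
    using assms by (intro spectral_mean_dominates[OF _ _ _ _ _ refl]) auto
  then show ?thesis using assms by (simp add: G_mean_pw pw_pw pw_le_one_iff)
qed

lemma SG_le_G_one:
  assumes "A \<in> pd_mats n" "B \<in> pd_mats n" "1 < \<alpha>" "0 < p" "0 < q" "p / q \<le> min 2 (\<alpha> / (\<alpha> - 1))"
    and "qle n (G_mean \<alpha> q A B) (1\<^sub>m n)"
  shows "qle n (SG_mean \<alpha> p A B) (1\<^sub>m n)"
proof -
  let ?E = "mean (1/2) (pw (pw A p) (-1)) (pw B p)"
  have "qle n (mean \<alpha> (pw A q) (pw B q)) (1\<^sub>m n)"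
    using assms by (simp add: G_mean_pw pw_le_one_iff)
  then have "qle n (pw (pw B q) (p/q)) (pw (pw A q) (p/q * (1 - 1/\<alpha>)))"
    using assms by (intro geo_mean_bound_power) auto
  then have "qle n (pw B p) (pw (pw A p) (1 - 1/\<alpha>))" using assms by (simp add: pw_pw)
  then have "qle n (pw ?E \<alpha> * (pw A p * pw ?E \<alpha>)) (1\<^sub>m n)"
    using assms by (intro spectral_mean_dominated[OF _ _ _ refl]) auto
  then show ?thesis using assms by (simp add: SG_mean_pw pw_pw pw_le_one_iff)
qed

lemma mean_smult_right:
  assumes "A \<in> psd_mats n" "B \<in> psd_mats n" "0 \<le> c"
  shows "mean t A (complex_of_real c \<cdot>\<^sub>m B) = complex_of_real (c powr t) \<cdot>\<^sub>m mean t A B"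
  using assms by (simp add: mean_def msmult pw_smult)

lemma G_mean_smult:
  assumes "A \<in> psd_mats n" "B \<in> psd_mats n" "0 < s" "0 < q"
  shows "G_mean \<alpha> q A (complex_of_real s \<cdot>\<^sub>m B) = complex_of_real (s powr \<alpha>) \<cdot>\<^sub>m G_mean \<alpha> q A B"
  using assms by (simp add: G_mean_pw smult_psd pw_smult mean_smult_right powr_powr)

lemma SG_mean_smult:
  assumes "A \<in> psd_mats n" "B \<in> psd_mats n" "0 < s" "0 < p"
  shows "SG_mean \<alpha> p A (complex_of_real s \<cdot>\<^sub>m B) = complex_of_real (s powr \<alpha>) \<cdot>\<^sub>m SG_mean \<alpha> p A B"
proof -
  define E where "E = mean (1/2) (pw A (-p)) (pw B p)"
  have [simp]: "E \<in> psd_mats n" using assms by (simp add: E_def)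
  \<comment> \<open>Each of the two factors E^\<alpha> contributes s^(p\<alpha>/2), the square root
    halving the exponent p; the final root 1/p leaves s^\<alpha>, free of p.\<close>
  define k where "k = (s powr (p * \<alpha> / 2)) * (s powr (p * \<alpha> / 2))"
  have k: "k powr (1/p) = s powr \<alpha>" using assms by (simp add: k_def powr_powr flip: powr_add)
  have "complex_of_real (s powr (p * \<alpha> / 2)) \<cdot>\<^sub>m (complex_of_real (s powr (p * \<alpha> / 2)) \<cdot>\<^sub>m X) = complex_of_real k \<cdot>\<^sub>m X" for X
    by (intro eq_matI) (auto simp: k_def)
  moreover have "0 \<le> k" by (simp add: k_def)
  ultimately have "SG_mean \<alpha> p A (complex_of_real s \<cdot>\<^sub>m B)
    = complex_of_real (k powr (1/p)) \<cdot>\<^sub>m pw (pw E \<alpha> * (pw A p * pw E \<alpha>)) (1/p)"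
    using assms by (simp add: SG_mean_pw smult_psd pw_smult mean_smult_right powr_powr E_def[symmetric] msmult)
  then show ?thesis using assms unfolding k by (simp add: SG_mean_pw E_def)
qed

lemma G_mean_mconv:
  assumes A: "A \<in> psd_mats n" and B: "B \<in> psd_mats n" and "0 < \<alpha>" "0 < q"
  shows "mconv (\<lambda>k. G_mean \<alpha> q A (shift (1 / real (Suc k)) B)) (G_mean \<alpha> q A B)"
proof -
  define S where "S k = shift (1 / real (Suc k)) B" for k
  have S: "S k \<in> psd_mats n" for k unfolding S_def by (intro pd_psd shift_pd B) simp
  have SB: "mconv S B" unfolding S_def by (rule mconv_shift[OF B])
  have "mconv (\<lambda>k. pw (mean \<alpha> (pw A q) (pw (S k) q)) (1/q)) (pw (mean \<alpha> (pw A q) (pw B q)) (1/q))"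
    using assms S by (intro mconv_pw[OF _ _ mconv_mean[OF _ _ _ mconv_pw[OF S B SB]]]) auto
  then show ?thesis unfolding S_def[symmetric] by (simp only: G_mean_pw[OF A B] G_mean_pw[OF A S])
qed

lemma SG_mean_mconv:
  assumes A: "A \<in> psd_mats n" and B: "B \<in> psd_mats n" and "0 < \<alpha>" "0 < p"
  shows "mconv (\<lambda>k. SG_mean \<alpha> p A (shift (1 / real (Suc k)) B)) (SG_mean \<alpha> p A B)"
proof -
  define S where "S k = shift (1 / real (Suc k)) B" for k
  have S: "S k \<in> psd_mats n" for k unfolding S_def by (intro pd_psd shift_pd B) simp
  have SB: "mconv S B" unfolding S_def by (rule mconv_shift[OF B])
  define E where "E X = pw (mean (1/2) (pw A (-p)) (pw X p)) \<alpha>" for X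
  have E: "E X \<in> psd_mats n" if "X \<in> psd_mats n" for X using that A by (simp add: E_def)
  have "mconv (\<lambda>k. E (S k)) (E B)" unfolding E_def
    using assms S by (intro mconv_pw[OF _ _ mconv_mean[OF _ _ _ mconv_pw[OF S B SB]]]) auto
  then have EE: "mconv (\<lambda>k. E (S k) * (pw A p * E (S k))) (E B * (pw A p * E B))"
    using A by (intro mconv_mult mconv_const) auto
  have psd: "E X * (pw A p * E X) \<in> psd_mats n" if "X \<in> psd_mats n" for X
    using psd_cong[of "pw A p" "E X"] A E[OF that] by simp
  have "mconv (\<lambda>k. pw (E (S k) * (pw A p * E (S k))) (1/p)) (pw (E B * (pw A p * E B)) (1/p))"
    using assms S B by (intro mconv_pw[OF _ _ EE] psd) auto
  then show ?thesis unfolding S_def[symmetric] E_def by (simp only: SG_mean_pw[OF A B] SG_mean_pw[OF A S])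
qed

text \<open>Rescaling \<open>B\<close> turns the bound 1 into an arbitrary positive bound, and a limit removes definiteness of \<open>B\<close>.\<close>

lemma homogeneous_transfer:
  assumes hom: "\<And>s B. 0 < s \<Longrightarrow> B \<in> pd_mats n \<Longrightarrow> P (complex_of_real s \<cdot>\<^sub>m B) = complex_of_real (s powr \<alpha>) \<cdot>\<^sub>m P B"
      "\<And>s B. 0 < s \<Longrightarrow> B \<in> pd_mats n \<Longrightarrow> Q (complex_of_real s \<cdot>\<^sub>m B) = complex_of_real (s powr \<alpha>) \<cdot>\<^sub>m Q B"
    and M: "\<And>B. B \<in> pd_mats n \<Longrightarrow> P B \<in> carrier_mat n n" "\<And>B. B \<in> pd_mats n \<Longrightarrow> Q B \<in> carrier_mat n n"
    and conv: "mconv (\<lambda>k. P (shift (1 / real (Suc k)) B)) (P B)" "mconv (\<lambda>k. Q (shift (1 / real (Suc k)) B)) (Q B)"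
    and one: "\<And>B. B \<in> pd_mats n \<Longrightarrow> qle n (P B) (1\<^sub>m n) \<Longrightarrow> qle n (Q B) (1\<^sub>m n)"
    and \<alpha>: "0 < \<alpha>" and B: "B \<in> psd_mats n" and c: "0 \<le> c" and le: "qle n (P B) (complex_of_real c \<cdot>\<^sub>m 1\<^sub>m n)"
  shows "qle n (Q B) (complex_of_real c \<cdot>\<^sub>m 1\<^sub>m n)"
proof -
  have scaled: "qle n (Q B) (complex_of_real d \<cdot>\<^sub>m 1\<^sub>m n)"
    if d: "0 < d" and B: "B \<in> pd_mats n" and le: "qle n (P B) (complex_of_real d \<cdot>\<^sub>m 1\<^sub>m n)" for B d
  proof -
    \<comment> \<open>The scale of B that multiplies both means, of degree \<alpha>, by 1/d.\<close>
    define s where "s = d powr (-1/\<alpha>)"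
    have "s powr \<alpha> = d powr (-1)" unfolding s_def powr_powr using \<alpha> by simp
    then have s: "0 < s" "s powr \<alpha> = 1 / d" using d by (simp_all add: s_def powr_minus_divide)
    have sm: "complex_of_real (1 / d) \<cdot>\<^sub>m (complex_of_real d \<cdot>\<^sub>m 1\<^sub>m n) = 1\<^sub>m n"
      "complex_of_real d \<cdot>\<^sub>m (complex_of_real (1 / d) \<cdot>\<^sub>m Q B) = Q B"
      using d by (intro eq_matI; simp)+
    have "qle n (complex_of_real (1 / d) \<cdot>\<^sub>m P B) (complex_of_real (1 / d) \<cdot>\<^sub>m (complex_of_real d \<cdot>\<^sub>m 1\<^sub>m n))"
      using M[OF B] le d by (intro qle_smult) auto
    then have "qle n (P (complex_of_real s \<cdot>\<^sub>m B)) (1\<^sub>m n)" unfolding sm hom(1)[OF s(1) B] s(2) .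
    then have "qle n (Q (complex_of_real s \<cdot>\<^sub>m B)) (1\<^sub>m n)" by (intro one smult_pd B s)
    then have "qle n (complex_of_real (1 / d) \<cdot>\<^sub>m Q B) (1\<^sub>m n)" unfolding hom(2)[OF s(1) B] s(2) .
    then have "qle n (complex_of_real d \<cdot>\<^sub>m (complex_of_real (1 / d) \<cdot>\<^sub>m Q B)) (complex_of_real d \<cdot>\<^sub>m 1\<^sub>m n)"
      using M[OF B] d by (intro qle_smult) auto
    then show ?thesis unfolding sm .
  qed
  obtain d where d: "d \<longlonglongrightarrow> c" "\<And>k. c < d k"
    "\<And>k. qle n (P (shift (1 / real (Suc k)) B)) (complex_of_real (d k) \<cdot>\<^sub>m 1\<^sub>m n)"
    using mconv_upper[OF conv(1) le] by blast
  show ?thesis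
  proof (rule mconv_le[OF conv(2) _ d(1)])
    fix k
    have "0 < d k" using d(2)[of k] c by simp
    then show "qle n (Q (shift (1 / real (Suc k)) B)) (complex_of_real (d k) \<cdot>\<^sub>m 1\<^sub>m n)"
      by (rule scaled[OF _ shift_pd[OF B] d(3)]) simp
  qed
qed

theorem G_le_SG:
  assumes "A \<in> pd_mats n" "B \<in> psd_mats n" "0 < \<alpha>" "\<alpha> < 1" "0 < p" "0 < q" "0 \<le> c"
    and "qle n (SG_mean \<alpha> p A B) (complex_of_real c \<cdot>\<^sub>m 1\<^sub>m n)"
  shows "qle n (G_mean \<alpha> q A B) (complex_of_real c \<cdot>\<^sub>m 1\<^sub>m n)"
proof (rule homogeneous_transfer[where P = "SG_mean \<alpha> p A" and Q = "G_mean \<alpha> q A" and \<alpha> = \<alpha>])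
  show "qle n (G_mean \<alpha> q A B) (1\<^sub>m n)" if "B \<in> pd_mats n" "qle n (SG_mean \<alpha> p A B) (1\<^sub>m n)" for B
    using that assms by (intro G_le_SG_one[of _ _ \<alpha> p]) auto
qed (use assms in \<open>simp_all add: G_mean_smult SG_mean_smult G_mean_mconv SG_mean_mconv del: of_nat_Suc\<close>)

theorem SG_le_G:
  assumes "A \<in> pd_mats n" "B \<in> psd_mats n" "1 < \<alpha>" "0 < p" "0 < q" "p / q \<le> min 2 (\<alpha> / (\<alpha> - 1))" "0 \<le> c"
    and "qle n (G_mean \<alpha> q A B) (complex_of_real c \<cdot>\<^sub>m 1\<^sub>m n)"
  shows "qle n (SG_mean \<alpha> p A B) (complex_of_real c \<cdot>\<^sub>m 1\<^sub>m n)"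
proof (rule homogeneous_transfer[where Q = "SG_mean \<alpha> p A" and P = "G_mean \<alpha> q A" and \<alpha> = \<alpha>])
  show "qle n (SG_mean \<alpha> p A B) (1\<^sub>m n)" if "B \<in> pd_mats n" "qle n (G_mean \<alpha> q A B) (1\<^sub>m n)" for B
    using that assms by (intro SG_le_G_one[of _ _ \<alpha> p q]) auto
qed (use assms in \<open>simp_all add: G_mean_smult SG_mean_smult G_mean_mconv SG_mean_mconv del: of_nat_Suc\<close>)

section \<open>Reduction to a positive definite first argument\<close>

lemma mat_eq_by_vec:
  fixes A B :: "complex mat"
  assumes "A \<in> carrier_mat n n" "B \<in> carrier_mat n n" "\<And>v. v \<in> carrier_vec n \<Longrightarrow> A *\<^sub>v v = B *\<^sub>v v"
  shows "A = B"
proof (rule eq_matI)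
  fix i j assume "i < dim_row B" "j < dim_col B"
  then have ij: "i < n" "j < n" using assms by auto
  have "A $$ (i, j) = (A *\<^sub>v unit_vec n j) $ i" using assms(1) ij by simp
  also have "\<dots> = (B *\<^sub>v unit_vec n j) $ i" using assms(3) by simp
  also have "\<dots> = B $$ (i, j)" using assms(2) ij by simp
  finally show "A $$ (i, j) = B $$ (i, j)" .
qed (use assms in auto)

text \<open>The condition under the description in \<open>supp_proj\<close>, named so that
  existence, by \<open>supp\<close>, and uniqueness can be shown separately.\<close>

definition is_proj :: "complex mat \<Rightarrow> complex mat \<Rightarrow> bool" where
  "is_proj A P \<longleftrightarrow> P \<in> carrier_mat n n \<and> adj P = P \<and> P * P = P \<and> mat_kernel P = mat_kernel A"

definition supp :: "complex mat \<Rightarrow> complex mat" where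
  "supp A = mat_fun (\<lambda>x. if x = 0 then 0 else 1) A"

lemma supp_mult:
  assumes "A \<in> psd_mats n"
  shows "A * supp A = A" "supp A * supp A = supp A" "mat_fun inverse A * A = supp A"
proof -
  have *: "mat_fun f A * mat_fun g A = mat_fun h A" if "\<And>x. f x * g x = h x" for f g h
    using mat_fun_mult[of A f g] that assms by simp
  have A: "mat_fun (\<lambda>x. x) A = A" using assms by (simp add: mat_fun_id)
  show "A * supp A = A" "mat_fun inverse A * A = supp A"
    using *[of "\<lambda>x. x" "\<lambda>x. if x = 0 then 0 else 1" "\<lambda>x. x"]
      *[of inverse "\<lambda>x. x" "\<lambda>x. if x = 0 then 0 else 1"] by (simp_all add: A supp_def)
  show "supp A * supp A = supp A" unfolding supp_def by (rule *) simp
qed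

lemma supp_herm [simp]: "A \<in> psd_mats n \<Longrightarrow> herm n (supp A)"
  by (simp add: supp_def)

lemma supp_carrier [simp]: "A \<in> psd_mats n \<Longrightarrow> supp A \<in> carrier_mat n n"
  by (rule herm_carrier) simp

lemma kernel_eq: "A \<in> carrier_mat n n \<Longrightarrow> mat_kernel A = {v \<in> carrier_vec n. A *\<^sub>v v = 0\<^sub>v n}" for A :: "complex mat"
  by (auto simp: mat_kernel_def)

lemma is_proj_supp:
  assumes "A \<in> psd_mats n"
  shows "is_proj A (supp A)"
proof -
  note [simp] = assms
  have "A *\<^sub>v v = 0\<^sub>v n \<longleftrightarrow> supp A *\<^sub>v v = 0\<^sub>v n" if v: "v \<in> carrier_vec n" for v
  proof
    assume "A *\<^sub>v v = 0\<^sub>v n"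
    then have "mat_fun inverse A *\<^sub>v (A *\<^sub>v v) = 0\<^sub>v n" by (simp add: mult_mat_vec_zero mat_fun_carrier)
    then show "supp A *\<^sub>v v = 0\<^sub>v n" using v
      by (simp add: supp_mult(3)[OF assms, symmetric] mat_fun_carrier mv_assoc)
  next
    assume "supp A *\<^sub>v v = 0\<^sub>v n"
    then have "A *\<^sub>v (supp A *\<^sub>v v) = 0\<^sub>v n" by (simp add: mult_mat_vec_zero)
    then have "(A * supp A) *\<^sub>v v = 0\<^sub>v n" using v by (simp add: mv_assoc)
    then show "A *\<^sub>v v = 0\<^sub>v n" by (simp add: supp_mult(1)[OF assms])
  qed
  then have "mat_kernel (supp A) = mat_kernel A" by (auto simp: kernel_eq)
  then show ?thesis by (simp add: is_proj_def supp_mult(2))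
qed

text \<open>The vector v - P v lies in the kernel of P, which is also that of Q, so Q P = Q. Taking
  adjoints and exchanging the roles of P and Q gives P = Q.\<close>

lemma is_proj_unique:
  assumes P: "is_proj A P" and Q: "is_proj A Q"
  shows "P = Q"
proof -
  have *: "Q * P = Q" if P: "is_proj A P" and Q: "is_proj A Q" for P Q
  proof (rule mat_eq_by_vec)
    have [simp]: "P \<in> carrier_mat n n" "Q \<in> carrier_mat n n" using P Q by (auto simp: is_proj_def)
    show "Q * P \<in> carrier_mat n n" "Q \<in> carrier_mat n n" by simp_all
    fix v :: "complex vec" assume v: "v \<in> carrier_vec n"
    have Pv: "P *\<^sub>v v \<in> carrier_vec n" using v by (intro mv_carrier) auto
    have "P *\<^sub>v (v - P *\<^sub>v v) = P *\<^sub>v v - (P * P) *\<^sub>v v"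
      using v Pv by (simp add: mult_minus_distrib_mat_vec[of _ n n] mv_assoc)
    also have "\<dots> = 0\<^sub>v n" using P Pv by (simp add: is_proj_def)
    finally have "v - P *\<^sub>v v \<in> mat_kernel P" using v Pv by (simp add: kernel_eq)
    then have "v - P *\<^sub>v v \<in> mat_kernel Q" using P Q by (simp add: is_proj_def)
    then have "Q *\<^sub>v v - Q *\<^sub>v (P *\<^sub>v v) = 0\<^sub>v n" 
      using v Pv by (simp add: kernel_eq mult_minus_distrib_mat_vec[of _ n n])
    moreover have "Q *\<^sub>v v \<in> carrier_vec n" "Q *\<^sub>v (P *\<^sub>v v) \<in> carrier_vec n"
      using v Pv by (auto intro: mv_carrier)
    ultimately have "Q *\<^sub>v v = Q *\<^sub>v (P *\<^sub>v v)"
      by (intro eq_vecI) (auto simp: vec_eq_iff)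
    then show "(Q * P) *\<^sub>v v = Q *\<^sub>v v" using v by (simp add: mv_assoc)
  qed
  have "Q = adj (Q * P)" using *[OF P Q] Q by (simp add: is_proj_def)
  also have "\<dots> = P * Q" using P Q by (simp add: is_proj_def adj_mul)
  also have "\<dots> = P" by (rule *[OF Q P])
  finally show ?thesis ..
qed

lemma supp_proj_eq:
  assumes "A \<in> psd_mats n"
  shows "supp_proj A = supp A"
proof -
  have d: "dim_row A = n" using psd_carrier[OF assms] by simp
  show ?thesis unfolding supp_proj_def d
    using is_proj_supp[OF assms] is_proj_unique unfolding is_proj_def by (intro the_equality) blast+
qed

text \<open>The part \<open>w\<close> of \<open>v\<close> killed by the support of A has quadratic
  form 0 under it, hence also under the smaller projection; so the support of B, and with it B,
  kills \<open>w\<close>.\<close>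

lemma supp_le_absorb:
  assumes A: "A \<in> psd_mats n" and B: "B \<in> psd_mats n"
    and le: "loewner_le n (supp_proj B) (supp_proj A)"
  shows "B * supp A = B"
proof (rule mat_eq_by_vec)
  note [simp] = A B
  show "B * supp A \<in> carrier_mat n n" "B \<in> carrier_mat n n" by simp_all
  fix v :: "complex vec" assume v: "v \<in> carrier_vec n"
  define w where "w = v - supp A *\<^sub>v v"
  have Pv: "supp A *\<^sub>v v \<in> carrier_vec n" using v by (intro mv_carrier) auto
  have w: "w \<in> carrier_vec n" using v Pv by (simp add: w_def)
  have "supp A *\<^sub>v w = supp A *\<^sub>v v - (supp A * supp A) *\<^sub>v v" unfolding w_def
    using v Pv by (simp add: mult_minus_distrib_mat_vec[of _ n n] mv_assoc)
  then have Aw: "supp A *\<^sub>v w = 0\<^sub>v n" using Pv by (simp add: supp_mult(2)[OF A])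
  have "supp A - supp B \<in> psd_mats n"
    using le by (simp add: loewner_le_def supp_proj_eq)
  then have "0 \<le> qform (supp A) w - qform (supp B) w"
    using psdD[of "supp A - supp B" w] w by (simp add: qform_minus)
  moreover have "qform (supp A) w = 0" using w by (simp add: qform_def Aw)
  moreover have "qform (supp B) w = qform (1\<^sub>m n) (supp B *\<^sub>v w)"
    using qform_mult[of "1\<^sub>m n" "supp B" w] w by (simp add: supp_mult(2)[OF B])
  moreover have "supp B *\<^sub>v w \<in> carrier_vec n" using w by (intro mv_carrier) auto
  ultimately have "supp B *\<^sub>v w = 0\<^sub>v n" using qform_one_pos[of "supp B *\<^sub>v w"] by fastforce
  then have "B *\<^sub>v w = 0\<^sub>v n" using is_proj_supp[OF B] w by (auto simp: is_proj_def kernel_eq)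
  then have "B *\<^sub>v v - B *\<^sub>v (supp A *\<^sub>v v) = 0\<^sub>v n"
    unfolding w_def using v Pv by (simp add: mult_minus_distrib_mat_vec[of _ n n])
  moreover have "B *\<^sub>v v \<in> carrier_vec n" "B *\<^sub>v (supp A *\<^sub>v v) \<in> carrier_vec n"
    using v Pv by (auto intro: mv_carrier)
  ultimately have "B *\<^sub>v v = B *\<^sub>v (supp A *\<^sub>v v)"
    by (intro eq_vecI) (auto simp: vec_eq_iff)
  then show "(B * supp A) *\<^sub>v v = B *\<^sub>v v" using v by (simp add: mv_assoc)
qed

text \<open>Every power of \<open>B\<close>, also a negative one, has a factor \<open>B\<close>:
  \<open>pw B r = pw B (r - 1) * B\<close>.\<close>

lemma absorb_pw:
  assumes B: "B \<in> psd_mats n" and P: "herm n P" "B * P = B"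
  shows "pw B r * P = pw B r" "P * pw B r = pw B r"
proof -
  note [simp] = B herm_carrier[OF P(1)]
  have "pw B r = pw B (r - 1) * B" using pw_mul[OF B, of "r - 1" 1] by simp
  then show *: "pw B r * P = pw B r" using P(2) by (simp add: assoc)
  have "P * pw B r = adj (pw B r * P)" using P(1) by (simp add: adj_mul)
  then show "P * pw B r = pw B r" by (simp add: *)
qed

text \<open>The means do not depend on how the first argument acts on its kernel, so it may be made definite there.\<close>

definition fill :: "complex mat \<Rightarrow> complex mat" where
  "fill A = mat_fun (\<lambda>x. if x = 0 then 1 else x) A"

lemma fill_pd:
  assumes "A \<in> psd_mats n"
  shows "fill A \<in> pd_mats n"
proof (rule psd_obtain[OF assms])
  fix U d assume U: "U \<in> unitary_mats n" "\<And>f. mat_fun f A = U * rdiag n (\<lambda>i. f (d i)) * adj U" "\<And>i. i < n \<Longrightarrow> 0 \<le> d i"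
  show ?thesis unfolding fill_def U(2)
    by (rule udiag_pd[OF U(1)]) (use U(3) in \<open>auto simp: less_le\<close>)
qed

lemma pw_fill:
  assumes "A \<in> psd_mats n"
  shows "pw (fill A) r * supp A = pw A r" "supp A * pw (fill A) r = pw A r"
proof -
  have "pw (fill A) r = mat_fun (\<lambda>x. (if x = 0 then 1 else x) powr r) A"
    using assms by (simp add: pw_def fill_def mat_fun_comp)
  moreover have "(\<lambda>x. (if x = 0 then 1 else x) powr r * (if x = 0 then 0 else 1)) = (\<lambda>x :: real. x powr r)"
    "(\<lambda>x. (if x = 0 then 0 else 1) * (if x = 0 then 1 else x) powr r) = (\<lambda>x :: real. x powr r)"
    by auto
  ultimately show "pw (fill A) r * supp A = pw A r" "supp A * pw (fill A) r = pw A r"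
    using psd_herm[OF assms] by (simp_all only: pw_def supp_def mat_fun_mult)
qed

text \<open>\<open>X\<close> is unchanged when multiplied by the support projection of
  \<open>A\<close> on either side, and this projection turns powers of \<open>fill A\<close> into
  powers of \<open>A\<close>.\<close>

lemma sandwich_fill:
  assumes A: "A \<in> psd_mats n" and X: "X \<in> psd_mats n" "X * supp A = X"
  shows "pw (fill A) r * (X * pw (fill A) r) = pw A r * (X * pw A r)"
    "X * (pw (fill A) r * X) = X * (pw A r * X)"
proof -
  note [simp] = A X(1) fill_pd[OF A]
  have PX: "supp A * X = X" using absorb_pw(2)[OF X(1) supp_herm[OF A] X(2), of 1] by simp
  have X': "X = supp A * (X * supp A)" using PX X(2) by simp
  have "pw (fill A) r * (X * pw (fill A) r) = pw (fill A) r * ((supp A * (X * supp A)) * pw (fill A) r)"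
    using X' by simp
  also have "\<dots> = (pw (fill A) r * supp A) * (X * (supp A * pw (fill A) r))" by (simp add: assoc)
  finally show "pw (fill A) r * (X * pw (fill A) r) = pw A r * (X * pw A r)" using pw_fill[OF A] by simp
  have "X * (pw (fill A) r * X) = X * (pw (fill A) r * (supp A * X))" using PX by simp
  also have "\<dots> = X * ((pw (fill A) r * supp A) * X)" by (simp add: assoc)
  finally show "X * (pw (fill A) r * X) = X * (pw A r * X)" using pw_fill[OF A] by simp
qed

lemma absorb_sandwich:
  assumes A: "A \<in> psd_mats n" and X: "X \<in> psd_mats n"
  shows "pw A r * (X * pw A r) * supp A = pw A r * (X * pw A r)"
  using absorb_pw(1)[OF A supp_herm[OF A] supp_mult(1)[OF A], of r] A X by (simp add: assoc)

text \<open>\<open>sandwich_fill\<close> is applied twice: to \<open>X\<close> inside the mean, and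
  to the power of the inner matrix, which again absorbs the support of \<open>A\<close>. The second
  claim is what the spectral mean needs for the factors E^\<alpha>.\<close>

lemma mean_fill:
  assumes A: "A \<in> psd_mats n" and X: "X \<in> psd_mats n" "X * supp A = X"
  shows "mean t (pw (fill A) r) X = mean t (pw A r) X" "mean t (pw A r) X * supp A = mean t (pw A r) X"
proof -
  note [simp] = A X(1) fill_pd[OF A]
  let ?N = "pw A (r * (-1/2)) * (X * pw A (r * (-1/2)))"
  have N: "pw ?N t * supp A = pw ?N t"
    by (intro absorb_pw absorb_sandwich supp_herm) auto
  have "mean t (pw (fill A) r) X = pw (fill A) (r * (1/2)) * (pw ?N t * pw (fill A) (r * (1/2)))"
    unfolding mean_def using sandwich_fill(1)[OF A X, of "r * (-1/2)"] by (simp add: pw_pw)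
  also have "\<dots> = pw A (r * (1/2)) * (pw ?N t * pw A (r * (1/2)))"
    by (rule sandwich_fill(1)[OF A _ N]) simp
  also have "\<dots> = mean t (pw A r) X" by (simp add: mean_def pw_pw)
  finally show "mean t (pw (fill A) r) X = mean t (pw A r) X" .
  have "mean t (pw A r) X = pw A (r * (1/2)) * (pw ?N t * pw A (r * (1/2)))" by (simp add: mean_def pw_pw)
  then show "mean t (pw A r) X * supp A = mean t (pw A r) X"
    using absorb_sandwich[of A "pw ?N t" "r * (1/2)"] by simp
qed

lemma means_fill:
  assumes A: "A \<in> psd_mats n" and B: "B \<in> psd_mats n"
    and le: "loewner_le n (supp_proj B) (supp_proj A)"
  shows "G_mean \<alpha> q (fill A) B = G_mean \<alpha> q A B" "SG_mean \<alpha> p (fill A) B = SG_mean \<alpha> p A B"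
proof -
  note [simp] = A B fill_pd[OF A]
  have X: "pw B r * supp A = pw B r" for r
    by (intro absorb_pw supp_le_absorb le) auto
  show "G_mean \<alpha> q (fill A) B = G_mean \<alpha> q A B"
    by (simp add: G_mean_pw mean_fill(1)[OF A _ X])
  define E where "E = mean (1/2) (pw A (-p)) (pw B p)"
  have E [simp]: "E \<in> psd_mats n" by (simp add: E_def)
  have "E * supp A = E" unfolding E_def by (rule mean_fill(2)[OF A _ X]) simp
  then have "pw E \<alpha> * supp A = pw E \<alpha>" by (intro absorb_pw) auto
  then have "pw E \<alpha> * (pw (fill A) p * pw E \<alpha>) = pw E \<alpha> * (pw A p * pw E \<alpha>)"
    by (intro sandwich_fill(2)) auto
  then show "SG_mean \<alpha> p (fill A) B = SG_mean \<alpha> p A B"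
    by (simp add: SG_mean_pw mean_fill(1)[OF A _ X] E_def[symmetric])
qed

section \<open>Norm estimates for the counterexample\<close>

text \<open>F^(1/2) E F E F^(1/2) is the square of F^(1/2) E F^(1/2). This converse of
  \<open>riccati\<close> allows E to be prescribed and H to be defined as E F E.\<close>

lemma riccati_inverse:
  assumes F: "F \<in> pd_mats n" and E: "E \<in> psd_mats n"
  shows "mean (1/2) (pw F (-1)) (E * (F * E)) = E"
proof -
  note [simp] = F E
  define K where "K = pw F (1/2) * (E * pw F (1/2))"
  have K [simp]: "K \<in> psd_mats n" by (simp add: K_def)
  have "pw F (1/2) * ((E * (F * E)) * pw F (1/2)) = pw F (1/2) * ((E * (pw F 1 * E)) * pw F (1/2))" by simp
  also have "pw F 1 = pw F (1/2) * pw F (1/2)" by (simp add: pw_mul pw_mul')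
  also have "pw F (1/2) * ((E * ((pw F (1/2) * pw F (1/2)) * E)) * pw F (1/2)) = K * K"
    unfolding K_def by (simp add: assoc)
  also have "\<dots> = pw K 2" using pw_mul[OF K, of 1 1] by simp
  finally have "mean (1/2) (pw F (-1)) (E * (F * E)) = pw F (-1/2) * (K * pw F (-1/2))"
    by (simp add: mean_def pw_pw)
  also have "\<dots> = E" unfolding K_def by (simp add: pw_simps)
  finally show ?thesis .
qed

text \<open>For the arguments chosen here the p-th power of the spectral mean is E^\<alpha> F
  E^\<alpha> \<le> f E^(2\<alpha>) \<le> f.\<close>

lemma SG_mean_bound:
  assumes F: "F \<in> pd_mats n" and E: "E \<in> pd_mats n" and "0 < \<alpha>" "0 < p" "0 < f"
    and Ff: "qle n F (complex_of_real f \<cdot>\<^sub>m 1\<^sub>m n)" and E1: "qle n E (1\<^sub>m n)"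
  shows "qle n (SG_mean \<alpha> p (pw F (1/p)) (pw (E * (F * E)) (1/p))) (complex_of_real (f powr (1/p)) \<cdot>\<^sub>m 1\<^sub>m n)"
proof -
  note [simp] = F E
  have H [simp]: "E * (F * E) \<in> psd_mats n" using psd_cong[of F E] by simp
  have "qle n (pw E \<alpha> * (F * pw E \<alpha>)) (pw E \<alpha> * ((complex_of_real f \<cdot>\<^sub>m 1\<^sub>m n) * pw E \<alpha>))"
    using Ff by (intro qle_sandwich) auto
  also have "\<dots> = complex_of_real f \<cdot>\<^sub>m pw E (2 * \<alpha>)" by (simp add: pw_mul pw_mul' msmult)
  also have "qle n \<dots> (complex_of_real f \<cdot>\<^sub>m 1\<^sub>m n)"
    using assms by (intro qle_smult pw_le_one) auto
  finally have "qle n (pw (pw E \<alpha> * (F * pw E \<alpha>)) (1/p)) (complex_of_real (f powr (1/p)) \<cdot>\<^sub>m 1\<^sub>m n)"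
    using assms by (intro pw_le_scalar) auto
  then show ?thesis using assms by (simp add: SG_mean_pw pw_pw riccati_inverse)
qed

text \<open>\<open>geo_mean_bound\<close> gives the estimate at the exponent q/p; Loewner-Heinz
  lowers it to any positive r \<le> q/p. This freedom permits r \<le> 1 even when q/p is
  large.\<close>

lemma G_mean_lower:
  assumes F: "F \<in> pd_mats n" and H: "H \<in> pd_mats n" and \<alpha>: "1 < \<alpha>" and pq: "0 < p" "0 < q" and f: "0 < f"
    and r: "0 < r" "r \<le> q / p"
    and le: "qle n (G_mean \<alpha> q (pw F (1/p)) (pw H (1/p))) (complex_of_real (f powr (1/p)) \<cdot>\<^sub>m 1\<^sub>m n)"
  shows "qle n (pw H r) (complex_of_real (f powr (r/\<alpha>)) \<cdot>\<^sub>m pw F (r * (1 - 1/\<alpha>)))"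
proof -
  note [simp] = F H
  define \<rho> where "\<rho> = q / p"
  have \<rho>: "0 < \<rho>" "r \<le> \<rho>" using pq r by (auto simp: \<rho>_def)
  let ?M = "mean \<alpha> (pw F \<rho>) (pw H \<rho>)"
  have G: "G_mean \<alpha> q (pw F (1/p)) (pw H (1/p)) = pw ?M (1/q)"
    using pq by (simp add: G_mean_pw pw_pw \<rho>_def)
  have "qle n (pw (pw ?M (1/q)) q) (complex_of_real ((f powr (1/p)) powr q) \<cdot>\<^sub>m 1\<^sub>m n)"
    using le pq unfolding G by (intro pw_le_scalar) auto
  then have "qle n ?M (complex_of_real (f powr \<rho>) \<cdot>\<^sub>m 1\<^sub>m n)"
    using pq by (simp add: pw_pw powr_powr \<rho>_def)
  then have "qle n (pw H \<rho>) (complex_of_real ((f powr \<rho>) powr (1/\<alpha>)) \<cdot>\<^sub>m pw (pw F \<rho>) (1 - 1/\<alpha>))"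
    using \<alpha> f by (intro geo_mean_bound) auto
  then have "qle n (pw (pw H \<rho>) (r/\<rho>)) (pw (complex_of_real ((f powr \<rho>) powr (1/\<alpha>)) \<cdot>\<^sub>m pw (pw F \<rho>) (1 - 1/\<alpha>)) (r/\<rho>))"
    using \<rho> r f by (intro loewner_heinz) (auto intro!: smult_pd)
  then show ?thesis using \<rho> by (simp add: pw_pw pw_smult powr_powr mult.commute)
qed

text \<open>On each eigenvalue x in (0, f] one has x^r = x^(r-1) x \<ge> f^(r-1) x, because r - 1
  \<le> 0.\<close>

lemma qform_pw_lower:
  assumes H: "H \<in> pd_mats n" and le: "qle n H (complex_of_real f \<cdot>\<^sub>m 1\<^sub>m n)" and r: "r \<le> 1" and v: "v \<in> carrier_vec n"
  shows "f powr (r - 1) * qform H v \<le> qform (pw H r) v"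
proof -
  obtain U d where U: "U \<in> unitary_mats n" "H = U * rdiag n d * adj U"
    "\<And>g. mat_fun g H = U * rdiag n (\<lambda>i. g (d i)) * adj U" "\<And>i. i < n \<Longrightarrow> 0 < d i"
    using pd_obtain[OF H] by blast
  note Uc = unitary_matsD(1)[OF U(1)]
  have "f powr (r - 1) * d i \<le> d i powr r" if "i < n" for i
  proof -
    have d: "0 < d i" "d i \<le> f" using U(4) that le qle_scalar_iff[OF U(1,2)] by auto
    have "f powr (r - 1) * d i \<le> d i powr (r - 1) * d i"
      using d r by (intro mult_right_mono powr_mono2') auto
    also have "\<dots> = d i powr r" using d by (simp add: powr_mult_base mult.commute)
    finally show ?thesis .
  qed
  then have "(\<Sum>i<n. f powr (r - 1) * (d i * (cmod ((adj U *\<^sub>v v) $ i))\<^sup>2)) \<le> (\<Sum>i<n. d i powr r * (cmod ((adj U *\<^sub>v v) $ i))\<^sup>2)"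
    by (intro sum_mono) (simp add: mult.assoc[symmetric] mult_right_mono)
  moreover have "qform H v = (\<Sum>i<n. d i * (cmod ((adj U *\<^sub>v v) $ i))\<^sup>2)"
    by (subst U(2)) (rule qform_udiag[OF Uc v])
  ultimately show ?thesis unfolding pw_def U(3) qform_udiag[OF Uc v] by (simp add: sum_distrib_left)
qed

end

section \<open>Compound matrices\<close>

definition idx_set :: "nat \<Rightarrow> nat \<Rightarrow> nat list set" where
  "idx_set n k = {I. sorted_wrt (<) I \<and> length I = k \<and> set I \<subseteq> {..<n}}"

lemma finite_idx_set: "finite (idx_set n k)"
  by (rule finite_subset[OF _ finite_lists_length_eq[of "{..<n}" k]]) (auto simp: idx_set_def)

lemma idx_setD:
  assumes "I \<in> idx_set n k"
  shows "length I = k" "sorted_wrt (<) I" "distinct I" "\<And>i. i < k \<Longrightarrow> I ! i < n"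
  using assms by (auto simp: idx_set_def strict_sorted_iff dest: nth_mem)

lemma idx_set_eqI:
  assumes "I \<in> idx_set n k" "J \<in> idx_set n k" "set I = set J"
  shows "I = J"
  using assms by (intro strict_sorted_equal) (auto simp: idx_set_def)

lemma idx_set_nth_inj:
  assumes "I \<in> idx_set n k" "J \<in> idx_set n k" "p permutes {0..<k}" "q permutes {0..<k}"
    and eq: "\<And>i. i < k \<Longrightarrow> I ! p i = J ! q i"
  shows "I = J" "p = q"
proof -
  have im: "(\<lambda>i. K ! r i) ` {0..<k} = set K" if "K \<in> idx_set n k" "r permutes {0..<k}" for K r
  proof -
    have "(\<lambda>i. K ! r i) ` {0..<k} = (!) K ` (r ` {0..<k})" by (simp add: image_image)
    also have "r ` {0..<k} = {0..<k}" by (rule permutes_image[OF that(2)])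
    also have "(!) K ` {0..<k} = set K" using idx_setD(1)[OF that(1)] by (auto simp: set_conv_nth)
    finally show ?thesis .
  qed
  have "set I = set J" using im[OF assms(1,3)] im[OF assms(2,4)] eq by (metis (mono_tags, lifting) atLeastLessThan_iff image_cong)
  then show IJ: "I = J" using idx_set_eqI assms by blast
  show "p = q"
  proof
    fix i
    show "p i = q i"
    proof (cases "i < k")
      case True
      then have "p i < k" "q i < k" using permutes_in_image[OF assms(3), of i] permutes_in_image[OF assms(4), of i] by auto
      then show ?thesis using eq[OF True] IJ idx_setD(1,3)[OF assms(1)] by (simp add: nth_eq_iff_index_eq)
    next
      case False
      then show ?thesis using assms(3,4) by (simp add: permutes_not_in)
    qed
  qed
qed

text \<open>Sorting the image shows that an injective choice of k indices is an increasing list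
  followed by a permutation; \<open>idx_set_nth_inj\<close> says that this factorization is
  unique.\<close>

lemma idx_set_factor:
  assumes f: "inj_on f {0..<k}" "f ` {0..<k} \<subseteq> {..<n}"
  obtains I p where "I \<in> idx_set n k" "p permutes {0..<k}" "\<And>i. i < k \<Longrightarrow> f i = I ! p i"
proof -
  define I where "I = sorted_list_of_set (f ` {0..<k})"
  have I: "I \<in> idx_set n k" "set I = f ` {0..<k}"
    using f card_image[OF f(1)] by (auto simp: I_def idx_set_def)
  have "\<exists>j<k. I ! j = f i" if "i < k" for i
  proof -
    have "f i \<in> set I" using I that by auto
    then show ?thesis using idx_setD(1)[OF I(1)] by (metis in_set_conv_nth)
  qed
  then obtain g where g: "\<And>i. i < k \<Longrightarrow> g i < k \<and> I ! g i = f i" by metis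
  define p where "p i = (if i < k then g i else i)" for i
  have "inj_on p {0..<k}" using g f(1) by (intro inj_onI) (metis atLeastLessThan_iff inj_onD p_def)
  moreover have "\<forall>i\<in>{0..<k}. p i \<in> {0..<k}" "\<forall>i. i \<notin> {0..<k} \<longrightarrow> p i = i" using g by (auto simp: p_def)
  ultimately have "p permutes {0..<k}" using inj_on_nat_permutes by blast
  moreover have "f i = I ! p i" if "i < k" for i using g[OF that] that by (simp add: p_def)
  ultimately show thesis using that I(1) by blast
qed

text \<open>Multilinearity in the rows of the product. Requiring \<open>f\<close> to be the identity
  outside \<open>{0..<k}\<close> makes the set of choice functions finite.\<close>

lemma det_rows_fun:
  fixes A B :: "complex mat"
  assumes A: "A \<in> carrier_mat k n" and B: "B \<in> carrier_mat n k"
  shows "det (A * B) = (\<Sum>f\<in>{f. (\<forall>i\<in>{0..<k}. f i \<in> {0..<n}) \<and> (\<forall>i. i \<notin> {0..<k} \<longrightarrow> f i = i)}.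
    (\<Prod>i=0..<k. A $$ (i, f i)) * det (mat k k (\<lambda>(i,j). B $$ (f i, j))))"
proof -
  have "det (A * B) = (\<Sum>f\<in>{f. (\<forall>i\<in>{0..<k}. f i \<in> {0..<n}) \<and> (\<forall>i. i \<notin> {0..<k} \<longrightarrow> f i = i)}.
      det (mat\<^sub>r k k (\<lambda>i. A $$ (i, f i) \<cdot>\<^sub>v row B (f i))))"
    unfolding mat_mul_finsum_alt[OF A B]
    by (rule det_linear_rows_sum) (use A B in auto)
  also have "\<dots> = (\<Sum>f\<in>{f. (\<forall>i\<in>{0..<k}. f i \<in> {0..<n}) \<and> (\<forall>i. i \<notin> {0..<k} \<longrightarrow> f i = i)}.
    (\<Prod>i=0..<k. A $$ (i, f i)) * det (mat k k (\<lambda>(i,j). B $$ (f i, j))))"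
  proof (rule sum.cong[OF refl])
    fix f assume f: "f \<in> {f. (\<forall>i\<in>{0..<k}. f i \<in> {0..<n}) \<and> (\<forall>i. i \<notin> {0..<k} \<longrightarrow> f i = i)}"
    have "mat\<^sub>r k k (\<lambda>i. row B (f i)) = mat k k (\<lambda>(i,j). B $$ (f i, j))"
      using f B by (intro eq_matI) auto
    then show "det (mat\<^sub>r k k (\<lambda>i. A $$ (i, f i) \<cdot>\<^sub>v row B (f i)))
      = (\<Prod>i=0..<k. A $$ (i, f i)) * det (mat k k (\<lambda>(i,j). B $$ (f i, j)))"
      using f B by (subst det_rows_mul) auto
  qed
  finally show ?thesis .
qed

text \<open>Choice functions that are not injective repeat a row and contribute 0. The injective
  ones are grouped by their image \<open>K\<close>, and for fixed \<open>K\<close> the sum over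
  permutations is the Leibniz formula for the minor of \<open>A\<close>.\<close>

theorem cauchy_binet:
  fixes A B :: "complex mat"
  assumes A: "A \<in> carrier_mat k n" and B: "B \<in> carrier_mat n k"
  shows "det (A * B) = (\<Sum>K\<in>idx_set n k. det (mat k k (\<lambda>(i,j). A $$ (i, K ! j))) * det (mat k k (\<lambda>(i,j). B $$ (K ! i, j))))"
proof -
  let ?F = "{f. (\<forall>i\<in>{0..<k}. f i \<in> {0..<n}) \<and> (\<forall>i. i \<notin> {0..<k} \<longrightarrow> f i = i)}"
  let ?P = "{p. p permutes {0..<k}}"
  let ?g = "\<lambda>f. (\<Prod>i=0..<k. A $$ (i, f i)) * det (mat k k (\<lambda>(i,j). B $$ (f i, j)))"
  let ?h = "\<lambda>(K, p). \<lambda>i. if i < k then K ! p i else i :: nat"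
  let ?S = "idx_set n k \<times> ?P"
  have fin: "finite ?F" by (rule finite_bounded_functions) auto
  have hF: "?h ` ?S \<subseteq> ?F"
    using idx_setD(4) permutes_in_image by fastforce
  have zero: "?g f = 0" if f: "f \<in> ?F - ?h ` ?S" for f
  proof -
    have "\<not> inj_on f {0..<k}"
    proof
      assume "inj_on f {0..<k}"
      moreover have "f ` {0..<k} \<subseteq> {..<n}" using f by auto
      ultimately obtain I p where Ip: "I \<in> idx_set n k" "p permutes {0..<k}" "\<And>i. i < k \<Longrightarrow> f i = I ! p i"
        using idx_set_factor[of f k n] by blast
      then have "f = ?h (I, p)" using f by auto
      then show False using f Ip(1,2) by blast
    qed
    then obtain i j where ij: "f i = f j" "i \<noteq> j" "i < k" "j < k" unfolding inj_on_def by auto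
    have "det (mat k k (\<lambda>(i,j). B $$ (f i, j))) = 0"
      by (rule det_identical_rows[OF _ ij(2-4)]) (use ij in auto)
    then show ?thesis by simp
  qed
  have inj: "inj_on ?h ?S"
  proof (rule inj_onI)
    fix x y assume x: "x \<in> ?S" and y: "y \<in> ?S" and eq: "?h x = ?h y"
    obtain I p J q where xy: "x = (I, p)" "y = (J, q)" by (cases x, cases y)
    have "I ! p i = J ! q i" if "i < k" for i using fun_cong[OF eq, of i] that by (simp add: xy)
    then show "x = y" using idx_set_nth_inj[of I n k J p q] x y by (auto simp: xy)
  qed
  have "det (A * B) = sum ?g ?F" by (rule det_rows_fun[OF A B])
  also have "\<dots> = sum ?g (?h ` ?S)" using fin hF zero by (intro sum.mono_neutral_right) auto
  also have "\<dots> = (\<Sum>x\<in>?S. ?g (?h x))" using inj by (simp add: sum.reindex o_def)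
  also have "\<dots> = (\<Sum>K\<in>idx_set n k. \<Sum>p\<in>?P. ?g (?h (K, p)))"
    unfolding sum.cartesian_product by (intro sum.cong refl) (auto simp only: split: prod.splits)
  also have "\<dots> = (\<Sum>K\<in>idx_set n k. det (mat k k (\<lambda>(i,j). A $$ (i, K ! j))) * det (mat k k (\<lambda>(i,j). B $$ (K ! i, j))))"
  proof (rule sum.cong[OF refl])
    fix K assume K: "K \<in> idx_set n k"
    let ?A = "mat k k (\<lambda>(i,j). A $$ (i, K ! j))" and ?B = "mat k k (\<lambda>(i,j). B $$ (K ! i, j))"
    have g: "?g (?h (K, p)) = signof p * (\<Prod>i=0..<k. ?A $$ (i, p i)) * det ?B" if p: "p permutes {0..<k}" for p
    proof -
      have pi: "p i < k" if "i < k" for i using permutes_in_image[OF p, of i] that by simp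
      have "mat k k (\<lambda>(i,j). B $$ (?h (K, p) i, j)) = mat k k (\<lambda>(i,j). ?B $$ (p i, j))"
        using pi by (intro eq_matI) auto
      then have "det (mat k k (\<lambda>(i,j). B $$ (?h (K, p) i, j))) = signof p * det ?B"
        using det_permute_rows[of ?B k p] p by simp
      moreover have "(\<Prod>i=0..<k. A $$ (i, ?h (K, p) i)) = (\<Prod>i=0..<k. ?A $$ (i, p i))"
        using pi by (intro prod.cong) auto
      ultimately show ?thesis by simp
    qed
    have "(\<Sum>p\<in>?P. ?g (?h (K, p))) = (\<Sum>p\<in>?P. signof p * (\<Prod>i=0..<k. ?A $$ (i, p i)) * det ?B)"
      using g by (intro sum.cong) auto
    also have "\<dots> = det ?A * det ?B" by (simp add: det_def'[of ?A k] sum_distrib_right)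
    finally show "(\<Sum>p\<in>?P. ?g (?h (K, p))) = det ?A * det ?B" .
  qed
  finally show ?thesis .
qed

text \<open>An arbitrary enumeration: its order only fixes the order of a basis of the exterior
  power.\<close>

definition idx :: "nat \<Rightarrow> nat \<Rightarrow> nat list list" where
  "idx n k = (SOME xs. set xs = idx_set n k \<and> distinct xs)"

lemma idx: "set (idx n k) = idx_set n k" "distinct (idx n k)"
  using someI_ex[OF finite_distinct_list[OF finite_idx_set[of n k]]] by (auto simp: idx_def)

definition minor :: "nat \<Rightarrow> complex mat \<Rightarrow> nat list \<Rightarrow> nat list \<Rightarrow> complex" where
  "minor k A I J = det (mat k k (\<lambda>(i,j). A $$ (I ! i, J ! j)))"

definition compound :: "nat \<Rightarrow> nat \<Rightarrow> complex mat \<Rightarrow> complex mat" where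
  "compound n k A = mat (length (idx n k)) (length (idx n k)) (\<lambda>(a,b). minor k A (idx n k ! a) (idx n k ! b))"

lemma minor_mult:
  assumes "A \<in> carrier_mat n n" "B \<in> carrier_mat n n" and I: "I \<in> idx_set n k" and J: "J \<in> idx_set n k"
  shows "minor k (A * B) I J = (\<Sum>K\<in>idx_set n k. minor k A I K * minor k B K J)"
proof -
  let ?A = "mat k n (\<lambda>(i,j). A $$ (I ! i, j))" and ?B = "mat n k (\<lambda>(i,j). B $$ (i, J ! j))"
  have "mat k k (\<lambda>(i,j). (A * B) $$ (I ! i, J ! j)) = ?A * ?B"
    using assms idx_setD(4)[OF I] idx_setD(4)[OF J] by (intro eq_matI) (auto simp: scalar_prod_def)
  then have "minor k (A * B) I J = det (?A * ?B)" by (simp add: minor_def)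
  also have "\<dots> = (\<Sum>K\<in>idx_set n k. minor k A I K * minor k B K J)"
    unfolding cauchy_binet[of ?A k n ?B, OF mat_carrier mat_carrier] minor_def
  proof (intro sum.cong refl)
    fix K assume K: "K \<in> idx_set n k"
    have "mat k k (\<lambda>(i,j). ?A $$ (i, K ! j)) = mat k k (\<lambda>(i,j). A $$ (I ! i, K ! j))"
      "mat k k (\<lambda>(i,j). ?B $$ (K ! i, j)) = mat k k (\<lambda>(i,j). B $$ (K ! i, J ! j))"
      using idx_setD(4)[OF K] by (auto intro!: eq_matI)
    then show "det (mat k k (\<lambda>(i,j). ?A $$ (i, K ! j))) * det (mat k k (\<lambda>(i,j). ?B $$ (K ! i, j)))
      = det (mat k k (\<lambda>(i,j). A $$ (I ! i, K ! j))) * det (mat k k (\<lambda>(i,j). B $$ (K ! i, J ! j)))" by simp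
  qed
  finally show ?thesis .
qed

lemma compound_carrier [simp]: "compound n k A \<in> carrier_mat (length (idx n k)) (length (idx n k))"
  by (simp add: compound_def)

lemma idx_nth: "a < length (idx n k) \<Longrightarrow> idx n k ! a \<in> idx_set n k"
  using idx(1) nth_mem by blast

lemma compound_mult:
  assumes "A \<in> carrier_mat n n" "B \<in> carrier_mat n n"
  shows "compound n k (A * B) = compound n k A * compound n k B"
proof (rule eq_matI)
  let ?N = "length (idx n k)"
  fix a b assume "a < dim_row (compound n k A * compound n k B)" "b < dim_col (compound n k A * compound n k B)"
  then have ab: "a < ?N" "b < ?N" by (auto simp: compound_def)
  have "(compound n k A * compound n k B) $$ (a, b) =
    (\<Sum>c<?N. minor k A (idx n k ! a) (idx n k ! c) * minor k B (idx n k ! c) (idx n k ! b))"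
    using ab by (subst mult_entry[of _ ?N]) (auto simp: compound_def)
  also have "\<dots> = (\<Sum>K\<in>idx_set n k. minor k A (idx n k ! a) K * minor k B K (idx n k ! b))"
    by (rule sum.reindex_bij_betw[OF bij_betw_nth[OF idx(2)[of n k] refl idx(1)[of n k, symmetric]]])
  also have "\<dots> = compound n k (A * B) $$ (a, b)"
    using ab minor_mult[OF assms idx_nth idx_nth] by (simp add: compound_def)
  finally show "compound n k (A * B) $$ (a, b) = (compound n k A * compound n k B) $$ (a, b)" ..
qed (auto simp: compound_def)

lemma det_cnj: "det (map_mat cnj A) = cnj (det A)" if "A \<in> carrier_mat k k"
proof -
  have "cnj (signof p) = signof p" for p :: "nat \<Rightarrow> nat" by (simp add: sign_def)
  then show ?thesis using that
    by (subst (1 2) det_def'[of _ k]) (auto simp: permutes_in_image intro!: sum.cong prod.cong)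
qed

lemma compound_adj:
  assumes "A \<in> carrier_mat n n"
  shows "compound n k (mat_adjoint A) = mat_adjoint (compound n k A)"
proof (rule eq_matI)
  let ?N = "length (idx n k)"
  fix a b assume "a < dim_row (mat_adjoint (compound n k A))" "b < dim_col (mat_adjoint (compound n k A))"
  then have ab: "a < ?N" "b < ?N" by (auto simp: compound_def)
  let ?I = "idx n k ! a" and ?J = "idx n k ! b"
  let ?S = "mat k k (\<lambda>(i,j). A $$ (?J ! i, ?I ! j))"
  have "mat k k (\<lambda>(i,j). mat_adjoint A $$ (?I ! i, ?J ! j)) = transpose_mat (map_mat cnj ?S)"
    using assms idx_setD(4)[OF idx_nth[OF ab(1)]] idx_setD(4)[OF idx_nth[OF ab(2)]] by (intro eq_matI) auto
  then have "minor k (mat_adjoint A) ?I ?J = cnj (minor k A ?J ?I)"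
    unfolding minor_def by (simp add: det_transpose[of _ k] det_cnj[of _ k])
  then show "compound n k (mat_adjoint A) $$ (a, b) = mat_adjoint (compound n k A) $$ (a, b)"
    using ab by (simp add: compound_def)
qed (auto simp: compound_def)

lemma compound_diag:
  "compound n k (mat_diag n f) = mat_diag (length (idx n k)) (\<lambda>a. \<Prod>i\<leftarrow>idx n k ! a. f i)"
proof (rule eq_matI)
  let ?N = "length (idx n k)"
  fix a b assume "a < dim_row (mat_diag ?N (\<lambda>a. \<Prod>i\<leftarrow>idx n k ! a. f i))"
    "b < dim_col (mat_diag ?N (\<lambda>a. \<Prod>i\<leftarrow>idx n k ! a. f i))"
  then have ab: "a < ?N" "b < ?N" by (auto simp: mat_diag_def)
  let ?I = "idx n k ! a" and ?J = "idx n k ! b"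
  note I = idx_setD[OF idx_nth[OF ab(1)]] and J = idx_setD[OF idx_nth[OF ab(2)]]
  let ?S = "mat k k (\<lambda>(i,j). mat_diag n f $$ (?I ! i, ?J ! j))"
  have entry: "?S $$ (i, j) = (if ?I ! i = ?J ! j then f (?I ! i) else 0)" if "i < k" "j < k" for i j
    using that I(4) J(4) by (auto simp: mat_diag_def)
  have "det ?S = (if a = b then \<Prod>i\<leftarrow>?I. f i else 0)"
  proof (cases "a = b")
    case True
    have S: "?S = mat_diag k (\<lambda>i. f (?I ! i))"
      using True I by (intro eq_matI) (auto simp: mat_diag_def nth_eq_iff_index_eq)
    have "det ?S = prod_list (diag_mat (mat_diag k (\<lambda>i. f (?I ! i))))"
      unfolding S by (rule det_upper_triangular[of _ k]) (auto simp: mat_diag_def)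
    also have "diag_mat (mat_diag k (\<lambda>i. f (?I ! i))) = map f ?I"
      using I(1) by (intro nth_equalityI) (auto simp: diag_mat_def mat_diag_def)
    finally show ?thesis using True by simp
  next
    case False
    then have "?I \<noteq> ?J" using ab idx(2) by (simp add: nth_eq_iff_index_eq)
    then have "set ?I \<noteq> set ?J" using idx_set_eqI[OF idx_nth[OF ab(1)] idx_nth[OF ab(2)]] by blast
    moreover have "card (set ?I) = card (set ?J)" using I(1,3) J(1,3) by (simp add: distinct_card)
    ultimately have "\<not> set ?I \<subseteq> set ?J" using card_subset_eq[of "set ?J" "set ?I"] by blast
    \<comment> \<open>Distinct index sets of equal size: row \<open>r\<close> of the submatrix meets
      no diagonal entry, so it is zero.\<close>
    then obtain r where r: "r < k" "?I ! r \<notin> set ?J" using I(1) by (metis in_set_conv_nth subsetI)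
    have "(\<Prod>i=0..<k. ?S $$ (i, p i)) = 0" if p: "p permutes {0..<k}" for p
    proof (rule prod_zero)
      have "p r < k" using permutes_in_image[OF p, of r] r by simp
      then have "?S $$ (r, p r) = 0" using entry[of r "p r"] r J(1) by (metis nth_mem)
      then show "\<exists>i\<in>{0..<k}. ?S $$ (i, p i) = 0" using r by auto
    qed simp
    then have "det ?S = 0" by (subst det_def'[of _ k]) (auto intro!: sum.neutral)
    then show ?thesis using False by simp
  qed
  then show "compound n k (mat_diag n f) $$ (a, b) = mat_diag ?N (\<lambda>a. \<Prod>i\<leftarrow>idx n k ! a. f i) $$ (a, b)"
    using ab by (simp add: compound_def minor_def mat_diag_def)
qed (auto simp: compound_def mat_diag_def)

lemma compound_one: "compound n k (1\<^sub>m n) = 1\<^sub>m (length (idx n k))"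
proof -
  have "(\<Prod>i\<leftarrow>xs. 1) = (1 :: complex)" for xs :: "nat list" by (induction xs) auto
  then show ?thesis using compound_diag[of n k "\<lambda>_. 1"] by simp
qed

lemma compound_unitary:
  assumes "U \<in> unitary_mats n"
  shows "compound n k U \<in> unitary_mats (length (idx n k))"
proof (rule unitary_matsI[OF compound_carrier])
  note u = unitary_matsD[OF assms]
  have "mat_adjoint (compound n k U) * compound n k U = compound n k (mat_adjoint U * U)"
    using u(1) by (simp add: compound_mult compound_adj)
  then show "mat_adjoint (compound n k U) * compound n k U = 1\<^sub>m (length (idx n k))"
    by (simp add: u(3) compound_one)
qed

lemma compound_udiag:
  assumes U: "U \<in> carrier_mat n n"
  shows "compound n k (U * rdiag n d * mat_adjoint U)
    = compound n k U * rdiag (length (idx n k)) (\<lambda>a. \<Prod>i\<leftarrow>idx n k ! a. d i) * mat_adjoint (compound n k U)"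
proof -
  have "(\<Prod>i\<leftarrow>xs. complex_of_real (d i)) = complex_of_real (\<Prod>i\<leftarrow>xs. d i)" for xs
    by (induction xs) auto
  then show ?thesis using U
    by (simp add: compound_mult mult_carrier_mat[of _ n n _ n] compound_adj compound_diag)
qed

lemma prod_list_nonneg: "(\<And>i. i \<in> set xs \<Longrightarrow> 0 \<le> d i) \<Longrightarrow> 0 \<le> (\<Prod>i\<leftarrow>xs. d i :: real)"
  by (induction xs) auto

lemma prod_list_pos: "(\<And>i. i \<in> set xs \<Longrightarrow> 0 < d i) \<Longrightarrow> 0 < (\<Prod>i\<leftarrow>xs. d i :: real)"
  by (induction xs) auto

lemma prod_list_powr: "(\<And>i. i \<in> set xs \<Longrightarrow> 0 \<le> d i) \<Longrightarrow> (\<Prod>i\<leftarrow>xs. d i powr r) = (\<Prod>i\<leftarrow>xs. d i :: real) powr r"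
  by (induction xs) (auto simp: powr_mult prod_list_nonneg)

lemma idx_less: "a < length (idx n k) \<Longrightarrow> i \<in> set (idx n k ! a) \<Longrightarrow> i < n"
  using idx_nth[of a n k] by (auto simp: idx_set_def)

lemma compound_psd:
  assumes "A \<in> psd_mats n"
  shows "compound n k A \<in> psd_mats (length (idx n k))"
proof (rule psd_obtain[OF assms])
  fix U d assume U: "U \<in> unitary_mats n" "A = U * rdiag n d * mat_adjoint U" "\<And>i. i < n \<Longrightarrow> 0 \<le> d i"
  show ?thesis unfolding U(2) compound_udiag[OF unitary_matsD(1)[OF U(1)]]
    by (rule udiag_psd[OF compound_carrier], rule prod_list_nonneg, rule U(3), rule idx_less)
qed

lemma compound_pd:
  assumes "A \<in> pd_mats n"
  shows "compound n k A \<in> pd_mats (length (idx n k))"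
proof (rule pd_obtain[OF assms])
  fix U d assume U: "U \<in> unitary_mats n" "A = U * rdiag n d * mat_adjoint U" "\<And>i. i < n \<Longrightarrow> 0 < d i"
  show ?thesis unfolding U(2) compound_udiag[OF unitary_matsD(1)[OF U(1)]]
    by (rule udiag_pd[OF compound_unitary[OF U(1)]], rule prod_list_pos, rule U(3), rule idx_less)
qed

text \<open>The eigenvalues of the compound are products of eigenvalues of \<open>A\<close>, and a
  real power of a product of nonnegative numbers is the product of the powers.\<close>

lemma compound_pw:
  assumes "A \<in> psd_mats n"
  shows "compound n k (pw A r) = pw (compound n k A) r"
proof (rule psd_obtain[OF assms])
  fix U d assume U: "U \<in> unitary_mats n" "A = U * rdiag n d * mat_adjoint U"
    "\<And>f. mat_fun f A = U * rdiag n (\<lambda>i. f (d i)) * mat_adjoint U" "\<And>i. i < n \<Longrightarrow> 0 \<le> d i"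
  let ?N = "length (idx n k)"
  note Uc = unitary_matsD(1)[OF U(1)]
  have "rdiag ?N (\<lambda>a. \<Prod>i\<leftarrow>idx n k ! a. d i powr r) = rdiag ?N (\<lambda>a. (\<Prod>i\<leftarrow>idx n k ! a. d i) powr r)"
    by (rule rdiag_cong) (rule prod_list_powr, use U(4) idx_less in blast)
  moreover have "compound n k A = compound n k U * rdiag ?N (\<lambda>a. \<Prod>i\<leftarrow>idx n k ! a. d i) * mat_adjoint (compound n k U)"
    unfolding U(2) by (rule compound_udiag[OF Uc])
  ultimately show ?thesis
    using mat_fun_eq[OF compound_unitary[OF U(1)], of "compound n k A" k _ "\<lambda>x. x powr r"]
    unfolding pw_def U(3) compound_udiag[OF Uc] by simp
qed

lemma compound_mean:
  assumes "A \<in> psd_mats n" "B \<in> psd_mats n"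
  shows "compound n k (mean t A B) = mean t (compound n k A) (compound n k B)"
  unfolding mean_def using assms
  by (simp add: compound_mult mult_carrier_mat[of _ n n _ n] psd_carrier[of _ n] compound_pw[of _ n] pw_psd[of _ n] mid_psd[of _ n])

lemma compound_G_mean:
  assumes "A \<in> psd_mats n" "B \<in> psd_mats n"
  shows "compound n k (G_mean \<alpha> q A B) = G_mean \<alpha> q (compound n k A) (compound n k B)"
  using assms by (simp add: G_mean_pw[of _ n] G_mean_pw[of _ "length (idx n k)"] compound_psd compound_pw[of _ n]
    compound_mean[of _ n] mean_psd[of _ n] pw_psd[of _ n])

lemma compound_SG_mean:
  assumes "A \<in> psd_mats n" "B \<in> psd_mats n"
  shows "compound n k (SG_mean \<alpha> q A B) = SG_mean \<alpha> q (compound n k A) (compound n k B)"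
  using assms by (simp add: SG_mean_pw[of _ n] SG_mean_pw[of _ "length (idx n k)"] compound_psd compound_pw[of _ n]
    compound_mean[of _ n] mean_psd[of _ n] pw_psd[of _ n] mid_psd[of _ n] compound_mult mult_carrier_mat[of _ n n _ n] psd_carrier[of _ n])

section \<open>Ordered eigenvalues and log-majorization\<close>

lemma udiag_entry:
  assumes "U \<in> carrier_mat n n" "i < n" "j < n"
  shows "(U * rdiag n d * mat_adjoint U) $$ (i, j) = (\<Sum>k<n. U $$ (i, k) * complex_of_real (d k) * cnj (U $$ (j, k)))"
proof -
  have "(U * rdiag n d * mat_adjoint U) $$ (i, j) = (\<Sum>k<n. (U * rdiag n d) $$ (i, k) * mat_adjoint U $$ (k, j))"
    using assms by (intro mult_entry[of _ n]) (auto intro: mult_carrier_mat[of _ n n _ n])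
  then show ?thesis using assms unfolding mat_diag_mult_right[OF assms(1)] by simp
qed

lemma psd_obtain_sorted:
  assumes "A \<in> psd_mats n"
  obtains U d where "U \<in> unitary_mats n" "A = U * rdiag n d * mat_adjoint U"
    "\<And>i. i < n \<Longrightarrow> 0 \<le> d i" "\<And>i j. i \<le> j \<Longrightarrow> j < n \<Longrightarrow> d j \<le> d i"
proof (rule psd_obtain[OF assms])
  fix U d assume U: "U \<in> unitary_mats n" "A = U * rdiag n d * mat_adjoint U" "\<And>i. i < n \<Longrightarrow> 0 \<le> d i"
  note u = unitary_matsD[OF U(1)]
  define xs where "xs = map d [0..<n]"
  have "mset (rev (sort xs)) = mset xs" by simp
  \<comment> \<open>The permutation that sorts the eigenvalues downwards is applied to the columns
    of \<open>U\<close>.\<close>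
  then obtain p where p: "p permutes {..<length xs}" "permute_list p xs = rev (sort xs)"
    by (rule mset_eq_permutation)
  have len: "length xs = n" by (simp add: xs_def)
  have pn: "p i < n" if "i < n" for i using permutes_in_image[OF p(1), of i] that len by simp
  have bij: "bij_betw p {..<n} {..<n}" using permutes_imp_bij[OF p(1)] len by simp
  have dp: "d (p i) = rev (sort xs) ! i" if "i < n" for i
    using permute_list_nth[OF p(1), of i] that pn[OF that] len p(2) by (simp add: xs_def)
  define V where "V = mat n n (\<lambda>(i,j). U $$ (i, p j))"
  have V: "V \<in> carrier_mat n n" by (simp add: V_def)
  have "mat_adjoint V * V = 1\<^sub>m n"
  proof (rule eq_matI)
    fix i j assume "i < dim_row (1\<^sub>m n :: complex mat)" "j < dim_col (1\<^sub>m n :: complex mat)"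
    then have ij: "i < n" "j < n" by auto
    have "(mat_adjoint V * V) $$ (i, j) = (\<Sum>k<n. cnj (U $$ (k, p i)) * U $$ (k, p j))"
      using ij V by (subst mult_entry[of _ n]) (auto simp: V_def)
    also have "\<dots> = (mat_adjoint U * U) $$ (p i, p j)"
      using pn ij u(1) by (subst mult_entry[of _ n]) auto
    also have "\<dots> = 1\<^sub>m n $$ (i, j)"
      unfolding u(3) using pn ij permutes_inj[OF p(1)] by (simp add: inj_eq)
    finally show "(mat_adjoint V * V) $$ (i, j) = 1\<^sub>m n $$ (i, j)" .
  qed (use V in auto)
  then have VU: "V \<in> unitary_mats n" by (rule unitary_matsI[OF V])
  have "A = V * rdiag n (\<lambda>i. d (p i)) * mat_adjoint V"
  proof (rule eq_matI)
    fix i j assume "i < dim_row (V * rdiag n (\<lambda>i. d (p i)) * mat_adjoint V)" "j < dim_col (V * rdiag n (\<lambda>i. d (p i)) * mat_adjoint V)"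
    then have ij: "i < n" "j < n" using V by auto
    have "A $$ (i, j) = (\<Sum>k<n. U $$ (i, k) * complex_of_real (d k) * cnj (U $$ (j, k)))"
      unfolding U(2) by (rule udiag_entry[OF u(1) ij])
    also have "\<dots> = (\<Sum>k<n. U $$ (i, p k) * complex_of_real (d (p k)) * cnj (U $$ (j, p k)))"
      by (rule sum.reindex_bij_betw[OF bij, symmetric])
    also have "\<dots> = (V * rdiag n (\<lambda>i. d (p i)) * mat_adjoint V) $$ (i, j)"
      unfolding udiag_entry[OF V ij] using ij by (simp add: V_def)
    finally show "A $$ (i, j) = (V * rdiag n (\<lambda>i. d (p i)) * mat_adjoint V) $$ (i, j)" .
  qed (use V u(1) in \<open>auto simp: U(2)\<close>)
  note AV = this
  have mono: "d (p j) \<le> d (p i)" if "i \<le> j" "j < n" for i j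
  proof -
    have "sorted_wrt (\<ge>) (rev (sort xs))" by (simp add: sorted_wrt_rev)
    then have "i < j \<Longrightarrow> rev (sort xs) ! i \<ge> rev (sort xs) ! j" using that len by (intro sorted_wrt_nth_less) auto
    then show ?thesis using dp[of i] dp[of j] that by (cases "i = j") auto
  qed
  show thesis by (rule that[OF VU AV U(3)[OF pn] mono])
qed

text \<open>A root of one product occurs in the other list, and the common linear factor cancels.
  This makes the list described in \<open>eigvals_desc\<close> unique up to order.\<close>

lemma mset_linear_factors:
  "(\<Prod>x\<leftarrow>xs. [:- complex_of_real x, 1:]) = (\<Prod>x\<leftarrow>ys. [:- complex_of_real x, 1:]) \<Longrightarrow> mset xs = mset ys"
proof (induction xs arbitrary: ys)
  case Nil
  have "ys = []"
  proof (rule ccontr)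
    assume "ys \<noteq> []"
    then obtain y zs where "ys = y # zs" by (cases ys) auto
    then have "poly (\<Prod>x\<leftarrow>ys. [:- complex_of_real x, 1:]) (complex_of_real y) = 0" by simp
    then show False unfolding Nil[symmetric] by simp
  qed
  then show ?case by simp
next
  case (Cons x xs)
  have "poly (\<Prod>x\<leftarrow>ys. [:- complex_of_real x, 1:]) (complex_of_real x) = 0" unfolding Cons.prems[symmetric] by simp
  then have "x \<in> set ys" by (induction ys) auto
  then have ys: "mset ys = mset (x # remove1 x ys)" by simp
  let ?P = "\<lambda>zs. \<Prod>x\<leftarrow>zs. [:- complex_of_real x, 1:]"
  have "?P zs = prod_mset (image_mset (\<lambda>x. [:- complex_of_real x, 1:]) (mset zs))" for zs
    by (simp add: prod_mset_prod_list[symmetric])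
  then have "?P ys = ?P (x # remove1 x ys)" by (simp only: ys)
  then have "[:- complex_of_real x, 1:] * ?P xs = [:- complex_of_real x, 1:] * ?P (remove1 x ys)"
    using Cons.prems by (simp only: list.map prod_list.Cons)
  then have "?P xs = ?P (remove1 x ys)"
    by (subst (asm) mult_left_cancel) simp_all
  from Cons.IH[OF this] show ?case by (simp only: ys mset.simps)
qed

lemma eigvals_desc_eq:
  assumes U: "U \<in> unitary_mats n" and A: "A = U * rdiag n d * mat_adjoint U"
    and d: "\<And>i j. i \<le> j \<Longrightarrow> j < n \<Longrightarrow> d j \<le> d i"
  shows "eigvals_desc A = map d [0..<n]"
proof -
  note u = unitary_matsD[OF U]
  have "similar_mat A (rdiag n d)"
    by (rule similar_matI[of _ _ U "mat_adjoint U" n]) (use u in \<open>auto simp: A intro!: mult_carrier_mat[of _ n n _ n]\<close>)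
  then have "char_poly A = char_poly (rdiag n d)" by (rule char_poly_similar)
  also have "\<dots> = (\<Prod>a\<leftarrow>diag_mat (rdiag n d). [:- a, 1:])"
    by (rule char_poly_upper_triangular[of _ n]) (auto simp: mat_diag_def)
  also have "diag_mat (rdiag n d) = map complex_of_real (map d [0..<n])"
    by (auto simp: diag_mat_def mat_diag_def)
  finally have cp: "char_poly A = (\<Prod>x\<leftarrow>map d [0..<n]. [:- complex_of_real x, 1:])" by (simp add: o_def)
  have sorted: "sorted_wrt (\<ge>) (map d [0..<n])" using d by (auto simp: sorted_wrt_iff_nth_less)
  show ?thesis unfolding eigvals_desc_def
  proof (rule the_equality)
    fix xs assume xs: "sorted_wrt (\<ge>) xs \<and> char_poly A = (\<Prod>x\<leftarrow>xs. [:- complex_of_real x, 1:])"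
    then have "mset xs = mset (map d [0..<n])" using cp by (intro mset_linear_factors) simp
    \<comment> \<open>Both lists decrease while \<open>sort\<close> yields increasing lists, hence
      the reversals.\<close>
    then have "rev xs = sort (rev (map d [0..<n]))" using xs
      by (intro properties_for_sort[symmetric]) (auto simp: sorted_wrt_rev)
    also have "\<dots> = rev (map d [0..<n])" using sorted
      by (intro properties_for_sort) (auto simp: sorted_wrt_rev simp del: rev_map)
    finally show "xs = map d [0..<n]" by (simp only: rev_is_rev_conv)
  qed (use sorted cp in blast)
qed

lemma eigvals_desc_prod:
  assumes "U \<in> unitary_mats n" "A = U * rdiag n d * mat_adjoint U"
    "\<And>i j. i \<le> j \<Longrightarrow> j < n \<Longrightarrow> d j \<le> d i" "k \<le> n"
  shows "(\<Prod>i<k. eigvals_desc A ! i) = (\<Prod>i<k. d i)"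
  using eigvals_desc_eq[OF assms(1,2,3)] assms(4) by (intro prod.cong) auto

lemma idx_nth_ge:
  assumes "I \<in> idx_set n k" "j < k"
  shows "j \<le> I ! j"
  using assms(2)
proof (induction j)
  case (Suc j)
  have "I ! j < I ! Suc j" using idx_setD(1,2)[OF assms(1)] Suc.prems
    by (intro sorted_wrt_nth_less[of "(<)" I j "Suc j"]) auto
  then show ?case using Suc by simp
qed simp

text \<open>The eigenvalues of the compound are products over increasing index lists. Such a list
  satisfies j \<le> I ! j, so for decreasing \<open>d\<close> the list \<open>[0..<k]\<close> gives
  the largest product.\<close>

lemma compound_le_iff:
  assumes U: "U \<in> unitary_mats n" and A: "A = U * rdiag n d * mat_adjoint U"
    and d: "\<And>i. i < n \<Longrightarrow> 0 \<le> d i" "\<And>i j. i \<le> j \<Longrightarrow> j < n \<Longrightarrow> d j \<le> d i" and k: "k \<le> n"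
  shows "qle (length (idx n k)) (compound n k A) (complex_of_real c \<cdot>\<^sub>m 1\<^sub>m (length (idx n k))) \<longleftrightarrow> (\<Prod>i<k. d i) \<le> c"
proof -
  let ?N = "length (idx n k)"
  have "compound n k A = compound n k U * rdiag ?N (\<lambda>a. \<Prod>i\<leftarrow>idx n k ! a. d i) * mat_adjoint (compound n k U)"
    unfolding A by (rule compound_udiag[OF unitary_matsD(1)[OF U]])
  from qle_scalar_iff[OF compound_unitary[OF U] this, of c]
  have "qle ?N (compound n k A) (complex_of_real c \<cdot>\<^sub>m 1\<^sub>m ?N) \<longleftrightarrow> (\<forall>a<?N. (\<Prod>i\<leftarrow>idx n k ! a. d i) \<le> c)" .
  also have "\<dots> \<longleftrightarrow> (\<forall>I\<in>idx_set n k. (\<Prod>i\<leftarrow>I. d i) \<le> c)"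
    by (simp add: idx(1)[symmetric] all_set_conv_all_nth)
  also have "\<dots> \<longleftrightarrow> (\<Prod>i<k. d i) \<le> c"
  proof
    assume *: "\<forall>I\<in>idx_set n k. (\<Prod>i\<leftarrow>I. d i) \<le> c"
    have "[0..<k] \<in> idx_set n k" using k by (auto simp: idx_set_def)
    from bspec[OF * this] show "(\<Prod>i<k. d i) \<le> c"
      by (simp add: prod.distinct_set_conv_list[symmetric] lessThan_atLeast0)
  next
    assume *: "(\<Prod>i<k. d i) \<le> c"
    show "\<forall>I\<in>idx_set n k. (\<Prod>i\<leftarrow>I. d i) \<le> c"
    proof
      fix I assume I: "I \<in> idx_set n k"
      have "(\<Prod>i\<leftarrow>I. d i) = (\<Prod>j<k. d (I ! j))"
        using idx_setD(1)[OF I] by (simp add: prod.list_conv_set_nth lessThan_atLeast0)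
      also have "\<dots> \<le> (\<Prod>i<k. d i)"
        using idx_setD(4)[OF I] idx_nth_ge[OF I] d by (intro prod_mono) auto
      finally show "(\<Prod>i\<leftarrow>I. d i) \<le> c" using * by simp
    qed
  qed
  finally show ?thesis .
qed

lemma det_udiag:
  assumes U: "U \<in> unitary_mats n"
  shows "det (U * rdiag n d * mat_adjoint U) = complex_of_real (\<Prod>i<n. d i)"
proof -
  note u = unitary_matsD[OF U]
  have "det (rdiag n d) = prod_list (diag_mat (rdiag n d))"
    by (rule det_upper_triangular[of _ n]) (auto simp: mat_diag_def)
  also have "diag_mat (rdiag n d) = map (\<lambda>i. complex_of_real (d i)) [0..<n]"
    by (auto simp: diag_mat_def mat_diag_def)
  finally have D: "det (rdiag n d) = complex_of_real (\<Prod>i<n. d i)"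
    by (simp add: prod.distinct_set_conv_list[symmetric] lessThan_atLeast0)
  have "det U * det (mat_adjoint U) = 1"
    using det_mult[of U n "mat_adjoint U"] u by simp
  moreover have "det (U * rdiag n d * mat_adjoint U) = det U * det (rdiag n d) * det (mat_adjoint U)"
    using u(1) by (simp add: det_mult[of _ n] mult_carrier_mat[of _ n n _ n])
  ultimately show ?thesis by (simp add: D algebra_simps)
qed

lemma log_majI:
  assumes X: "X \<in> psd_mats n" and Y: "Y \<in> psd_mats n" and det: "det X = det Y"
    and le: "\<And>k c. k \<le> n \<Longrightarrow> 0 \<le> c \<Longrightarrow>
      qle (length (idx n k)) (compound n k Y) (complex_of_real c \<cdot>\<^sub>m 1\<^sub>m (length (idx n k))) \<Longrightarrow>
      qle (length (idx n k)) (compound n k X) (complex_of_real c \<cdot>\<^sub>m 1\<^sub>m (length (idx n k)))"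
  shows "log_maj n X Y"
proof -
  obtain U d where U: "U \<in> unitary_mats n" "X = U * rdiag n d * mat_adjoint U"
    "\<And>i. i < n \<Longrightarrow> 0 \<le> d i" "\<And>i j. i \<le> j \<Longrightarrow> j < n \<Longrightarrow> d j \<le> d i" using psd_obtain_sorted[OF X] by blast
  obtain V e where V: "V \<in> unitary_mats n" "Y = V * rdiag n e * mat_adjoint V"
    "\<And>i. i < n \<Longrightarrow> 0 \<le> e i" "\<And>i j. i \<le> j \<Longrightarrow> j < n \<Longrightarrow> e j \<le> e i" using psd_obtain_sorted[OF Y] by blast
  have "(\<Prod>i<k. d i) \<le> (\<Prod>i<k. e i)" if k: "k \<le> n" for k
  proof -
    have "0 \<le> (\<Prod>i<k. e i)" using V(3) k by (intro prod_nonneg) auto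
    then show ?thesis
      \<comment> \<open>The hypothesis is used for the best bound on the compound of Y, with c the
        product of its k largest eigenvalues.\<close>
      using le[OF k] compound_le_iff[OF U k] compound_le_iff[OF V k] by blast
  qed
  moreover have "(\<Prod>i<n. d i) = (\<Prod>i<n. e i)"
    using det unfolding U(2) V(2) det_udiag[OF U(1)] det_udiag[OF V(1)] by (simp only: of_real_eq_iff)
  ultimately show ?thesis
    unfolding log_maj_def using eigvals_desc_prod[OF U(1,2,4)] eigvals_desc_prod[OF V(1,2,4)] by simp
qed

text \<open>The clause k = 1 of log-majorization compares the largest eigenvalues, that is, the best
  scalar bounds.\<close>

lemma log_maj_top:
  assumes X: "X \<in> psd_mats n" and Y: "Y \<in> psd_mats n" and lm: "log_maj n X Y" and n: "0 < n"
    and le: "qle n Y (complex_of_real c \<cdot>\<^sub>m 1\<^sub>m n)"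
  shows "qle n X (complex_of_real c \<cdot>\<^sub>m 1\<^sub>m n)"
proof -
  obtain U d where U: "U \<in> unitary_mats n" "X = U * rdiag n d * mat_adjoint U"
    "\<And>i. i < n \<Longrightarrow> 0 \<le> d i" "\<And>i j. i \<le> j \<Longrightarrow> j < n \<Longrightarrow> d j \<le> d i" using psd_obtain_sorted[OF X] by blast
  obtain V e where V: "V \<in> unitary_mats n" "Y = V * rdiag n e * mat_adjoint V"
    "\<And>i. i < n \<Longrightarrow> 0 \<le> e i" "\<And>i j. i \<le> j \<Longrightarrow> j < n \<Longrightarrow> e j \<le> e i" using psd_obtain_sorted[OF Y] by blast
  have "eigvals_desc X = map d [0..<n]" "eigvals_desc Y = map e [0..<n]"
    by (rule eigvals_desc_eq[OF U(1,2,4)] eigvals_desc_eq[OF V(1,2,4)]; simp)+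
  then have "d 0 \<le> e 0" using lm n unfolding log_maj_def by (auto dest!: bspec[of _ _ 1])
  moreover have "e 0 \<le> c" using le n qle_scalar_iff[OF V(1,2), of c] by blast
  ultimately have "\<forall>i<n. d i \<le> c" using U(4)[of 0] by force
  then show ?thesis using qle_scalar_iff[OF U(1,2)] by blast
qed

section \<open>Determinants\<close>

lemma det_psd:
  assumes "A \<in> psd_mats n"
  shows "det A = complex_of_real (Re (det A))" "0 \<le> Re (det A)" "det (pw A r) = complex_of_real (Re (det A) powr r)"
proof -
  obtain U d where U: "U \<in> unitary_mats n" "A = U * rdiag n d * mat_adjoint U"
    "\<And>f. mat_fun f A = U * rdiag n (\<lambda>i. f (d i)) * mat_adjoint U" "\<And>i. i < n \<Longrightarrow> 0 \<le> d i" 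
    using psd_obtain[OF assms] by blast
  define P where "P = (\<Prod>i<n. d i)"
  have D: "det A = complex_of_real P" unfolding U(2) P_def by (rule det_udiag[OF U(1)])
  have "0 \<le> P" unfolding P_def using U(4) by (intro prod_nonneg) auto
  then show "det A = complex_of_real (Re (det A))" "0 \<le> Re (det A)" by (simp_all add: D)
  have "(\<Prod>i<m. d i powr r) = (\<Prod>i<m. d i) powr r" if "m \<le> n" for m
    using that U(4) by (induction m) (auto simp: powr_mult prod_nonneg)
  then show "det (pw A r) = complex_of_real (Re (det A) powr r)"
    unfolding pw_def U(3) det_udiag[OF U(1)] D Re_complex_of_real P_def by simp
qed

lemma det_pd:
  assumes "A \<in> pd_mats n"
  shows "0 < Re (det A)"
proof -
  obtain U d where U: "U \<in> unitary_mats n" "A = U * rdiag n d * mat_adjoint U" "\<And>i. i < n \<Longrightarrow> 0 < d i" 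
    using pd_obtain[OF assms] by blast
  then show ?thesis unfolding U(2) det_udiag[OF U(1)] Re_complex_of_real by (intro prod_pos) auto
qed

lemma det_mean:
  assumes A: "A \<in> pd_mats n" and B: "B \<in> psd_mats n"
  shows "det (mean t A B) = complex_of_real (Re (det A) powr (1 - t) * Re (det B) powr t)"
proof -
  define a b where "a = Re (det A)" and "b = Re (det B)"
  have a: "0 < a" and b: "0 \<le> b" "det B = complex_of_real b"
    using det_pd[OF A] det_psd[OF B] by (auto simp: a_def b_def)
  note [simp] = A B psd_carrier[of _ n] mult_carrier_mat[of _ n n _ n] pw_psd[of _ n] mid_psd[of _ n]
  have N: "det (pw A (-1/2) * (B * pw A (-1/2))) = complex_of_real (a powr (-1/2) * (b * a powr (-1/2)))"
    by (simp add: det_mult[of _ n] det_psd(3)[of _ n] a_def[symmetric] b(2))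
  have "det (mean t A B) = complex_of_real (a powr (1/2) * ((a powr (-1/2) * (b * a powr (-1/2))) powr t * a powr (1/2)))"
    using det_psd(3)[of "pw A (-1/2) * (B * pw A (-1/2))" n t] unfolding N
    by (simp add: mean_def det_mult[of _ n] det_psd(3)[of _ n] a_def[symmetric])
  also have "a powr (1/2) * ((a powr (-1/2) * (b * a powr (-1/2))) powr t * a powr (1/2))
    = (a powr (1/2) * a powr (-1/2*t) * a powr (-1/2*t) * a powr (1/2)) * b powr t"
    using a b by (simp add: powr_mult powr_powr)
  also have "\<dots> = a powr (1 - t) * b powr t"
    unfolding powr_add[symmetric] by simp
  finally show ?thesis by (simp add: a_def b_def)
qed

text \<open>Both determinants equal det(A)^(1-\<alpha>) det(B)^\<alpha>, independently of p and
  q.\<close>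

lemma det_G_SG:
  assumes A: "A \<in> pd_mats n" and B: "B \<in> psd_mats n" and pq: "0 < p" "0 < q"
  shows "det (G_mean \<alpha> q A B) = det (SG_mean \<alpha> p A B)"
proof -
  define a b where "a = Re (det A)" and "b = Re (det B)"
  have a: "0 < a" and b: "0 \<le> b" using det_pd[OF A] det_psd[OF B] by (auto simp: a_def b_def)
  note [simp] = A B psd_carrier[of _ n] mult_carrier_mat[of _ n n _ n] pw_psd[of _ n] pw_pd[of _ n]
    mid_psd[of _ n] mean_psd[of _ n]
  have pw: "det (pw A r) = complex_of_real (a powr r)" "det (pw B r) = complex_of_real (b powr r)" for r
    by (simp_all add: det_psd(3)[of _ n] a_def b_def)
  have "Re (det (mean \<alpha> (pw A q) (pw B q))) = a powr (q * (1 - \<alpha>)) * b powr (q * \<alpha>)"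
    by (simp add: det_mean[of _ n] pw powr_powr)
  then have G: "det (G_mean \<alpha> q A B) = complex_of_real (a powr (1 - \<alpha>) * b powr \<alpha>)"
    using pq a b by (simp add: G_mean_pw[of _ n] det_psd(3)[of _ n] powr_mult powr_powr)
  define E where "E = mean (1/2) (pw A (-p)) (pw B p)"
  have [simp]: "E \<in> psd_mats n" by (simp add: E_def)
  have "Re (det E) = a powr (-p/2) * b powr (p/2)"
    by (simp add: E_def det_mean[of _ n] pw powr_powr)
  then have E: "det (pw E \<alpha>) = complex_of_real (a powr (-p/2*\<alpha>) * b powr (p/2*\<alpha>))"
    using a b by (simp add: det_psd(3)[of _ n] powr_mult powr_powr)
  have "Re (det (pw E \<alpha> * (pw A p * pw E \<alpha>))) =
    (a powr (-p/2*\<alpha>) * a powr p * a powr (-p/2*\<alpha>)) * (b powr (p/2*\<alpha>) * b powr (p/2*\<alpha>))"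
    by (simp add: det_mult[of _ n] pw E)
  also have "\<dots> = a powr (p * (1 - \<alpha>)) * b powr (p * \<alpha>)"
    unfolding powr_add[symmetric] by (simp add: algebra_simps)
  finally have "det (SG_mean \<alpha> p A B) = complex_of_real (a powr (1 - \<alpha>) * b powr \<alpha>)"
    using pq a b by (simp add: SG_mean_pw[of _ n] E_def[symmetric] det_psd(3)[of _ n] powr_mult powr_powr)
  then show ?thesis by (simp add: G)
qed

section \<open>The majorizations and the counterexample\<close>

text \<open>The first argument is made definite by \<open>fill\<close>; then \<open>G_le_SG\<close>
  is applied to the compounds of both arguments, in dimension
  \<open>length (idx n k)\<close>.\<close>

lemma log_maj_G_SG:
  assumes A: "A \<in> psd_mats n" and B: "B \<in> psd_mats n" and s: "loewner_le n (supp_proj B) (supp_proj A)"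
    and \<alpha>: "0 < \<alpha>" "\<alpha> < 1" and pq: "0 < p" "0 < q"
  shows "log_maj n (G_mean \<alpha> q A B) (SG_mean \<alpha> p A B)"
proof -
  define F where "F = fill A"
  have F: "F \<in> pd_mats n" unfolding F_def by (rule fill_pd[OF A])
  note psd = pd_psd[OF F] B
  have "log_maj n (G_mean \<alpha> q F B) (SG_mean \<alpha> p F B)"
  proof (rule log_majI[OF G_mean_psd[OF psd] SG_mean_psd[OF psd] det_G_SG[OF F B pq]])
    fix k c assume "0 \<le> (c :: real)"
      and "qle (length (idx n k)) (compound n k (SG_mean \<alpha> p F B)) (complex_of_real c \<cdot>\<^sub>m 1\<^sub>m (length (idx n k)))"
    then show "qle (length (idx n k)) (compound n k (G_mean \<alpha> q F B)) (complex_of_real c \<cdot>\<^sub>m 1\<^sub>m (length (idx n k)))"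
      unfolding compound_G_mean[OF psd] compound_SG_mean[OF psd]
      by (intro G_le_SG[OF compound_pd[OF F] compound_psd[OF B] \<alpha> pq])
  qed
  then show ?thesis unfolding F_def means_fill[OF A B s] .
qed

lemma log_maj_SG_G:
  assumes A: "A \<in> psd_mats n" and B: "B \<in> psd_mats n" and s: "loewner_le n (supp_proj B) (supp_proj A)"
    and \<alpha>: "1 < \<alpha>" and pq: "0 < p" "0 < q" and r: "p / q \<le> min 2 (\<alpha> / (\<alpha> - 1))"
  shows "log_maj n (SG_mean \<alpha> p A B) (G_mean \<alpha> q A B)"
proof -
  define F where "F = fill A"
  have F: "F \<in> pd_mats n" unfolding F_def by (rule fill_pd[OF A])
  note psd = pd_psd[OF F] B
  have "log_maj n (SG_mean \<alpha> p F B) (G_mean \<alpha> q F B)"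
  proof (rule log_majI[OF SG_mean_psd[OF psd] G_mean_psd[OF psd] det_G_SG[OF F B pq, symmetric]])
    fix k c assume "0 \<le> (c :: real)"
      and "qle (length (idx n k)) (compound n k (G_mean \<alpha> q F B)) (complex_of_real c \<cdot>\<^sub>m 1\<^sub>m (length (idx n k)))"
    then show "qle (length (idx n k)) (compound n k (SG_mean \<alpha> p F B)) (complex_of_real c \<cdot>\<^sub>m 1\<^sub>m (length (idx n k)))"
      unfolding compound_G_mean[OF psd] compound_SG_mean[OF psd]
      by (intro SG_le_G[OF compound_pd[OF F] compound_psd[OF B] \<alpha> pq r])
  qed
  then show ?thesis unfolding F_def means_fill[OF A B s] .
qed

text \<open>With \<open>F = diag(1, f)\<close> and \<open>H = E F E\<close>, the majorization would force \<open>H\<^bsup>r\<^esup> \<le> f\<^bsup>r/\<alpha>\<^esup> F\<^bsup>r(1-1/\<alpha>)\<^esup>\<close>.  The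
  upper left entry of the left-hand side is at least \<open>f\<^bsup>r\<^esup> / 16\<close>, that of the right-hand side is \<open>f\<^bsup>r/\<alpha>\<^esup>\<close>.\<close>

lemma counterexample:
  assumes \<alpha>: "1 < \<alpha>" and pq: "0 < p" "0 < q"
  shows "\<exists>A \<in> pd_mats 2. \<exists>B \<in> pd_mats 2. \<not> log_maj 2 (G_mean \<alpha> q A B) (SG_mean \<alpha> p A B)"
proof -
  \<comment> \<open>r \<le> q/p is required by \<open>G_mean_lower\<close>, and r \<le> 1 by
    \<open>qform_pw_lower\<close>.\<close>
  define r where "r = min (q / p) 1"
  have r: "0 < r" "r \<le> q / p" "r \<le> 1" using pq by (auto simp: r_def)
  define s where "s = r * (1 - 1/\<alpha>)"
  have s: "0 < s" using r \<alpha> by (simp add: s_def)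
  \<comment> \<open>The final inequality is f^r \<le> 16 f^(r/\<alpha>), that is f^s \<le> 16 since
    r = r/\<alpha> + s. The number 16 is the inverse square of the off-diagonal entry 1/4 of
    \<open>E\<close>.\<close>
  define f where "f = 17 powr (1 / s)"
  have f: "1 < f" "f powr s = 17" using s by (simp_all add: f_def powr_powr)
  define F where "F = rdiag 2 (\<lambda>i. if i = 0 then 1 else f)"
  \<comment> \<open>The eigenvalues of this matrix are 1/4 and 3/4, so 0 < E \<le> 1.\<close>
  define E where "E = mat 2 2 (\<lambda>(i,j). if i = j then 1/2 else 1/4 :: complex)"
  have U: "1\<^sub>m 2 \<in> unitary_mats 2" by (rule unitary_matsI) simp_all
  have F1: "F = 1\<^sub>m 2 * F * mat_adjoint (1\<^sub>m 2)" by (simp add: F_def)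
  have F: "F \<in> pd_mats 2" by (subst F1, unfold F_def, rule udiag_pd[OF U]) (use f in auto)
  have Ff: "qle 2 F (complex_of_real f \<cdot>\<^sub>m 1\<^sub>m 2)"
    using qle_scalar_iff[OF U F1[unfolded F_def], of f] f by (auto simp: F_def)
  have powF: "pw F s = rdiag 2 (\<lambda>i. (if i = 0 then 1 else f) powr s)"
    unfolding pw_def using mat_fun_eq[OF U F1[unfolded F_def], of "\<lambda>x. x powr s"] by (simp add: F_def)
  have E [simp]: "E \<in> carrier_mat 2 2" by (simp add: E_def)
  have Eh: "herm 2 E" by (rule hermI[OF E]) (intro eq_matI, auto simp: E_def)
  \<comment> \<open>Both E and 1 - E are written as a quarter of the identity plus a square, which
    gives definiteness and the bound E \<le> 1 at once.\<close>
  have qE: "qform E v = (1/4) * (cmod (v $ 0 + v $ 1))\<^sup>2 + (1/4) * qform (1\<^sub>m 2) v"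
    "qform (1\<^sub>m 2) v - qform E v = (1/4) * (cmod (v $ 0 - v $ 1))\<^sup>2 + (1/4) * qform (1\<^sub>m 2) v"
    if "v \<in> carrier_vec 2" for v
  proof -
    have "{..<2 :: nat} = {0, 1}" by auto
    then show "qform E v = (1/4) * (cmod (v $ 0 + v $ 1))\<^sup>2 + (1/4) * qform (1\<^sub>m 2) v"
      "qform (1\<^sub>m 2) v - qform E v = (1/4) * (cmod (v $ 0 - v $ 1))\<^sup>2 + (1/4) * qform (1\<^sub>m 2) v"
      unfolding qform_entries[OF E that] qform_one[OF that]
      by (simp_all add: E_def cmod_power2) (simp_all add: field_simps power2_eq_square)
  qed
  have Epd: "E \<in> pd_mats 2"
  proof (rule pdI[OF Eh])
    fix v :: "complex vec" assume v: "v \<in> carrier_vec 2" "v \<noteq> 0\<^sub>v 2"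
    show "0 < qform E v" unfolding qE(1)[OF v(1)] using qform_one_pos[OF v] by (intro add_nonneg_pos) auto
  qed
  have E1: "qle 2 E (1\<^sub>m 2)" unfolding qle_def
  proof
    fix v :: "complex vec" assume v: "v \<in> carrier_vec 2"
    have "0 \<le> (1/4) * (cmod (v $ 0 - v $ 1))\<^sup>2 + (1/4) * qform (1\<^sub>m 2) v"
      using qform_one_nonneg[OF v] by (intro add_nonneg_nonneg) auto
    then show "qform E v \<le> qform (1\<^sub>m 2) v" unfolding qE(2)[OF v, symmetric] by simp
  qed
  define H where "H = E * (F * E)"
  have H: "H \<in> pd_mats 2"
    using mid_pd[OF Epd F, of 1] pw_1[of E 2] Epd by (simp add: H_def)
  have Hf: "qle 2 H (complex_of_real f \<cdot>\<^sub>m 1\<^sub>m 2)"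
  proof -
    have "qle 2 (E * (F * E)) (E * ((complex_of_real f \<cdot>\<^sub>m 1\<^sub>m 2) * E))"
      using F Eh Ff by (intro qle_sandwich) auto
    also have "\<dots> = complex_of_real f \<cdot>\<^sub>m pw E 2"
      using pw_mul[of E 2 1 1] pw_1[of E 2] Epd
      by (simp add: mult_smult_distrib[of _ 2 2 _ 2] mult_smult_assoc_mat[of _ 2 2 _ 2])
    also have "qle 2 \<dots> (complex_of_real f \<cdot>\<^sub>m 1\<^sub>m 2)"
      using Epd E1 f by (intro qle_smult pw_le_one) (auto simp: pd_carrier[of _ 2] pw_pd[of _ 2])
    finally show ?thesis by (simp add: H_def)
  qed
  \<comment> \<open>The roots are taken so that A^p = F and B^p = H.\<close>
  let ?A = "pw F (1/p)" and ?B = "pw H (1/p)"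
  have AB: "?A \<in> pd_mats 2" "?B \<in> pd_mats 2" using F H by (simp_all add: pw_pd[of _ 2])
  have "\<not> log_maj 2 (G_mean \<alpha> q ?A ?B) (SG_mean \<alpha> p ?A ?B)"
  proof
    assume lm: "log_maj 2 (G_mean \<alpha> q ?A ?B) (SG_mean \<alpha> p ?A ?B)"
    have "qle 2 (SG_mean \<alpha> p ?A ?B) (complex_of_real (f powr (1/p)) \<cdot>\<^sub>m 1\<^sub>m 2)"
      unfolding H_def using F Epd \<alpha> pq f Ff E1 by (intro SG_mean_bound) auto
    then have "qle 2 (G_mean \<alpha> q ?A ?B) (complex_of_real (f powr (1/p)) \<cdot>\<^sub>m 1\<^sub>m 2)"
      using AB by (intro log_maj_top[OF _ _ lm] G_mean_psd SG_mean_psd) auto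
    then have le: "qle 2 (pw H r) (complex_of_real (f powr (r/\<alpha>)) \<cdot>\<^sub>m pw F s)"
      unfolding s_def using F H \<alpha> pq f r by (intro G_mean_lower) auto
    let ?e = "unit_vec 2 0 :: complex vec"
    have e: "?e \<in> carrier_vec 2" by simp
    have Fs: "pw F s \<in> carrier_mat 2 2" using F by (simp add: pw_pd[of _ 2] pd_carrier[of _ 2])
    have "qform (pw F s) ?e = 1"
      unfolding powF by (subst qform_entries[of _ 2]) (auto simp: mat_diag_def numeral_2_eq_2)
    then have "qform (pw H r) ?e \<le> f powr (r/\<alpha>)"
      using bspec[OF le[unfolded qle_def] e] qform_smult[OF Fs e] by simp
    moreover have "qform H ?e = qform F (E *\<^sub>v ?e)"
      using qform_mult[of F 2 E ?e] Eh F by (simp add: H_def pd_carrier[of _ 2])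
    moreover have "qform F (E *\<^sub>v ?e) = 1/4 + f/16"
    proof -
      have two: "{..<2 :: nat} = {0, 1}" by auto
      have w: "(E *\<^sub>v ?e) $ 0 = 1/2" "(E *\<^sub>v ?e) $ Suc 0 = 1/4" by (simp_all add: E_def)
      show ?thesis
        unfolding qform_entries[OF pd_carrier[OF F] mult_mat_vec_carrier[OF E e]] two
        by (simp add: F_def mat_diag_def w)
    qed
    ultimately have "f powr (r - 1) * (1/4 + f/16) \<le> f powr (r/\<alpha>)"
      using qform_pw_lower[OF H Hf r(3) e] by simp
    moreover have "f powr (r - 1) * (f / 16) \<le> f powr (r - 1) * (1/4 + f/16)"
      using f by (intro mult_left_mono) auto
    moreover have "f powr (r - 1) * (f / 16) = f powr r / 16"
      using f by (simp add: powr_mult_base mult.commute)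
    ultimately have "f powr r \<le> 16 * f powr (r/\<alpha>)" by simp
    moreover have "f powr r = f powr (r/\<alpha>) * f powr s"
      unfolding powr_add[symmetric] by (simp add: s_def algebra_simps)
    ultimately show False using f by simp
  qed
  then show ?thesis using AB by blast
qed

theorem proposition3p13:
  shows "(\<forall>\<alpha> p q :: real. 0 < \<alpha> \<and> \<alpha> < 1 \<and> 0 < p \<and> 0 < q \<longrightarrow>
      (\<forall>n. \<forall>A \<in> psd_mats n. \<forall>B \<in> psd_mats n.
         loewner_le n (supp_proj B) (supp_proj A) \<longrightarrow>
         log_maj n (G_mean \<alpha> q A B) (SG_mean \<alpha> p A B)))
    \<and> (\<forall>\<alpha> p q :: real. 1 < \<alpha> \<and> 0 < p \<and> 0 < q \<longrightarrow>
      (\<exists>A \<in> pd_mats 2. \<exists>B \<in> pd_mats 2.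
         \<not> log_maj 2 (G_mean \<alpha> q A B) (SG_mean \<alpha> p A B)))
    \<and> (\<forall>\<alpha> p q :: real. 1 < \<alpha> \<and> 0 < p \<and> 0 < q \<and> p / q \<le> min 2 (\<alpha> / (\<alpha> - 1)) \<longrightarrow>
      (\<forall>n. \<forall>A \<in> psd_mats n. \<forall>B \<in> psd_mats n.
         loewner_le n (supp_proj B) (supp_proj A) \<longrightarrow>
         log_maj n (SG_mean \<alpha> p A B) (G_mean \<alpha> q A B)))"
  using log_maj_G_SG counterexample log_maj_SG_G by blast

end
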